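(* Let $d\ge 2$ and $1\le k\le d-1$. Let $s\in\mathbb{R}$ and $f\in H^s(\mathbb{R}^d)$ with $\operatorname{supp}(f)\subseteq\overline{\Omega}$ for some bounded open set $\Omega\subset\mathbb{R}^d$. Then there exist constants $c_{s,d,k},C_{s,d,k}>0$ such that $$c_{s,d,k}\,\|f\|_{H^s(\mathbb{R}^d)}\le \|Pf\|_{H^{s+k/2}(\mathcal{G}_{k,d})}\le C_{s,d,k}\,\|f\|_{H^s(\mathbb{R}^d)},$$ where $P$ is the $k$-plane transform.
   Context: $G_{k,d}$ is the Grassmannian of $k$-dimensional linear subspaces of $\mathbb{R}^d$, with its rotation-invariant measure $d\alpha$, normalized to have total mass $|G_{k,d}|=\frac{|\mathbb{S}^{d-1}||\mathbb{S}^{d-2}|\cdots|\mathbb{S}^{d-k}|}{2|\mathbb{S}^{k-1}||\mathbb{S}^{k-2}|\cdots|\mathbb{S}^1|}$ for $k\ge2$ and $|G_{1,d}|=|\mathbb{S}^{d-1}|/2$. The affine Grassmannian is $\mathcal{G}_{k,d}=\{(\alpha,y):\alpha\in G_{k,d},\ y\in\alpha^\perp\}$, where $(\alpha,y)$ represents the affine plane $\alpha+y$ and $\alpha^\perp$ is the orthogonal complement of $\alpha$ (of dimension $d-k$). For $f$ in the Schwartz space $\mathcal{S}(\mathbb{R}^d)$ the $k$-plane transform is $(Pf)(\alpha,y)=\int_{\alpha} f(x+y)\,dx$, with $dx$ Lebesgue measure on $\alpha$. For a compactly supported distribution $f$, $Pf(\alpha,\cdot)$ is the compactly supported distribution on $\alpha^\perp$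 given by $\langle Pf(\alpha,\cdot),\psi\rangle=\langle f,\psi\circ\pi_{\alpha^\perp}\rangle$ for $\psi\in C^\infty(\alpha^\perp)$, where $\pi_{\alpha^\perp}$ is the orthogonal projection of $\mathbb{R}^d$ onto $\alpha^\perp$; this agrees with the integral formula for functions. The Fourier transform is unitary: $\hat f(\xi)=(2\pi)^{-d/2}\int_{\mathbb{R}^d}e^{-ix\cdot\xi}f(x)\,dx$. The fiberwise Fourier transform of $u$ on $\mathcal{G}_{k,d}$ is $\hat u(\alpha,\eta)=(2\pi)^{-(d-k)/2}\int_{\alpha^\perp}e^{-iy\cdot\eta}u(\alpha,y)\,dy$, $\eta\in\alpha^\perp$ (extended to distributions in the fiber variable). The Sobolev norms, for $\sigma\in\mathbb{R}$, are $\|f\|_{H^\sigma(\mathbb{R}^d)}^2=\int_{\mathbb{R}^d}(1+|\xi|^2)^\sigma|\hat f(\xi)|^2\,d\xi$ and $\|u\|_{H^\sigma(\mathcal{G}_{k,d})}^2=\int_{G_{k,d}}\int_{\alpha^\perp}(1+|\eta|^2)^\sigma|\hat u(\alpha,\eta)|^2\,d\eta\,d\alpha$. $H^\sigma(\mathbb{R}^d)$ is the completion of $\mathcal{S}(\mathbb{R}^d)$ in its norm, and $H^\sigma(\mathcal{G}_{k,d})$ is the completion of the space of test functions on $\mathcal{G}_{k,d}$ in its norm.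
   Formalization: The upper constant C may depend on Ω as well as on s, d, k: dilating f makes the ratio of the norms of Pf and f grow like λ^{k/2}, so no C depending only on s, d, k can serve every bounded Ω. The lower constant c depends only on s, d, k. *)

theory Defs
  imports "HOL-Analysis.Analysis"
begin

section \<open>Smooth functions, test functions and Schwartz functions\<close>

definition iter_deriv :: "'a::euclidean_space list \<Rightarrow> ('a \<Rightarrow> complex) \<Rightarrow> 'a \<Rightarrow> complex" where
  "iter_deriv vs \<phi> = foldr (\<lambda>v g x. frechet_derivative g (at x) v) vs \<phi>"

definition smooth :: "('a::euclidean_space \<Rightarrow> complex) \<Rightarrow> bool" where
  "smooth \<phi> \<longleftrightarrow> (\<forall>vs x. set vs \<subseteq> Basis \<longrightarrow> iter_deriv vs \<phi> differentiable (at x))"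

definition fun_support :: "('a::euclidean_space \<Rightarrow> complex) \<Rightarrow> 'a set" where
  "fun_support \<phi> = closure {x. \<phi> x \<noteq> 0}"

definition test_functions :: "('a::euclidean_space \<Rightarrow> complex) set" where
  "test_functions = {\<phi>. smooth \<phi> \<and> compact (fun_support \<phi>)}"

definition schwartz_space :: "('a::euclidean_space \<Rightarrow> complex) set" where
  "schwartz_space = {\<phi>. smooth \<phi> \<and>
     (\<forall>vs N. set vs \<subseteq> Basis \<longrightarrow> bounded (range (\<lambda>x. (1 + norm x) ^ N *\<^sub>R iter_deriv vs \<phi> x)))}"

definition schwartz_seminorm :: "nat \<Rightarrow> ('a::euclidean_space \<Rightarrow> complex) \<Rightarrow> real" where
  "schwartz_seminorm N \<phi> =
     (\<Sum>vs | set vs \<subseteq> Basis \<and> length vs \<le> N. SUP x. (1 + norm x) ^ N * norm (iter_deriv vs \<phi> x))"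


section \<open>Tempered distributions\<close>

text \<open>
  A distribution is a functional on all functions of type \<^typ>\<open>'a \<Rightarrow> complex\<close>; only its values on
  Schwartz functions are meaningful.
\<close>

definition tempered_distribution :: "(('a::euclidean_space \<Rightarrow> complex) \<Rightarrow> complex) \<Rightarrow> bool" where
  "tempered_distribution f \<longleftrightarrow>
     (\<forall>\<phi>\<in>schwartz_space. \<forall>\<psi>\<in>schwartz_space. f (\<lambda>x. \<phi> x + \<psi> x) = f \<phi> + f \<psi>) \<and>
     (\<forall>a. \<forall>\<phi>\<in>schwartz_space. f (\<lambda>x. a * \<phi> x) = a * f \<phi>) \<and>
     (\<exists>C N. \<forall>\<phi>\<in>schwartz_space. norm (f \<phi>) \<le> C * schwartz_seminorm N \<phi>)"

definition dist_support :: "(('a::euclidean_space \<Rightarrow> complex) \<Rightarrow> complex) \<Rightarrow> 'a set" where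
  "dist_support f =
     {x. \<forall>U. open U \<and> x \<in> U \<longrightarrow> (\<exists>\<phi>\<in>test_functions. fun_support \<phi> \<subseteq> U \<and> f \<phi> \<noteq> 0)}"

text \<open>
  The pairing of a compactly supported distribution with an arbitrary smooth function, by means of a
  cutoff function equal to 1 near the support. The value does not depend on the cutoff chosen.
\<close>

definition cutoff :: "(('a::euclidean_space \<Rightarrow> complex) \<Rightarrow> complex) \<Rightarrow> 'a \<Rightarrow> complex" where
  "cutoff f = (SOME h. h \<in> test_functions \<and>
     (\<exists>U. open U \<and> dist_support f \<subseteq> U \<and> (\<forall>x\<in>U. h x = 1)))"

definition pairing ::
    "(('a::euclidean_space \<Rightarrow> complex) \<Rightarrow> complex) \<Rightarrow> ('a \<Rightarrow> complex) \<Rightarrow> complex" where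
  "pairing f \<phi> = f (\<lambda>x. cutoff f x * \<phi> x)"


section \<open>Fourier transform and Sobolev spaces on the whole space\<close>

definition fourier :: "('a::euclidean_space \<Rightarrow> complex) \<Rightarrow> 'a \<Rightarrow> complex" where
  "fourier \<phi> \<xi> = complex_of_real ((2 * pi) powr (- real DIM('a) / 2)) *
     (LINT x|lborel. cis (- (x \<bullet> \<xi>)) * \<phi> x)"

text \<open>
  \<open>dist_fourier f\<close> is a function representing the distributional Fourier transform of \<open>f\<close>, which is
  defined by duality. It is unique up to null sets, and is used only for distributions whose
  Fourier transform is a function, such as the elements of a Sobolev space.
\<close>

definition dist_fourier :: "(('a::euclidean_space \<Rightarrow> complex) \<Rightarrow> complex) \<Rightarrow> 'a \<Rightarrow> complex" where
  "dist_fourier f = (SOME g. g \<in> borel_measurable borel \<and>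
     (\<forall>\<phi>\<in>schwartz_space. integrable lborel (\<lambda>\<xi>. g \<xi> * \<phi> \<xi>) \<and>
        (LINT \<xi>|lborel. g \<xi> * \<phi> \<xi>) = f (fourier \<phi>)))"

definition ennreal_sqrt :: "ennreal \<Rightarrow> ennreal" where
  "ennreal_sqrt t = (if t = \<infinity> then \<infinity> else ennreal (sqrt (enn2real t)))"

definition weighted_L2_norm :: "real \<Rightarrow> ('a::euclidean_space \<Rightarrow> complex) \<Rightarrow> ennreal" where
  "weighted_L2_norm s g =
     ennreal_sqrt (\<integral>\<^sup>+ \<xi>. ennreal ((1 + (norm \<xi>)\<^sup>2) powr s * (norm (g \<xi>))\<^sup>2) \<partial>lborel)"

definition sobolev_norm :: "real \<Rightarrow> (('a::euclidean_space \<Rightarrow> complex) \<Rightarrow> complex) \<Rightarrow> ennreal" where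
  "sobolev_norm s f = weighted_L2_norm s (dist_fourier f)"

text \<open>
  The completion of the Schwartz space in the Sobolev norm, realized inside the tempered
  distributions: the class of a Cauchy sequence is identified with its distributional limit.
\<close>

definition sobolev_space :: "real \<Rightarrow> (('a::euclidean_space \<Rightarrow> complex) \<Rightarrow> complex) set" where
  "sobolev_space s = {f. tempered_distribution f \<and>
     (\<exists>\<phi>::nat \<Rightarrow> 'a \<Rightarrow> complex. (\<forall>n. \<phi> n \<in> schwartz_space) \<and>
        (\<forall>e>0. \<exists>N. \<forall>m\<ge>N. \<forall>n\<ge>N.
           weighted_L2_norm s (fourier (\<lambda>x. \<phi> m x - \<phi> n x)) < ennreal e) \<and>
        (\<forall>\<psi>\<in>schwartz_space. (\<lambda>n. LINT x|lborel. \<phi> n x * \<psi> x) \<longlonglongrightarrow> f \<psi>))}"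


section \<open>The Grassmannian\<close>

definition grassmannian :: "nat \<Rightarrow> 'a::euclidean_space set set" where
  "grassmannian k = {\<alpha>. subspace \<alpha> \<and> dim \<alpha> = k}"

definition orth_proj :: "'a::euclidean_space set \<Rightarrow> 'a \<Rightarrow> 'a" where
  "orth_proj V x = (THE p. p \<in> V \<and> x - p \<in> V\<^sup>\<bottom>)"

text \<open>
  The Grassmannian carries the topology induced by its embedding \<open>\<alpha> \<mapsto> orth_proj \<alpha>\<close> into
  the space of linear operators; this is the resulting Borel \<open>\<sigma>\<close>-algebra.
\<close>

definition grassmannian_borel :: "nat \<Rightarrow> 'a::euclidean_space set measure" where
  "grassmannian_borel k =
     vimage_algebra (grassmannian k) (\<lambda>\<alpha>. Blinfun (orth_proj \<alpha>)) borel"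

text \<open>\<open>sphere_area n\<close> is the surface area of the unit sphere of dimension \<open>n\<close>.\<close>

definition sphere_area :: "nat \<Rightarrow> real" where
  "sphere_area n = 2 * pi powr (real (n + 1) / 2) / Gamma (real (n + 1) / 2)"

text \<open>For \<open>k = 1\<close> the denominator is 2, in accordance with the separate convention for lines.\<close>

definition grassmannian_mass :: "nat \<Rightarrow> nat \<Rightarrow> real" where
  "grassmannian_mass k d =
     (\<Prod>j=d-k..d-1. sphere_area j) / (2 * (\<Prod>j=1..k-1. sphere_area j))"

text \<open>These conditions determine the measure uniquely.\<close>

definition invariant_grassmannian_measure :: "nat \<Rightarrow> 'a::euclidean_space set measure \<Rightarrow> bool" where
  "invariant_grassmannian_measure k \<mu> \<longleftrightarrow>
     space \<mu> = grassmannian k \<and>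
     sets \<mu> = sets (grassmannian_borel k) \<and>
     (\<forall>R. orthogonal_transformation R \<longrightarrow> distr \<mu> \<mu> (\<lambda>\<alpha>. R ` \<alpha>) = \<mu>) \<and>
     emeasure \<mu> (grassmannian k) = ennreal (grassmannian_mass k DIM('a))"


section \<open>The k-plane transform and Sobolev norms on the affine Grassmannian\<close>

text \<open>
  Lebesgue measure on a subspace, as a measure on the ambient space concentrated on it: the image of
  the product Lebesgue measure under orthonormal coordinates. It does not depend on the basis chosen.
\<close>

definition orthonormal_basis :: "'a::euclidean_space set \<Rightarrow> 'a set" where
  "orthonormal_basis V =
     (SOME B. B \<subseteq> V \<and> pairwise orthogonal B \<and> (\<forall>b\<in>B. norm b = 1) \<and> span B = V)"

definition subspace_lborel :: "'a::euclidean_space set \<Rightarrow> 'a measure" where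
  "subspace_lborel V =
     distr (\<Pi>\<^sub>M b\<in>orthonormal_basis V. lborel) borel (\<lambda>c. \<Sum>b\<in>orthonormal_basis V. c b *\<^sub>R b)"

text \<open>
  For a compactly supported distribution \<open>f\<close>, \<open>kplane_transform f \<alpha>\<close> is the distribution
  on the orthogonal complement of \<open>\<alpha>\<close>. Functions on the complement are represented by functions
  on the ambient space, of which only the values on the complement are used.
\<close>

definition kplane_transform ::
    "(('a::euclidean_space \<Rightarrow> complex) \<Rightarrow> complex) \<Rightarrow> 'a set \<Rightarrow> ('a \<Rightarrow> complex) \<Rightarrow> complex" where
  "kplane_transform f \<alpha> \<psi> = pairing f (\<psi> \<circ> orth_proj (\<alpha>\<^sup>\<bottom>))"

text \<open>
  The Fourier transform of the compactly supported distribution \<open>u \<alpha>\<close> on the fiber over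
  \<open>\<alpha>\<close>, evaluated at \<open>\<eta>\<close> in the fiber: the integral against the exponential is the
  pairing of \<open>u \<alpha>\<close> with this smooth function.
\<close>

definition fiber_fourier ::
    "('a::euclidean_space set \<Rightarrow> ('a \<Rightarrow> complex) \<Rightarrow> complex) \<Rightarrow> 'a set \<Rightarrow> 'a \<Rightarrow> complex" where
  "fiber_fourier u \<alpha> \<eta> = complex_of_real ((2 * pi) powr (- real (dim (\<alpha>\<^sup>\<bottom>)) / 2)) *
     u \<alpha> (\<lambda>y. cis (- (y \<bullet> \<eta>)))"

definition affine_grassmannian_sobolev_norm ::
    "'a::euclidean_space set measure \<Rightarrow> real \<Rightarrow>
     ('a set \<Rightarrow> ('a \<Rightarrow> complex) \<Rightarrow> complex) \<Rightarrow> ennreal" where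
  "affine_grassmannian_sobolev_norm \<mu> \<sigma> u =
     ennreal_sqrt (\<integral>\<^sup>+ \<alpha>. (\<integral>\<^sup>+ \<eta>.
       ennreal ((1 + (norm \<eta>)\<^sup>2) powr \<sigma> * (norm (fiber_fourier u \<alpha> \<eta>))\<^sup>2)
         \<partial>subspace_lborel (\<alpha>\<^sup>\<bottom>)) \<partial>\<mu>)"

end

theory Submission
  imports Defs "HOL-Probability.Probability"
begin

text \<open>
  Put \<open>F \<xi> = (2\<pi>)\<^sup>-\<^sup>d\<^sup>/\<^sup>2 \<langle>f, e\<^sup>-\<^sup>i\<^sup>x\<^sup>\<xi>\<rangle>\<close>. The fiber over \<open>\<alpha>\<close> of the Fourier transform of
  \<open>Pf\<close> is \<open>(2\<pi>)\<^sup>k\<^sup>/\<^sup>2 F\<close> restricted to the orthogonal complement of \<open>\<alpha>\<close>, and integrating a function over all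
  complements amounts to integrating it over the whole space against a multiple of
  \<open>|\<xi>|\<^sup>-\<^sup>k\<close>, because up to a factor there is only one measure on the punctured space that is invariant
  under similarities. So both norms are weighted \<open>L\<^sup>2\<close> norms of \<open>F\<close>, and the ratio of the weights is
  \<open>(1 + |\<xi>|\<^sup>2)\<^sup>k\<^sup>/\<^sup>2 |\<xi>|\<^sup>-\<^sup>k\<close>. It is at least 1, and bounded for \<open>|\<xi>| \<ge> 1\<close>. Near the origin it is still integrable,
  and there \<open>|F \<xi>|\<close> is at most a multiple of the Sobolev norm, by the duality of \<open>H\<^sup>s\<close> and \<open>H\<^sup>-\<^sup>s\<close> applied
  to a cutoff times an exponential; this is where the support enters.
\<close>

section \<open>Lebesgue measure on subspaces\<close>

text \<open>Restricting a Fourier transform to a subspace means evaluating it on a null set, so the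
  fiber norms call for a function with values at every point, whereas \<open>dist_fourier f\<close>
  is determined only almost everywhere. The function \<open>hat\<close> supplies these values and
  has to be identified with \<open>dist_fourier f\<close> before the norms can be compared. Three
  objects are chosen by \<open>SOME\<close>: the bases of the fibers, the cutoffs and
  \<open>dist_fourier f\<close>. Each is traded for a description free of the choice: a Gaussian
  integral over the whole space, independence of the cutoff, and equality almost everywhere with
  \<open>hat\<close>. The constant in the integral formula over the complements is never computed.
  It exists by uniqueness of invariant measures, is positive because a Gaussian has a positive
  integral, and \<open>inverse (norm x ^ k)\<close> is integrable near the origin because the
  averaged fiber measure of a ball is finite. The lower estimate is pointwise in the weights, hence
  uniform in \<Omega>. The upper constant depends on \<Omega> through one cutoff that serves all f
  at the same time.\<close>

lemma ennreal_mult_right_imp_eq: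
  fixes a b c :: ennreal
  shows "a * c = b * c \<Longrightarrow> c \<noteq> 0 \<Longrightarrow> c \<noteq> \<infinity> \<Longrightarrow> a = b"
  using ennreal_mult_cancel_left[of c a b] by (auto simp: mult.commute)

lemma orthogonal_transformation_bounded_linear:
  fixes T :: "'a::euclidean_space \<Rightarrow> 'a"
  shows "orthogonal_transformation T \<Longrightarrow> bounded_linear T"
  using orthogonal_transformation_linear linear_conv_bounded_linear by blast

lemma orthogonal_transformation_measurable:
  fixes T :: "'a::euclidean_space \<Rightarrow> 'a"
  shows "orthogonal_transformation T \<Longrightarrow> T \<in> borel_measurable borel"
  by (intro borel_measurable_continuous_onI linear_continuous_on orthogonal_transformation_bounded_linear)

lemma nn_integral_lborel_translation:
  fixes g :: "'a::euclidean_space \<Rightarrow> ennreal"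
  assumes [measurable]: "g \<in> borel_measurable borel"
  shows "(\<integral>\<^sup>+x. g (x + a) \<partial>lborel) = (\<integral>\<^sup>+x. g x \<partial>lborel)"
proof -
  have "(\<integral>\<^sup>+x. g x \<partial>lborel) = (\<integral>\<^sup>+x. g x \<partial>distr lborel borel ((+) a))"
    by (simp add: lborel_distr_plus)
  also have "\<dots> = (\<integral>\<^sup>+x. g (x + a) \<partial>lborel)"
    by (subst nn_integral_distr) (simp_all add: add.commute)
  finally show ?thesis by simp
qed

text \<open>The unit ball is invariant under T and calibrates the measure. The integral of
  \<open>indicator A (T x + y)\<close> over all x and over y in the ball is evaluated in both
  orders: translating x by \<open>S y\<close> produces the measure of the preimage of A, translating
  y by \<open>T x\<close> produces that of A, each times the volume of the ball.\<close>

lemma lborel_distr_orthogonal: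
  fixes T :: "'a::euclidean_space \<Rightarrow> 'a"
  assumes T: "orthogonal_transformation T"
  shows "distr lborel borel T = lborel"
proof (rule measure_eqI)
  fix A :: "'a set" assume "A \<in> sets (distr lborel borel T)"
  then have A[measurable]: "A \<in> sets borel" by simp
  have ball[measurable]: "ball (0::'a) 1 \<in> sets borel" by (rule borel_open) simp
  note Tm[measurable] = orthogonal_transformation_measurable[OF T]
  define S where "S = inv T"
  have ST: "T (S y) = y" for y
    unfolding S_def by (simp add: T orthogonal_transformation_surj surj_f_inv_f)
  have lin: "T (x + y) = T x + T y" for x y
    using T by (simp add: linear_add orthogonal_transformation_linear)
  let ?h = "indicator (ball 0 1) :: 'a \<Rightarrow> ennreal" and ?g = "indicator A :: 'a \<Rightarrow> ennreal"
  have tr: "(\<integral>\<^sup>+x. ?g (T x + y) \<partial>lborel) = (\<integral>\<^sup>+x. ?g (T x) \<partial>lborel)" for y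
    using nn_integral_lborel_translation[of "\<lambda>x. ?g (T x)" "S y"] by (simp add: lin ST)
  have "(\<integral>\<^sup>+x. ?g (T x) \<partial>lborel) * (\<integral>\<^sup>+y. ?h y \<partial>lborel) = (\<integral>\<^sup>+y. (\<integral>\<^sup>+x. ?g (T x + y) * ?h y \<partial>lborel) \<partial>lborel)"
  proof -
    have *: "(\<integral>\<^sup>+x. ?g (T x + y) * ?h y \<partial>lborel) = (\<integral>\<^sup>+x. ?g (T x) \<partial>lborel) * ?h y" for y
      by (subst nn_integral_multc) (auto simp: tr)
    show ?thesis
      unfolding * by (rule nn_integral_cmult[symmetric]) auto
  qed
  also have "\<dots> = (\<integral>\<^sup>+x. (\<integral>\<^sup>+y. ?g (T x + y) * ?h y \<partial>lborel) \<partial>lborel)"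
    by (rule lborel_pair.Fubini') measurable
  also have "\<dots> = (\<integral>\<^sup>+x. (\<integral>\<^sup>+y. ?g y * ?h (y - T x) \<partial>lborel) \<partial>lborel)"
  proof (rule nn_integral_cong)
    fix x
    show "(\<integral>\<^sup>+y. ?g (T x + y) * ?h y \<partial>lborel) = (\<integral>\<^sup>+y. ?g y * ?h (y - T x) \<partial>lborel)"
      using nn_integral_lborel_translation[of "\<lambda>y. ?g y * ?h (y - T x)" "T x"]
      by (simp add: add.commute)
  qed
  also have "\<dots> = (\<integral>\<^sup>+y. (\<integral>\<^sup>+x. ?g y * ?h (y - T x) \<partial>lborel) \<partial>lborel)"
    by (rule lborel_pair.Fubini') measurable
  also have "\<dots> = (\<integral>\<^sup>+y. ?g y * (\<integral>\<^sup>+x. ?h x \<partial>lborel) \<partial>lborel)"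
  proof (rule nn_integral_cong)
    fix y
    have "(\<integral>\<^sup>+x. ?h (y - T x) \<partial>lborel) = (\<integral>\<^sup>+x. ?h (y - T (x + S y)) \<partial>lborel)"
      by (rule nn_integral_lborel_translation[symmetric]) measurable
    also have "\<dots> = (\<integral>\<^sup>+x. ?h x \<partial>lborel)"
      by (rule nn_integral_cong)
        (simp add: lin ST indicator_def orthogonal_transformation_norm[OF T])
    finally show "(\<integral>\<^sup>+x. ?g y * ?h (y - T x) \<partial>lborel) = ?g y * (\<integral>\<^sup>+x. ?h x \<partial>lborel)"
      by (subst nn_integral_cmult) auto
  qed
  also have "\<dots> = (\<integral>\<^sup>+x. ?g x \<partial>lborel) * (\<integral>\<^sup>+y. ?h y \<partial>lborel)"
    by (subst nn_integral_multc) auto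
  finally have eq: "(\<integral>\<^sup>+x. ?g (T x) \<partial>lborel) * emeasure lborel (ball (0::'a) 1) = emeasure lborel A * emeasure lborel (ball (0::'a) 1)"
    by simp
  have "emeasure lborel (ball (0::'a) 1) \<noteq> \<infinity>"
    using emeasure_lborel_ball_finite[of "0::'a" 1] by simp
  moreover have "emeasure lborel (ball (0::'a) 1) \<noteq> 0"
    using less_imp_neq[OF unit_ball_vol_pos[of "real DIM('a)"]] by (simp add: emeasure_ball)
  moreover have "(\<integral>\<^sup>+x. ?g (T x) \<partial>lborel) = emeasure (distr lborel borel T) A"
    using nn_integral_distr[of T lborel borel ?g] by simp
  ultimately show "emeasure (distr lborel borel T) A = emeasure lborel A"
    using ennreal_mult_right_imp_eq[OF eq] by simp
qed simp

lemma nn_integral_lborel_orthogonal: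
  fixes T :: "'a::euclidean_space \<Rightarrow> 'a" and g :: "'a \<Rightarrow> ennreal"
  assumes T: "orthogonal_transformation T" and [measurable]: "g \<in> borel_measurable borel"
  shows "(\<integral>\<^sup>+x. g (T x) \<partial>lborel) = (\<integral>\<^sup>+x. g x \<partial>lborel)"
proof -
  note Tm[measurable] = orthogonal_transformation_measurable[OF T]
  have "(\<integral>\<^sup>+x. g (T x) \<partial>lborel) = (\<integral>\<^sup>+x. g x \<partial>distr lborel borel T)"
    by (simp add: nn_integral_distr)
  then show ?thesis by (simp add: lborel_distr_orthogonal[OF T])
qed

lemma nn_integral_lborel_scale:
  fixes g :: "'a::euclidean_space \<Rightarrow> ennreal"
  assumes [measurable]: "g \<in> borel_measurable borel" and t: "t > 0"
  shows "(\<integral>\<^sup>+x. g (t *\<^sub>R x) \<partial>lborel) = ennreal (inverse (t ^ DIM('a))) * (\<integral>\<^sup>+x. g x \<partial>lborel)"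
proof -
  have "(\<integral>\<^sup>+x. g x \<partial>lborel) = ennreal (t ^ DIM('a)) * (\<integral>\<^sup>+x. g (t *\<^sub>R x) \<partial>lborel)"
    using t by (subst lborel_affine[of t 0]) (simp_all add: nn_integral_density nn_integral_distr nn_integral_cmult)
  then have "ennreal (inverse (t ^ DIM('a))) * (\<integral>\<^sup>+x. g x \<partial>lborel) =
     ennreal (inverse (t ^ DIM('a)) * t ^ DIM('a)) * (\<integral>\<^sup>+x. g (t *\<^sub>R x) \<partial>lborel)"
    using t by (subst ennreal_mult) (simp_all add: mult.assoc)
  also have "inverse (t ^ DIM('a)) * t ^ DIM('a) = 1" using t by simp
  finally show ?thesis by simp
qed

section \<open>Orthonormal coordinates on subspaces\<close>

locale orthonormal_set =
  fixes B :: "'a::euclidean_space set"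
  assumes orth: "pairwise orthogonal B" and unit: "b \<in> B \<Longrightarrow> norm b = 1"
begin

lemma independent: "independent B"
  using pairwise_orthogonal_independent[OF orth] unit by force

lemma finite: "finite B"
  using independent independent_imp_finite by blast

lemma inner: "b \<in> B \<Longrightarrow> b' \<in> B \<Longrightarrow> b \<bullet> b' = (if b = b' then 1 else 0)"
  using orth unit by (auto simp: pairwise_def orthogonal_def norm_eq_1)

lemma card: "card B = dim (span B)"
  using dim_span_eq_card_independent independent by force

lemma inner_sum: "(\<Sum>b\<in>B. c b *\<^sub>R b) \<bullet> (\<Sum>b\<in>B. c' b *\<^sub>R b) = (\<Sum>b\<in>B. c b * c' b)"
proof -
  have "(\<Sum>b\<in>B. c b *\<^sub>R b) \<bullet> (\<Sum>b\<in>B. c' b *\<^sub>R b) = (\<Sum>b\<in>B. \<Sum>b'\<in>B. c b * (c' b' * (b \<bullet> b')))"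
    by (simp add: inner_sum_left inner_sum_right sum_distrib_left mult_ac) (rule sum.swap)
  also have "\<dots> = (\<Sum>b\<in>B. c b * c' b)"
    by (intro sum.cong refl) (simp add: inner finite if_distrib[of "\<lambda>x. _ * x"] cong: if_cong)
  finally show ?thesis .
qed

lemma norm_sum: "(norm (\<Sum>b\<in>B. c b *\<^sub>R b))\<^sup>2 = (\<Sum>b\<in>B. (c b)\<^sup>2)"
  using inner_sum[of c c] by (simp add: dot_square_norm flip: power2_eq_square)

lemma measurable_lin: "(\<lambda>c. \<Sum>b\<in>B. c b *\<^sub>R b) \<in> borel_measurable (\<Pi>\<^sub>M b\<in>B. lborel)"
  by measurable

text \<open>A bijection p from \<open>Basis\<close> to B extends to an orthogonal map T, and T
  preserves \<open>lborel\<close>. It remains to see that relabelling coordinates along p carries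
  one product measure to the other.\<close>

lemma distr_orthonormal:
  assumes sp: "span B = UNIV"
  shows "distr (\<Pi>\<^sub>M b\<in>B. lborel) borel (\<lambda>c. \<Sum>b\<in>B. c b *\<^sub>R b) = lborel"
proof -
  have "card B = DIM('a)" using card sp by simp
  then obtain p where p: "bij_betw p (Basis::'a set) B"
    using finite_same_card_bij[OF finite_Basis finite] by metis
  define q where "q = inv_into Basis p"
  have qp: "i \<in> Basis \<Longrightarrow> q (p i) = i" for i unfolding q_def using p by (simp add: bij_betw_inv_into_left)
  have pB: "i \<in> Basis \<Longrightarrow> p i \<in> B" for i using p bij_betwE by blast
  have pq: "b \<in> B \<Longrightarrow> p (q b) = b" for b unfolding q_def using p by (simp add: bij_betw_inv_into_right)
  have qB: "b \<in> B \<Longrightarrow> q b \<in> Basis" for b unfolding q_def using p by (meson bij_betwE bij_betw_inv_into)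
  have bq: "bij_betw q B Basis" unfolding q_def using p by (rule bij_betw_inv_into)
  define T where "T x = (\<Sum>i\<in>Basis. (x \<bullet> i) *\<^sub>R p i)" for x :: 'a
  have reidx: "(\<Sum>i\<in>Basis. c i *\<^sub>R p i) = (\<Sum>b\<in>B. c (q b) *\<^sub>R b)" for c
    by (subst sum.reindex_bij_betw[OF bq, symmetric]) (simp add: pq)
  have "linear T" unfolding T_def
    by (intro linearI) (simp_all add: inner_add_left scaleR_add_left sum.distrib scaleR_sum_right)
  moreover have "T v \<bullet> T w = v \<bullet> w" for v w
    unfolding T_def reidx inner_sum
    by (subst sum.reindex_bij_betw[OF bq]) (simp add: euclidean_inner[of v w])
  ultimately have T: "orthogonal_transformation T" by (simp add: orthogonal_transformation_def)
  note Tm[measurable] = orthogonal_transformation_measurable[OF T]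
  interpret P: product_sigma_finite "\<lambda>_::'a. lborel::real measure" by standard
  let ?PB = "\<Pi>\<^sub>M b\<in>B. (lborel::real measure)" and ?P = "\<Pi>\<^sub>M b\<in>(Basis::'a set). (lborel::real measure)"
  let ?t = "\<lambda>c. \<lambda>b\<in>B. c (q b)"
  have tm[measurable]: "?t \<in> measurable ?P ?PB"
    using qB by (intro measurable_restrict) (auto intro!: measurable_component_singleton)
  have re: "distr ?P ?PB ?t = ?PB"
  proof (rule P.PiM_eqI[OF finite])
    fix A assume A: "\<And>b. b \<in> B \<Longrightarrow> A b \<in> sets (lborel::real measure)"
    have "?t -` (Pi\<^sub>E B A) \<inter> space ?P = Pi\<^sub>E Basis (\<lambda>i. A (p i))"
      using qp pB pq qB by (fastforce simp: space_PiM PiE_def Pi_def extensional_def)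
    then have "emeasure (distr ?P ?PB ?t) (Pi\<^sub>E B A) = emeasure ?P (Pi\<^sub>E Basis (\<lambda>i. A (p i)))"
      using A finite by (subst emeasure_distr) (auto intro!: sets_PiM_I_finite)
    also have "\<dots> = (\<Prod>i\<in>Basis. emeasure lborel (A (p i)))"
      using A pB by (intro P.emeasure_PiM) auto
    also have "\<dots> = (\<Prod>b\<in>B. emeasure lborel (A b))"
      by (rule prod.reindex_bij_betw[OF p])
    finally show "emeasure (distr ?P ?PB ?t) (Pi\<^sub>E B A) = (\<Prod>b\<in>B. emeasure lborel (A b))" .
  qed simp
  have "lborel = distr (distr ?P borel (\<lambda>c. \<Sum>i\<in>Basis. c i *\<^sub>R i)) borel T"
    using lborel_distr_orthogonal[OF T] lborel_eq[where 'a='a] by simp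
  also have "\<dots> = distr ?P borel (\<lambda>c. T (\<Sum>i\<in>Basis. c i *\<^sub>R i))"
    by (subst distr_distr) (auto simp: o_def)
  also have "\<dots> = distr ?P borel (\<lambda>c. \<Sum>b\<in>B. ?t c b *\<^sub>R b)"
  proof (rule distr_cong)
    fix c
    have "T (\<Sum>i\<in>Basis. c i *\<^sub>R i) = (\<Sum>i\<in>Basis. c i *\<^sub>R p i)"
      unfolding T_def by (intro sum.cong) auto
    then show "T (\<Sum>i\<in>Basis. c i *\<^sub>R i) = (\<Sum>b\<in>B. ?t c b *\<^sub>R b)"
      unfolding reidx by simp
  qed simp_all
  also have "\<dots> = distr (distr ?P ?PB ?t) borel (\<lambda>c. \<Sum>b\<in>B. c b *\<^sub>R b)"
    by (subst distr_distr) (auto simp: o_def)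
  finally show ?thesis by (simp add: re)
qed

end

lemma orthonormal_basis_props:
  fixes V :: "'a::euclidean_space set"
  assumes "subspace V"
  shows "orthonormal_basis V \<subseteq> V" "pairwise orthogonal (orthonormal_basis V)"
    "\<And>b. b \<in> orthonormal_basis V \<Longrightarrow> norm b = 1" "span (orthonormal_basis V) = V"
proof -
  obtain B where "B \<subseteq> V" "pairwise orthogonal B" "\<And>x. x \<in> B \<Longrightarrow> norm x = 1" "span B = V"
    using orthonormal_basis_subspace[OF assms] by metis
  then have "\<exists>B. B \<subseteq> V \<and> pairwise orthogonal B \<and> (\<forall>b\<in>B. norm b = 1) \<and> span B = V" by blast
  from someI_ex[OF this, folded orthonormal_basis_def]
  show "orthonormal_basis V \<subseteq> V" "pairwise orthogonal (orthonormal_basis V)"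
    "\<And>b. b \<in> orthonormal_basis V \<Longrightarrow> norm b = 1" "span (orthonormal_basis V) = V" by auto
qed

lemma orthonormal_set_basis:
  "subspace V \<Longrightarrow> orthonormal_set (orthonormal_basis V)"
  using orthonormal_basis_props by unfold_locales auto

section \<open>Orthogonal projections and the splitting of Lebesgue measure\<close>

lemma orth_proj_eqI:
  assumes V: "subspace V" and "p \<in> V" "x - p \<in> V\<^sup>\<bottom>"
  shows "orth_proj V x = p"
  unfolding orth_proj_def
proof (rule the_equality)
  fix q assume q: "q \<in> V \<and> x - q \<in> V\<^sup>\<bottom>"
  then have "(x - p) - (x - q) \<in> V\<^sup>\<bottom>"
    using subspace_diff[OF subspace_orthogonal_comp assms(3), of "x - q"] q by blast
  then have "q - p \<in> V\<^sup>\<bottom>" by simp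
  moreover have "q - p \<in> V" using q assms by (simp add: subspace_diff)
  ultimately have "q - p \<in> V \<inter> V\<^sup>\<bottom>" by simp
  then show "q = p" using orthogonal_Int_0[OF V] by simp
qed (use assms in auto)

lemma orth_proj:
  assumes V: "subspace V"
  shows "orth_proj V x \<in> V" "x - orth_proj V x \<in> V\<^sup>\<bottom>"
proof -
  have "x \<in> V + V\<^sup>\<bottom>" using subspace_sum_orthogonal_comp[OF V] by simp
  then obtain p r where "p \<in> V" "r \<in> V\<^sup>\<bottom>" "x = p + r" by (auto elim: set_plus_elim)
  then have "p \<in> V \<and> x - p \<in> V\<^sup>\<bottom>" by simp
  moreover then have "orth_proj V x = p" using orth_proj_eqI[OF V] by blast
  ultimately show "orth_proj V x \<in> V" "x - orth_proj V x \<in> V\<^sup>\<bottom>" by auto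
qed

lemma inner_orthogonal_comp: "v \<in> V \<Longrightarrow> w \<in> V\<^sup>\<bottom> \<Longrightarrow> v \<bullet> w = 0"
  by (simp add: orthogonal_comp_def orthogonal_def)

lemma linear_orth_proj:
  assumes V: "subspace V"
  shows "linear (orth_proj V)"
proof (rule linearI)
  fix x y
  show "orth_proj V (x + y) = orth_proj V x + orth_proj V y"
  proof (rule orth_proj_eqI[OF V])
    have "(x - orth_proj V x) + (y - orth_proj V y) \<in> V\<^sup>\<bottom>"
      using orth_proj[OF V] by (intro subspace_add subspace_orthogonal_comp)
    then show "x + y - (orth_proj V x + orth_proj V y) \<in> V\<^sup>\<bottom>" by (simp add: algebra_simps)
  qed (use orth_proj[OF V] V in \<open>simp add: subspace_add\<close>)
next
  fix c x
  show "orth_proj V (c *\<^sub>R x) = c *\<^sub>R orth_proj V x"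
  proof (rule orth_proj_eqI[OF V])
    have "c *\<^sub>R (x - orth_proj V x) \<in> V\<^sup>\<bottom>"
      using orth_proj[OF V] by (intro subspace_scale subspace_orthogonal_comp)
    then show "c *\<^sub>R x - c *\<^sub>R orth_proj V x \<in> V\<^sup>\<bottom>" by (simp add: algebra_simps)
  qed (use orth_proj[OF V] V in \<open>simp add: subspace_scale\<close>)
qed

lemma bounded_linear_orth_proj: "subspace V \<Longrightarrow> bounded_linear (orth_proj V)"
  using linear_orth_proj linear_conv_bounded_linear by blast

lemma measurable_orth_proj: "subspace V \<Longrightarrow> orth_proj V \<in> borel_measurable borel"
  by (intro borel_measurable_continuous_onI linear_continuous_on bounded_linear_orth_proj)

lemma inner_orth_proj:
  assumes V: "subspace V" and "v \<in> V"
  shows "orth_proj V x \<bullet> v = x \<bullet> v"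
  using inner_orthogonal_comp[OF \<open>v \<in> V\<close>, of "x - orth_proj V x"] orth_proj[OF V]
  by (simp add: algebra_simps inner_commute)

lemma sets_subspace_lborel[measurable_cong, simp]: "sets (subspace_lborel V) = sets borel"
  by (simp add: subspace_lborel_def)

lemma nn_integral_subspace_lborel:
  assumes V: "subspace V" and [measurable]: "g \<in> borel_measurable borel"
  shows "(\<integral>\<^sup>+x. g x \<partial>subspace_lborel V) =
    (\<integral>\<^sup>+c. g (\<Sum>b\<in>orthonormal_basis V. c b *\<^sub>R b) \<partial>(\<Pi>\<^sub>M b\<in>orthonormal_basis V. lborel))"
  unfolding subspace_lborel_def
  using orthonormal_set.measurable_lin[OF orthonormal_set_basis[OF V]]
  by (subst nn_integral_distr) auto

lemma AE_subspace_lborel: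
  fixes V :: "'a::euclidean_space set"
  assumes V: "subspace V"
  shows "AE x in subspace_lborel V. x \<in> V"
proof -
  have "closed V" using V closed_subspace by blast
  then have [measurable]: "V \<in> sets borel" by simp
  show ?thesis
    unfolding subspace_lborel_def
    using orthonormal_set.measurable_lin[OF orthonormal_set_basis[OF V]] orthonormal_basis_props[OF V]
    by (subst AE_distr_iff) (auto intro!: subspace_sum[OF V] subspace_scale[OF V])
qed

text \<open>The chosen bases of V and of its complement together form an orthonormal basis of the
  space, so \<open>lborel\<close> is the image of a product measure that can be folded along the two
  index sets.\<close>

lemma nn_integral_lborel_decompose:
  fixes V :: "'a::euclidean_space set" and g h :: "'a \<Rightarrow> ennreal"
  assumes V: "subspace V" and [measurable]: "g \<in> borel_measurable borel" "h \<in> borel_measurable borel"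
  shows "(\<integral>\<^sup>+x. g (x - orth_proj V x) * h (orth_proj V x) \<partial>lborel) =
    (\<integral>\<^sup>+x. g x \<partial>subspace_lborel (V\<^sup>\<bottom>)) * (\<integral>\<^sup>+x. h x \<partial>subspace_lborel V)"
proof -
  note W = subspace_orthogonal_comp[of V]
  let ?I = "orthonormal_basis (V\<^sup>\<bottom>)" and ?J = "orthonormal_basis V"
  interpret I: orthonormal_set ?I using orthonormal_set_basis[OF W] .
  interpret J: orthonormal_set ?J using orthonormal_set_basis[OF V] .
  note Ip = orthonormal_basis_props[OF W] and Jp = orthonormal_basis_props[OF V]
  have disj: "?I \<inter> ?J = {}"
  proof -
    have "?I \<inter> ?J \<subseteq> V \<inter> V\<^sup>\<bottom>" using Ip(1) Jp(1) by blast
    then have "?I \<inter> ?J \<subseteq> {0}" using orthogonal_Int_0[OF V] by simp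
    then show ?thesis using Ip(3) by fastforce
  qed
  interpret U: orthonormal_set "?I \<union> ?J"
  proof
    have "v \<bullet> w = 0" "w \<bullet> v = 0" if "w \<in> ?I" "v \<in> ?J" for v w
      using that Ip(1) Jp(1) inner_orthogonal_comp[of v V w] by (auto simp: inner_commute)
    then show "pairwise orthogonal (?I \<union> ?J)"
      using Ip(2) Jp(2) unfolding pairwise_def orthogonal_def by blast
  qed (use Ip Jp in auto)
  have sp: "span (?I \<union> ?J) = UNIV"
  proof -
    have "x \<in> span (?I \<union> ?J)" for x
    proof -
      have "orth_proj V x \<in> span (?I \<union> ?J)"
        using orth_proj(1)[OF V, of x] Jp(4) span_mono[of ?J "?I \<union> ?J"] by auto
      moreover have "x - orth_proj V x \<in> span (?I \<union> ?J)"
        using orth_proj(2)[OF V, of x] Ip(4) span_mono[of ?I "?I \<union> ?J"] by auto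
      ultimately have "orth_proj V x + (x - orth_proj V x) \<in> span (?I \<union> ?J)" by (rule span_add)
      then show ?thesis by simp
    qed
    then show ?thesis by auto
  qed
  note [measurable] = measurable_orth_proj[OF V] U.measurable_lin I.measurable_lin J.measurable_lin
  interpret P: product_sigma_finite "\<lambda>_::'a. lborel::real measure" by standard
  let ?P = "\<lambda>B. \<Pi>\<^sub>M b\<in>B. (lborel::real measure)" and ?s = "\<lambda>B c. \<Sum>b\<in>B. c b *\<^sub>R b"
  let ?f = "\<lambda>x. g (x - orth_proj V x) * h (orth_proj V x)"
  have "(\<integral>\<^sup>+x. ?f x \<partial>lborel) = (\<integral>\<^sup>+x. ?f x \<partial>distr (?P (?I \<union> ?J)) borel (?s (?I \<union> ?J)))"
    by (simp only: U.distr_orthonormal[OF sp])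
  also have "\<dots> = (\<integral>\<^sup>+c. ?f (?s (?I \<union> ?J) c) \<partial>?P (?I \<union> ?J))"
    by (rule nn_integral_distr) simp_all
  also have "\<dots> = (\<integral>\<^sup>+x. (\<integral>\<^sup>+y. ?f (?s (?I \<union> ?J) (merge ?I ?J (x, y))) \<partial>?P ?J) \<partial>?P ?I)"
    using U.measurable_lin by (intro P.product_nn_integral_fold disj I.finite J.finite) simp
  also have "\<dots> = (\<integral>\<^sup>+x. (\<integral>\<^sup>+y. g (?s ?I x) * h (?s ?J y) \<partial>?P ?J) \<partial>?P ?I)"
  proof (intro nn_integral_cong)
    fix x y :: "'a \<Rightarrow> real"
    have "?s (?I \<union> ?J) (merge ?I ?J (x, y)) = ?s ?I x + ?s ?J y"
    proof -
      have "?s (?I \<union> ?J) (merge ?I ?J (x, y)) = ?s ?I (merge ?I ?J (x, y)) + ?s ?J (merge ?I ?J (x, y))"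
        by (rule sum.union_disjoint[OF I.finite J.finite disj])
      also have "?s ?I (merge ?I ?J (x, y)) = ?s ?I x" by (intro sum.cong) (auto simp: merge_def)
      also have "?s ?J (merge ?I ?J (x, y)) = ?s ?J y"
        using disj by (intro sum.cong) (auto simp: merge_def)
      finally show ?thesis .
    qed
    moreover have "orth_proj V (?s ?I x + ?s ?J y) = ?s ?J y"
      using Ip(1) Jp(1)
      by (intro orth_proj_eqI[OF V]) (auto intro!: subspace_sum[OF V] subspace_sum[OF W] subspace_scale[OF V] subspace_scale[OF W])
    ultimately show "?f (?s (?I \<union> ?J) (merge ?I ?J (x, y))) = g (?s ?I x) * h (?s ?J y)" by simp
  qed
  also have "\<dots> = (\<integral>\<^sup>+x. g (?s ?I x) * (\<integral>\<^sup>+y. h (?s ?J y) \<partial>?P ?J) \<partial>?P ?I)"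
    by (intro nn_integral_cong nn_integral_cmult) simp
  also have "\<dots> = (\<integral>\<^sup>+x. g (?s ?I x) \<partial>?P ?I) * (\<integral>\<^sup>+y. h (?s ?J y) \<partial>?P ?J)"
    by (rule nn_integral_multc) simp
  finally show ?thesis by (simp add: nn_integral_subspace_lborel V W)
qed

section \<open>Gaussian integrals and dilations on subspaces\<close>

lemma nn_integral_gaussian_1d:
  assumes t: "t > 0"
  shows "(\<integral>\<^sup>+x. ennreal (exp (- (x\<^sup>2 / (2 * t\<^sup>2)))) \<partial>lborel) = ennreal (t * sqrt (2 * pi))"
proof -
  have eq: "exp (- (x\<^sup>2 / (2 * t\<^sup>2))) = t * sqrt (2 * pi) * normal_density 0 t x" for x
    using t by (simp add: normal_density_def real_sqrt_mult)
  have "(\<integral>\<^sup>+x. ennreal (exp (- (x\<^sup>2 / (2 * t\<^sup>2)))) \<partial>lborel) = ennreal (\<integral>x. t * sqrt (2 * pi) * normal_density 0 t x \<partial>lborel)"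
    unfolding eq using t by (intro nn_integral_eq_integral) auto
  also have "(\<integral>x. t * sqrt (2 * pi) * normal_density 0 t x \<partial>lborel) = t * sqrt (2 * pi)"
    using t by simp
  finally show ?thesis .
qed

lemma nn_integral_gaussian_subspace:
  fixes V :: "'a::euclidean_space set"
  assumes V: "subspace V" and t: "t > 0"
  shows "(\<integral>\<^sup>+x. ennreal (exp (- ((norm x)\<^sup>2 / (2 * t\<^sup>2)))) \<partial>subspace_lborel V) = ennreal ((t * sqrt (2 * pi)) ^ dim V)"
proof -
  let ?J = "orthonormal_basis V"
  interpret J: orthonormal_set ?J using orthonormal_set_basis[OF V] .
  interpret P: product_sigma_finite "\<lambda>_::'a. lborel::real measure" by standard
  have card: "card ?J = dim V" using J.card orthonormal_basis_props(4)[OF V] by simp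
  have "(\<integral>\<^sup>+x. ennreal (exp (- ((norm x)\<^sup>2 / (2 * t\<^sup>2)))) \<partial>subspace_lborel V) =
    (\<integral>\<^sup>+c. (\<Prod>b\<in>?J. ennreal (exp (- ((c b)\<^sup>2 / (2 * t\<^sup>2))))) \<partial>(\<Pi>\<^sub>M b\<in>?J. lborel))"
    by (subst nn_integral_subspace_lborel[OF V])
      (auto intro!: nn_integral_cong simp: J.norm_sum prod_ennreal exp_sum[OF J.finite, symmetric] sum_negf sum_divide_distrib)
  also have "\<dots> = (\<Prod>b\<in>?J. (\<integral>\<^sup>+x. ennreal (exp (- (x\<^sup>2 / (2 * t\<^sup>2)))) \<partial>lborel))"
    by (rule P.product_nn_integral_prod[OF J.finite]) simp
  also have "\<dots> = ennreal ((t * sqrt (2 * pi)) ^ dim V)"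
    using t by (simp add: nn_integral_gaussian_1d ennreal_power card)
  finally show ?thesis .
qed

text \<open>A constant weight along a nonzero V would have infinite mass; a Gaussian has a known
  finite one. The left side involves V only through its projection. The width t is left free because
  dilations change it.\<close>

lemma nn_integral_subspace_gaussian_weight:
  fixes V :: "'a::euclidean_space set" and g :: "'a \<Rightarrow> ennreal"
  assumes V: "subspace V" and [measurable]: "g \<in> borel_measurable borel" and t: "t > 0"
  shows "(\<integral>\<^sup>+x. g (x - orth_proj V x) * ennreal (exp (- ((norm (orth_proj V x))\<^sup>2 / (2 * t\<^sup>2)))) \<partial>lborel) =
    (\<integral>\<^sup>+x. g x \<partial>subspace_lborel (V\<^sup>\<bottom>)) * ennreal ((t * sqrt (2 * pi)) ^ dim V)"
  by (subst nn_integral_lborel_decompose[OF V, of g "\<lambda>y. ennreal (exp (- ((norm y)\<^sup>2 / (2 * t\<^sup>2))))"])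
    (simp_all add: nn_integral_gaussian_subspace[OF V t])

lemma dim_orthogonal_comp:
  fixes V :: "'a::euclidean_space set"
  assumes V: "subspace V"
  shows "dim (V\<^sup>\<bottom>) = DIM('a) - dim V" "dim V \<le> DIM('a)"
proof -
  have "dim V + dim (V\<^sup>\<bottom>) = DIM('a)"
    using dim_subspace_orthogonal_to_vectors[of V UNIV] V
    by (simp add: orthogonal_comp_def add.commute)
  then show "dim (V\<^sup>\<bottom>) = DIM('a) - dim V" "dim V \<le> DIM('a)" by auto
qed

text \<open>The dilation turns a Gaussian of width 1 along V into one of width t. Rescaling
  \<open>lborel\<close> contributes the power \<open>DIM('a)\<close> of \<open>inverse t\<close>,
  the wider Gaussian gives back the power \<open>dim V\<close> of t, and the dimension of the
  complement remains.\<close>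

lemma nn_integral_subspace_lborel_scale:
  fixes V :: "'a::euclidean_space set" and g :: "'a \<Rightarrow> ennreal"
  assumes V: "subspace V" and [measurable]: "g \<in> borel_measurable borel" and t: "t > 0"
  shows "(\<integral>\<^sup>+x. g (t *\<^sub>R x) \<partial>subspace_lborel (V\<^sup>\<bottom>)) =
    ennreal (inverse (t ^ dim (V\<^sup>\<bottom>))) * (\<integral>\<^sup>+x. g x \<partial>subspace_lborel (V\<^sup>\<bottom>))"
proof -
  note [measurable] = measurable_orth_proj[OF V]
  let ?p = "orth_proj V"
  let ?A = "sqrt (2 * pi) ^ dim V" 
  have ps: "?p (t *\<^sub>R x) = t *\<^sub>R ?p x" for x using linear_scale[OF linear_orth_proj[OF V]] by simp
  have "(\<integral>\<^sup>+x. g (t *\<^sub>R x) \<partial>subspace_lborel (V\<^sup>\<bottom>)) * ennreal ?A =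
    (\<integral>\<^sup>+x. g (t *\<^sub>R (x - ?p x)) * ennreal (exp (- ((norm (?p x))\<^sup>2 / (2 * 1\<^sup>2)))) \<partial>lborel)"
    by (subst nn_integral_subspace_gaussian_weight[OF V, of "\<lambda>x. g (t *\<^sub>R x)" 1]) simp_all
  also have "\<dots> = (\<integral>\<^sup>+x. g (t *\<^sub>R x - ?p (t *\<^sub>R x)) * ennreal (exp (- ((norm (?p (t *\<^sub>R x)))\<^sup>2 / (2 * t\<^sup>2)))) \<partial>lborel)"
    using t by (intro nn_integral_cong) (simp add: ps scaleR_diff_right power_mult_distrib)
  also have "\<dots> = ennreal (inverse (t ^ DIM('a))) * (\<integral>\<^sup>+x. g (x - ?p x) * ennreal (exp (- ((norm (?p x))\<^sup>2 / (2 * t\<^sup>2)))) \<partial>lborel)"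
    by (rule nn_integral_lborel_scale[OF _ t]) measurable
  also have "\<dots> = ennreal (inverse (t ^ DIM('a))) * ((\<integral>\<^sup>+x. g x \<partial>subspace_lborel (V\<^sup>\<bottom>)) * ennreal (t ^ dim V * ?A))"
    by (subst nn_integral_subspace_gaussian_weight[OF V _ t]) (simp_all add: power_mult_distrib)
  also have "\<dots> = (ennreal (inverse (t ^ DIM('a))) * ennreal (t ^ dim V)) * (\<integral>\<^sup>+x. g x \<partial>subspace_lborel (V\<^sup>\<bottom>)) * ennreal ?A"
    using t by (simp add: ennreal_mult mult_ac)
  also have "ennreal (inverse (t ^ DIM('a))) * ennreal (t ^ dim V) = ennreal (inverse (t ^ dim (V\<^sup>\<bottom>)))"
    using t dim_orthogonal_comp[OF V]
    by (subst ennreal_mult[symmetric]) (simp_all add: power_diff field_simps)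
  finally show ?thesis by (rule ennreal_mult_right_imp_eq) auto
qed

section \<open>Uniqueness of similarity-invariant measures\<close>

text \<open>After y is rescaled to the norm of x, the reflection in the hyperplane orthogonal to the
  difference of the two vectors exchanges them.\<close>

lemma similarity_transitive:
  fixes x y :: "'a::euclidean_space"
  assumes "x \<noteq> 0" "y \<noteq> 0"
  obtains T t where "orthogonal_transformation T" "t > 0" "y = t *\<^sub>R T x"
proof -
  define t where "t = norm y / norm x"
  define z where "z = y /\<^sub>R t"
  have t: "t > 0" using assms by (simp add: t_def)
  have nz: "norm z = norm x" using assms by (simp add: z_def t_def)
  have "\<exists>T. orthogonal_transformation T \<and> T x = z"
  proof (cases "x = z")
    case True
    then show ?thesis by (intro exI[of _ "\<lambda>x. x"]) simp
  next
    case False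
    define v where "v = x - z"
    define T where "T w = w - (2 * (v \<bullet> w) / (v \<bullet> v)) *\<^sub>R v" for w
    have vv: "v \<bullet> v \<noteq> 0" using False by (simp add: v_def)
    have "linear T"
      by (rule linearI) (simp_all add: T_def inner_add_right distrib_left add_divide_distrib algebra_simps)
    moreover have "T a \<bullet> T b = a \<bullet> b" for a b
    proof -
      define p q where "p = 2 * (v \<bullet> a) / (v \<bullet> v)" and "q = 2 * (v \<bullet> b) / (v \<bullet> v)"
      have pq: "p * (v \<bullet> v) = 2 * (v \<bullet> a)" "q * (v \<bullet> v) = 2 * (v \<bullet> b)" using vv by (simp_all add: p_def q_def)
      have T: "T a \<bullet> T b = a \<bullet> b - q * (v \<bullet> a) - p * (v \<bullet> b) + p * (q * (v \<bullet> v))"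
        unfolding T_def p_def[symmetric] q_def[symmetric]
        by (simp add: inner_diff_left inner_diff_right inner_commute)
      have "2 * (p * (v \<bullet> b)) = p * (q * (v \<bullet> v))" unfolding pq by simp
      moreover have "2 * (q * (v \<bullet> a)) = q * (p * (v \<bullet> v))" unfolding pq by simp
      moreover have "q * (p * (v \<bullet> v)) = p * (q * (v \<bullet> v))" by (rule mult.left_commute)
      ultimately show ?thesis unfolding T by linarith
    qed
    moreover have "T x = z"
    proof -
      have "v \<bullet> v = 2 * (v \<bullet> x)"
        using nz by (simp add: v_def inner_diff_left inner_diff_right inner_commute norm_eq)
      then have "2 * (v \<bullet> x) / (v \<bullet> v) = (v \<bullet> v) / (v \<bullet> v)" by (rule arg_cong2[OF sym refl])
      also have "\<dots> = 1" using vv by (rule divide_self)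
      finally have "T x = x - v" unfolding T_def by (simp only: scaleR_one)
      then show ?thesis by (simp add: v_def)
    qed
    ultimately show ?thesis by (auto simp: orthogonal_transformation_def)
  qed
  then obtain T where "orthogonal_transformation T" "T x = z" by blast
  with t show ?thesis by (intro that[of T t]) (auto simp: z_def)
qed

lemma compact_annulus: "compact {x::'a::euclidean_space. a \<le> norm x \<and> norm x \<le> b}"
proof -
  have "{x::'a. a \<le> norm x \<and> norm x \<le> b} = {x. a \<le> norm x} \<inter> cball 0 b" by auto
  moreover have "closed {x::'a. a \<le> norm x}" by (intro closed_Collect_le continuous_intros)
  ultimately show ?thesis by (simp add: closed_Int_compact)
qed

text \<open>Compact annuli exhaust the punctured space; the origin is adjoined so that the sets
  cover the whole type, which costs nothing for measures that give it mass 0.\<close>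

definition exhaustion :: "nat \<Rightarrow> 'a::euclidean_space set" where
  "exhaustion n = insert 0 {x. 1 / Suc n \<le> norm x \<and> norm x \<le> n}"

lemma exhaustion_minus_zero: "exhaustion n - {0} = {x. 1 / Suc n \<le> norm x \<and> norm x \<le> n}"
  by (auto simp: exhaustion_def)

lemma UN_exhaustion: "(\<Union>n. exhaustion n) = UNIV"
proof -
  have "x \<in> (\<Union>n. exhaustion n)" for x :: 'a
  proof (cases "x = 0")
    case False
    obtain m :: nat where m: "norm x \<le> m" using real_arch_simple by blast
    obtain n :: nat where n: "1 / Suc n < norm x" using False nat_approx_posE[of "norm x"] by auto
    have "1 / Suc (max m n) \<le> 1 / Suc n" by (simp add: frac_le)
    then have "x \<in> exhaustion (max m n)" using m n by (auto simp: exhaustion_def)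
    then show ?thesis by blast
  qed (simp add: exhaustion_def)
  then show ?thesis by blast
qed

text \<open>The model is Lebesgue measure divided by the power \<open>DIM('a)\<close> of the norm.
  It is infinite both near the origin and near infinity, so finiteness is asked for on closed
  annuli.\<close>

locale similarity_invariant =
  fixes M :: "'a::euclidean_space measure"
  assumes sets_eq: "sets M = sets borel"
    and rotate: "orthogonal_transformation T \<Longrightarrow> A \<in> sets borel \<Longrightarrow> emeasure M (T -` A) = emeasure M A"
    and scale: "t > 0 \<Longrightarrow> A \<in> sets borel \<Longrightarrow> emeasure M ((\<lambda>x. t *\<^sub>R x) -` A) = emeasure M A"
    and finite_annulus: "a > 0 \<Longrightarrow> emeasure M {x. a \<le> norm x \<and> norm x \<le> b} < \<infinity>"
    and zero: "emeasure M {0} = 0"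
begin

lemma measurable_eq: "measurable M = measurable borel"
  using sets_eq measurable_cong_sets by blast

lemma finite_compact:
  assumes "compact C" "0 \<notin> C"
  shows "emeasure M C < \<infinity>"
proof -
  obtain b where b: "\<And>x. x \<in> C \<Longrightarrow> norm x \<le> b"
    using compact_imp_bounded[OF assms(1)] by (auto simp: bounded_iff)
  have "open (- C)" using assms(1) compact_imp_closed by blast
  then obtain a where a: "a > 0" "ball 0 a \<subseteq> - C" using assms(2) open_contains_ball by blast
  have "C \<subseteq> {x. a \<le> norm x \<and> norm x \<le> b}"
  proof
    fix x assume x: "x \<in> C"
    then have "x \<notin> ball 0 a" using a(2) by blast
    then show "x \<in> {x. a \<le> norm x \<and> norm x \<le> b}" using b[OF x] by simp
  qed
  then have "emeasure M C \<le> emeasure M {x. a \<le> norm x \<and> norm x \<le> b}"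
    by (rule emeasure_mono) (simp add: sets_eq)
  also have "\<dots> < \<infinity>" by (rule finite_annulus[OF a(1)])
  finally show ?thesis .
qed

lemma sets_exhaustion: "exhaustion n \<in> sets M"
  unfolding sets_eq exhaustion_def
  by (intro borel_closed closed_insert compact_imp_closed compact_annulus)

lemma finite_exhaustion: "emeasure M (exhaustion n) \<noteq> \<infinity>"
proof -
  let ?A = "{x::'a. 1 / Suc n \<le> norm x \<and> norm x \<le> n}"
  have "emeasure M (exhaustion n) \<le> emeasure M {0} + emeasure M ?A"
    using emeasure_subadditive[of "{0}" M ?A] compact_annulus[THEN compact_imp_closed]
    by (simp add: sets_eq exhaustion_def)
  also have "\<dots> < \<infinity>" using zero finite_annulus[of "1 / Suc n" n] by simp
  finally show ?thesis by simp
qed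

lemma sigma_finite: "sigma_finite_measure M"
proof
  have "space M = UNIV" using sets_eq_imp_space_eq[OF sets_eq] by simp
  then show "\<exists>A. countable A \<and> A \<subseteq> sets M \<and> \<Union> A = space M \<and> (\<forall>a\<in>A. emeasure M a \<noteq> \<infinity>)"
    using sets_exhaustion finite_exhaustion UN_exhaustion
    by (intro exI[of _ "range exhaustion"] conjI ballI) auto
qed

end

text \<open>
  The relation is invariant under similarities, so its sections have constant measure. Integrating it
  over \<open>C\<close> in one variable and exchanging the integrals compares \<open>M\<close> and \<open>N\<close> on \<open>C\<close>, up to an error that
  vanishes with \<open>e\<close>.
\<close>

definition near :: "real \<Rightarrow> 'a::euclidean_space \<Rightarrow> 'a \<Rightarrow> bool" where
  "near e x y \<longleftrightarrow> (norm (x - y))\<^sup>2 < e\<^sup>2 * (norm x * norm y)"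

lemma near_sym: "near e x y = near e y x"
  by (simp add: near_def norm_minus_commute mult.commute)

text \<open>Both sides of the inequality in \<open>near\<close> are homogeneous of degree two and
  depend on norms alone. The product of the two norms, in place of a square of one of them, is what
  keeps the relation symmetric as well.\<close>

lemma near_similarity:
  assumes "orthogonal_transformation T" "t > 0"
  shows "near e (t *\<^sub>R T x) (t *\<^sub>R T y) = near e x y"
proof -
  have "t *\<^sub>R T x - t *\<^sub>R T y = t *\<^sub>R T (x - y)"
    using assms by (simp add: linear_diff orthogonal_transformation_linear scaleR_diff_right)
  then have "(norm (t *\<^sub>R T x - t *\<^sub>R T y))\<^sup>2 = t\<^sup>2 * (norm (x - y))\<^sup>2"
    using assms by (simp add: orthogonal_transformation_norm power_mult_distrib)
  moreover have "e\<^sup>2 * (norm (t *\<^sub>R T x) * norm (t *\<^sub>R T y)) = t\<^sup>2 * (e\<^sup>2 * (norm x * norm y))"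
    using assms by (simp add: orthogonal_transformation_norm power2_eq_square)
  ultimately show ?thesis using assms(2) by (simp only: near_def) simp
qed

lemma near_norm:
  assumes "near e x y" "0 < e" "e \<le> 1"
  shows "norm y < 3 * norm x" "norm (x - y) < 2 * e * norm x"
proof -
  have pos: "norm x * norm y > 0"
    using assms(1) by (auto simp: near_def zero_less_mult_iff)
  have "e\<^sup>2 * (norm x * norm y) \<le> 1 * (norm x * norm y)"
    using assms pos by (intro mult_right_mono) (auto simp: power_le_one)
  also have "\<dots> \<le> ((norm x + norm y) / 2)\<^sup>2"
    using zero_le_power2[of "norm x - norm y"] by (simp add: power2_eq_square algebra_simps)
  finally have "(norm (x - y))\<^sup>2 < ((norm x + norm y) / 2)\<^sup>2"
    using assms(1) by (simp add: near_def)
  then have "norm (x - y) < (norm x + norm y) / 2"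
    by (rule power2_less_imp_less) simp
  then show n3: "norm y < 3 * norm x"
    using norm_triangle_ineq2[of y x] by (simp add: norm_minus_commute)
  have "(norm (x - y))\<^sup>2 < e\<^sup>2 * (norm x * norm y)" using assms(1) by (simp add: near_def)
  \<comment> \<open>The factor 3 is relaxed to 4 so that the bound becomes a perfect square.\<close>
  also have "\<dots> \<le> e\<^sup>2 * (norm x * (4 * norm x))"
    using n3 norm_ge_zero[of x] zero_le_power2[of e] by (intro mult_left_mono) linarith+
  also have "\<dots> = (2 * e * norm x)\<^sup>2" by (simp add: power2_eq_square)
  finally show "norm (x - y) < 2 * e * norm x"
    by (rule power2_less_imp_less) (use assms in auto)
qed

lemma sets_near[measurable]: "{y. near e x y} \<in> sets borel"
  unfolding near_def by measurable

context similarity_invariant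
begin

text \<open>Similarities act transitively on nonzero vectors and preserve both the relation and the
  measure.\<close>

lemma near_const:
  assumes "x \<noteq> 0" "y \<noteq> 0"
  shows "emeasure M {z. near e x z} = emeasure M {z. near e y z}"
proof -
  obtain T t where T: "orthogonal_transformation T" "t > 0" "y = t *\<^sub>R T x"
    using similarity_transitive[OF assms] by metis
  note [measurable] = orthogonal_transformation_measurable[OF T(1)]
  have "emeasure M {z. near e y z} = emeasure M ((\<lambda>x. t *\<^sub>R x) -` {z. near e y z})"
    by (rule scale[symmetric, OF T(2)]) simp
  also have "\<dots> = emeasure M (T -` ((\<lambda>x. t *\<^sub>R x) -` {z. near e y z}))"
    by (rule rotate[symmetric, OF T(1)], rule measurable_sets_borel[OF _ sets_near]) simp
  also have "T -` ((\<lambda>x. t *\<^sub>R x) -` {z. near e y z}) = {z. near e x z}"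
    using near_similarity[OF T(1,2)] by (auto simp: T(3))
  finally show ?thesis by simp
qed

lemma near_finite:
  assumes "x \<noteq> 0" "0 < e" "e \<le> 1"
  shows "emeasure M {z. near e x z} < \<infinity>"
proof -
  have "{z. near e x z} \<subseteq> {z. norm x / 3 \<le> norm z \<and> norm z \<le> 3 * norm x}"
  proof clarify
    fix z assume z: "near e x z"
    then have "near e z x" by (simp add: near_sym)
    from near_norm(1)[OF z assms(2,3)] near_norm(1)[OF this assms(2,3)]
    show "norm x / 3 \<le> norm z \<and> norm z \<le> 3 * norm x" by simp
  qed
  then have "emeasure M {z. near e x z} \<le> emeasure M {z. norm x / 3 \<le> norm z \<and> norm z \<le> 3 * norm x}"
    by (rule emeasure_mono) (simp add: sets_eq)
  also have "\<dots> < \<infinity>" using assms by (intro finite_annulus) auto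
  finally show ?thesis .
qed

end

text \<open>A pair in the relation whose first point lies in C has its second point in D. So the
  product measure of the pairs starting in C is at most that of the pairs ending in D, and on either
  side the sections over nonzero points have constant measure.\<close>

lemma similarity_invariant_step:
  fixes M N :: "'a::euclidean_space measure"
  assumes "similarity_invariant M" "similarity_invariant N"
    and C: "compact C" "0 \<notin> C" and D: "D \<in> sets borel" "0 \<notin> D"
    and near: "\<And>x y. x \<in> C \<Longrightarrow> near e x y \<Longrightarrow> y \<in> D" and x0: "x0 \<noteq> 0"
  shows "emeasure M C * emeasure N {z. near e x0 z} \<le> emeasure M {z. near e x0 z} * emeasure N D"
proof -
  interpret M: similarity_invariant M by fact
  interpret N: similarity_invariant N by fact
  interpret pair_sigma_finite M N
    using M.sigma_finite N.sigma_finite by (simp add: pair_sigma_finite_def)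
  note [measurable_cong] = M.sets_eq N.sets_eq
  have [measurable]: "C \<in> sets borel" "D \<in> sets borel" using C D borel_compact by auto
  have [measurable]: "Measurable.pred (borel \<Otimes>\<^sub>M borel) (\<lambda>(x, y). near e x (y::'a))"
    unfolding near_def by measurable
  have "emeasure M C * emeasure N {z. near e x0 z} =
    (\<integral>\<^sup>+x. indicator C x * emeasure N {z. near e x0 z} \<partial>M)"
    by (subst nn_integral_multc) (auto simp: mult.commute)
  also have "\<dots> = (\<integral>\<^sup>+x. (\<integral>\<^sup>+y. indicator C x * (if near e x y then 1 else 0) \<partial>N) \<partial>M)"
  proof (rule nn_integral_cong)
    fix x
    have "x \<in> C \<Longrightarrow> emeasure N {z. near e x0 z} = emeasure N {z. near e x z}"
      using C x0 by (intro N.near_const) auto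
    moreover have "emeasure N {z. near e x z} = (\<integral>\<^sup>+y. (if near e x y then 1 else 0) \<partial>N)"
    proof -
      have "emeasure N {z. near e x z} = (\<integral>\<^sup>+y. indicator {z. near e x z} y \<partial>N)"
        by (rule nn_integral_indicator[symmetric]) (simp add: N.sets_eq)
      also have "\<dots> = (\<integral>\<^sup>+y. (if near e x y then 1 else 0) \<partial>N)"
        by (rule nn_integral_cong) (simp add: indicator_def)
      finally show ?thesis .
    qed
    ultimately show "indicator C x * emeasure N {z. near e x0 z} = (\<integral>\<^sup>+y. indicator C x * (if near e x y then 1 else 0) \<partial>N)"
      by (subst nn_integral_cmult) (auto split: split_indicator simp: N.measurable_eq)
  qed
  also have "\<dots> \<le> (\<integral>\<^sup>+x. (\<integral>\<^sup>+y. indicator D y * (if near e y x then 1 else 0) \<partial>N) \<partial>M)"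
    using near by (intro nn_integral_mono) (auto split: split_indicator simp: near_sym)
  also have "\<dots> = (\<integral>\<^sup>+y. (\<integral>\<^sup>+x. indicator D y * (if near e y x then 1 else 0) \<partial>M) \<partial>N)"
    by (rule Fubini'[symmetric]) measurable
  also have "\<dots> = (\<integral>\<^sup>+y. indicator D y * emeasure M {z. near e x0 z} \<partial>N)"
  proof (rule nn_integral_cong)
    fix x
    have "x \<in> D \<Longrightarrow> emeasure M {z. near e x0 z} = emeasure M {z. near e x z}"
      using D x0 by (intro M.near_const) auto
    moreover have "emeasure M {z. near e x z} = (\<integral>\<^sup>+y. (if near e x y then 1 else 0) \<partial>M)"
    proof -
      have "emeasure M {z. near e x z} = (\<integral>\<^sup>+y. indicator {z. near e x z} y \<partial>M)"
        by (rule nn_integral_indicator[symmetric]) (simp add: M.sets_eq)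
      also have "\<dots> = (\<integral>\<^sup>+y. (if near e x y then 1 else 0) \<partial>M)"
        by (rule nn_integral_cong) (simp add: indicator_def)
      finally show ?thesis .
    qed
    ultimately show "(\<integral>\<^sup>+y. indicator D x * (if near e x y then 1 else 0) \<partial>M) = indicator D x * emeasure M {z. near e x0 z}"
      by (subst nn_integral_cmult) (auto split: split_indicator simp: M.measurable_eq)
  qed
  also have "\<dots> = emeasure M {z. near e x0 z} * emeasure N D"
    by (subst nn_integral_multc) (auto simp: mult.commute)
  finally show ?thesis .
qed

section \<open>Comparison of two invariant measures on compact sets\<close>

definition fatten :: "'a::euclidean_space set \<Rightarrow> nat \<Rightarrow> 'a set" where
  "fatten C n = {y. infdist y C \<le> 1 / Suc n}"

text \<open>This is continuity from above along the closed neighbourhoods of C. Their measure is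
  finite once they avoid the origin, near which an invariant measure may be infinite.\<close>

lemma fatten_limit:
  assumes "similarity_invariant M" and C: "compact C" "0 \<notin> C" "C \<noteq> {}"
  shows "(\<lambda>n. emeasure M (fatten C n)) \<longlonglongrightarrow> emeasure M C"
    and "eventually (\<lambda>n. 0 \<notin> fatten C n) sequentially"
proof -
  interpret M: similarity_invariant M by fact
  have cl: "closed (fatten C n)" for n
    unfolding fatten_def by (intro closed_Collect_le continuous_intros)
  have dec: "decseq (fatten C)"
    unfolding fatten_def decseq_def by (auto simp: frac_le elim!: order_trans)
  have Int: "(\<Inter>n. fatten C n) = C"
  proof
    show "C \<subseteq> (\<Inter>n. fatten C n)" by (auto simp: fatten_def)
    show "(\<Inter>n. fatten C n) \<subseteq> C"
    proof
      fix x assume x: "x \<in> (\<Inter>n. fatten C n)"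
      have "infdist x C \<le> 0"
      proof (rule ccontr)
        assume "\<not> infdist x C \<le> 0"
        then obtain n where "1 / real (Suc n) < infdist x C" using nat_approx_posE[of "infdist x C"] by auto
        moreover have "infdist x C \<le> 1 / real (Suc n)" using x by (auto simp: fatten_def)
        ultimately show False by simp
      qed
      then have "infdist x C = 0" using infdist_nonneg[of x C] by simp
      then show "x \<in> C" using in_closed_iff_infdist_zero[OF compact_imp_closed[OF C(1)] C(3)] by simp
    qed
  qed
  have "0 \<notin> (\<Inter>n. fatten C n)" using Int C by simp
  then obtain m where m: "0 \<notin> fatten C m" by auto
  then have "0 \<notin> fatten C n" if "m \<le> n" for n
    using dec that by (auto simp: decseq_def)
  then show "eventually (\<lambda>n. 0 \<notin> fatten C n) sequentially" by (auto simp: eventually_sequentially)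
  obtain b where b: "\<And>x. x \<in> C \<Longrightarrow> norm x \<le> b"
    using compact_imp_bounded[OF C(1)] by (auto simp: bounded_iff)
  have "bounded (fatten C m)"
  proof (rule boundedI)
    fix y assume "y \<in> fatten C m"
    then have le: "infdist y C \<le> 1" by (simp add: fatten_def) (smt (verit) divide_le_eq_1 of_nat_0_le_iff)
    obtain x where x: "x \<in> C" "infdist y C = dist y x"
      using infdist_attains_inf[OF compact_imp_closed[OF C(1)] C(3)] by metis
    have "norm y \<le> norm x + norm (y - x)" using norm_triangle_sub by blast
    then show "norm y \<le> b + 1" using b[OF x(1)] le x(2) by (simp add: dist_norm)
  qed
  then have "compact (fatten C m)" using cl compact_eq_bounded_closed by blast
  then have fin: "emeasure M (fatten C m) < \<infinity>" using m by (rule M.finite_compact)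
  \<comment> \<open>The shift by m starts the sequence at a neighbourhood that avoids the origin and
    so has finite measure.\<close>
  have "(\<lambda>n. emeasure M (fatten C (n + m))) \<longlonglongrightarrow> emeasure M (\<Inter>n. fatten C (n + m))"
  proof (rule Lim_emeasure_decseq)
    show "range (\<lambda>n. fatten C (n + m)) \<subseteq> sets M" using cl by (auto simp: M.sets_eq)
    show "decseq (\<lambda>n. fatten C (n + m))" using dec by (simp add: decseq_def)
    fix n have "emeasure M (fatten C (n + m)) \<le> emeasure M (fatten C m)"
      using dec cl by (intro emeasure_mono) (auto simp: decseq_def M.sets_eq)
    then show "emeasure M (fatten C (n + m)) \<noteq> \<infinity>" using fin by auto
  qed
  moreover have "(\<Inter>n. fatten C (n + m)) = C"
  proof -
    have "(\<Inter>n. fatten C (n + m)) \<subseteq> (\<Inter>n. fatten C n)"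
    proof (rule INT_greatest)
      fix n
      have "fatten C (n + m) \<subseteq> fatten C n" by (rule decseqD[OF dec]) simp
      then show "(\<Inter>n. fatten C (n + m)) \<subseteq> fatten C n" by blast
    qed
    moreover have "(\<Inter>n. fatten C n) \<subseteq> (\<Inter>n. fatten C (n + m))" by auto
    ultimately show ?thesis using Int by simp
  qed
  ultimately show "(\<lambda>n. emeasure M (fatten C n)) \<longlonglongrightarrow> emeasure M C"
    by (simp add: LIMSEQ_offset[where k=m])
qed

lemma fatten_near:
  assumes "compact C"
  obtains e where "0 < e" "e \<le> 1" "\<And>x y. x \<in> C \<Longrightarrow> near e x y \<Longrightarrow> y \<in> fatten C n"
proof -
  obtain b where b: "\<And>x. x \<in> C \<Longrightarrow> norm x \<le> b"
    using compact_imp_bounded[OF assms] by (auto simp: bounded_iff)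
  \<comment> \<open>The relation controls the distance relative to \<open>norm x\<close>, which is
    at most \<open>\<bar>b\<bar> + 1\<close> on C; with this e the bound
    \<open>2 * e * norm x\<close> is at most \<open>1 / Suc n\<close>. The absolute value keeps the
    denominator positive when C is empty and b arbitrary.\<close>
  define e where "e = min 1 (1 / (2 * Suc n * (\<bar>b\<bar> + 1)))"
  have e: "0 < e" "e \<le> 1" by (auto simp: e_def)
  have "y \<in> fatten C n" if x: "x \<in> C" "near e x y" for x y
  proof -
    have "dist y x < 2 * e * norm x" using near_norm(2)[OF x(2) e] by (simp add: dist_norm norm_minus_commute)
    also have "\<dots> \<le> 2 * (1 / (2 * Suc n * (\<bar>b\<bar> + 1))) * (\<bar>b\<bar> + 1)"
      using b[OF x(1)] by (intro mult_mono) (auto simp: e_def)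
    also have "\<dots> = 1 / Suc n" using abs_ge_zero[of b] by (simp add: divide_simps del: abs_ge_zero) (simp add: algebra_simps)
    finally show ?thesis using infdist_le[OF x(1), of y] by (simp add: fatten_def)
  qed
  with e that show ?thesis by blast
qed

lemma near_mono: "0 < e \<Longrightarrow> e \<le> e' \<Longrightarrow> near e x y \<Longrightarrow> near e' x y"
proof -
  assume e: "0 < e" "e \<le> e'" and n: "near e x y"
  have "e\<^sup>2 * (norm x * norm y) \<le> e'\<^sup>2 * (norm x * norm y)"
    using e by (intro mult_right_mono) (auto simp: power_mono)
  with n show ?thesis by (simp add: near_def)
qed

text \<open>The comparison is applied once to C and once to D with M and N exchanged, for a common
  e. In the product of the two inequalities the measures of the sections occur on both sides and
  cancel; shrinking the neighbourhoods then gives the claim.\<close>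

lemma similarity_invariant_ratio:
  fixes M N :: "'a::euclidean_space measure"
  assumes M: "similarity_invariant M" and N: "similarity_invariant N"
    and pos: "\<And>U. open U \<Longrightarrow> U \<noteq> {} \<Longrightarrow> 0 \<notin> U \<Longrightarrow> emeasure N U > 0"
    and C: "compact C" "0 \<notin> C" and D: "compact D" "0 \<notin> D"
  shows "emeasure M C * emeasure N D \<le> emeasure N C * emeasure M D"
proof (cases "C = {} \<or> D = {}")
  case False
  then have ne: "C \<noteq> {}" "D \<noteq> {}" by auto
  interpret M: similarity_invariant M by fact
  interpret N: similarity_invariant N by fact
  note limC = fatten_limit[OF N C ne(1)] and limD = fatten_limit[OF M D ne(2)]
  have cl: "fatten E n \<in> sets borel" for n and E :: "'a set"
    unfolding fatten_def by (intro borel_closed closed_Collect_le continuous_intros)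
  obtain x0 :: 'a where x0: "x0 \<noteq> 0" using C ne(1) by (metis all_not_in_conv)
  have ev: "eventually (\<lambda>n. emeasure M C * emeasure N D \<le> emeasure N (fatten C n) * emeasure M (fatten D n)) sequentially"
    using limC(2) limD(2)
  proof eventually_elim
    case (elim n)
    obtain e1 where e1: "0 < e1" "e1 \<le> 1" "\<And>x y. x \<in> C \<Longrightarrow> near e1 x y \<Longrightarrow> y \<in> fatten C n"
      using fatten_near[OF C(1)] by metis
    obtain e2 where e2: "0 < e2" "e2 \<le> 1" "\<And>x y. x \<in> D \<Longrightarrow> near e2 x y \<Longrightarrow> y \<in> fatten D n"
      using fatten_near[OF D(1)] by metis
    define e where "e = min e1 e2"
    have e: "0 < e" "e \<le> 1" using e1 e2 by (auto simp: e_def)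
    have eC: "x \<in> C \<Longrightarrow> near e x y \<Longrightarrow> y \<in> fatten C n" for x y
      using near_mono[OF e(1), of e1 x y] e1(3)[of x y] by (simp add: e_def)
    have eD: "x \<in> D \<Longrightarrow> near e x y \<Longrightarrow> y \<in> fatten D n" for x y
      using near_mono[OF e(1), of e2 x y] e2(3)[of x y] by (simp add: e_def)
    let ?m = "emeasure M {z. near e x0 z}" and ?n = "emeasure N {z. near e x0 z}"
    have s1: "emeasure M C * ?n \<le> ?m * emeasure N (fatten C n)"
      by (rule similarity_invariant_step[OF M N C cl elim(1) eC x0])
    have s2: "emeasure N D * ?m \<le> ?n * emeasure M (fatten D n)"
      by (rule similarity_invariant_step[OF N M D cl elim(2) eD x0])
    have mfin: "?m < \<infinity>" using M.near_finite[OF x0 e] .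
    have nfin: "?n < \<infinity>" using N.near_finite[OF x0 e] .
    have "open {z. near e x0 z}" unfolding near_def by (intro open_Collect_less continuous_intros)
    moreover have "near e x0 x0" using x0 e by (simp add: near_def)
    moreover have "\<not> near e x0 0" by (simp add: near_def)
    ultimately have npos: "?n > 0" using pos[of "{z. near e x0 z}"] by auto
    show ?case
    \<comment> \<open>Open sets are known to have positive measure for N but not for M, which might
      even be zero. A null section forces C to be null for M.\<close>
    proof (cases "?m = 0")
      case True
      then have "emeasure M C * ?n = 0" using s1 by simp
      then have "emeasure M C = 0" using npos by (metis mult_eq_0_iff less_irrefl)
      then show ?thesis by simp
    next
      case False
      have "(emeasure M C * emeasure N D) * (?m * ?n) = (emeasure M C * ?n) * (emeasure N D * ?m)"
        by (simp add: mult_ac)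
      also have "\<dots> \<le> (?m * emeasure N (fatten C n)) * (?n * emeasure M (fatten D n))"
        by (intro mult_mono s1 s2) auto
      also have "\<dots> = (emeasure N (fatten C n) * emeasure M (fatten D n)) * (?m * ?n)"
        by (simp add: mult_ac)
      finally have le: "(emeasure M C * emeasure N D) * (?m * ?n) \<le> (emeasure N (fatten C n) * emeasure M (fatten D n)) * (?m * ?n)" .
      have "0 < ?m * ?n" using False npos by (simp add: ennreal_zero_less_mult_iff zero_less_iff_neq_zero)
      moreover have "?m * ?n < top" using mfin nfin by (simp add: ennreal_mult_less_top)
      ultimately show ?thesis using le by (metis ennreal_mult_le_mult_iff mult.commute less_top not_gr_zero)
    qed
  qed
  have "(\<lambda>n. emeasure N (fatten C n) * emeasure M (fatten D n)) \<longlonglongrightarrow> emeasure N C * emeasure M D"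
    using N.finite_compact[OF C] M.finite_compact[OF D] by (intro tendsto_mult_ennreal limC(1) limD(1)) auto
  from tendsto_lowerbound[OF this ev] show ?thesis by simp
qed auto

text \<open>A closed set is the union of its intersections with the sets
  \<open>exhaustion n\<close>, and these are generators. Allowing the origin in or out makes the
  generators stable under intersection and able to cover the space.\<close>

lemma sigma_sets_compact_punctured:
  "sets (borel :: 'a::euclidean_space measure) = sigma_sets UNIV {C. compact (C - {0})}" (is "_ = sigma_sets UNIV ?E")
proof
  show "sigma_sets UNIV ?E \<subseteq> sets (borel :: 'a measure)"
  proof
    fix X :: "'a set" assume "X \<in> sigma_sets UNIV ?E"
    then show "X \<in> sets borel"
    proof induct
      case (Basic a)
      then have "a - {0} \<in> sets borel" using borel_compact by blast
      then have "a - {0} \<union> {0} \<in> sets borel" by (intro sets.Un) auto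
      moreover have "a = a - {0} \<or> a = a - {0} \<union> {0}" by auto
      ultimately show ?case using \<open>a - {0} \<in> sets borel\<close> by metis
    qed (auto simp: Compl_eq_Diff_UNIV[symmetric])
  qed
  have "closed F \<Longrightarrow> F \<in> sigma_sets UNIV ?E" for F :: "'a set"
  proof -
    assume F: "closed F"
    let ?G = "\<lambda>n. F \<inter> exhaustion n"
    have G: "?G n \<in> ?E" for n
    proof -
      have "?G n - {0} = F \<inter> (exhaustion n - {0})" by auto
      then show ?thesis
        using closed_Int_compact[OF F compact_annulus[of "1 / real (Suc n)" "real n"]]
        by (simp only: exhaustion_minus_zero mem_Collect_eq)
    qed
    have F_eq: "F = (\<Union>n. ?G n)" using UN_exhaustion by blast
    have "(\<Union>n. ?G n) \<in> sigma_sets UNIV ?E"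
      by (rule sigma_sets.Union, rule sigma_sets.Basic, rule G)
    then show ?thesis using F_eq[symmetric] by (rule back_subst[of "\<lambda>X. X \<in> sigma_sets UNIV ?E"])
  qed
  then have "sigma_sets UNIV {F::'a set. closed F} \<subseteq> sigma_sets UNIV ?E"
    by (intro sigma_sets_mono) auto
  then show "sets (borel :: 'a measure) \<subseteq> sigma_sets UNIV ?E"
    by (simp add: borel_eq_closed)
qed

text \<open>The constant is the ratio of the two measures of one fixed annulus A. The ratio
  inequality for the pairs (C, A) and (A, C) together is an equality, so the measures are
  proportional on compact sets off the origin, and these determine them.\<close>

lemma similarity_invariant_unique:
  fixes M N :: "'a::euclidean_space measure"
  assumes M: "similarity_invariant M" and N: "similarity_invariant N"
    and pos: "\<And>U. open U \<Longrightarrow> U \<noteq> {} \<Longrightarrow> 0 \<notin> U \<Longrightarrow> emeasure N U > 0"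
  obtains c :: real where "c \<ge> 0" "M = scale_measure (ennreal c) N"
proof -
  interpret M: similarity_invariant M by fact
  interpret N: similarity_invariant N by fact
  define A where "A = {x::'a. 1 \<le> norm x \<and> norm x \<le> 2}"
  have A: "compact A" "0 \<notin> A" using compact_annulus by (auto simp: A_def)
  define U where "U = {x::'a. 1 < norm x \<and> norm x < 2}"
  have "open U" unfolding U_def by (intro open_Collect_conj open_Collect_less continuous_intros)
  moreover obtain b :: 'a where b: "b \<in> Basis" using nonempty_Basis by blast
  have "(3/2) *\<^sub>R b \<in> U" using b by (simp add: U_def)
  then have "U \<noteq> {}" by blast
  ultimately have "0 < emeasure N U" by (intro pos) (auto simp: U_def)
  also have "emeasure N U \<le> emeasure N A"
    using A compact_imp_closed by (intro emeasure_mono) (auto simp: U_def A_def N.sets_eq)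
  finally have Npos: "emeasure N A > 0" .
  have Nfin: "emeasure N A < \<infinity>" "emeasure M A < \<infinity>" using A N.finite_compact M.finite_compact by auto
  obtain n where n: "emeasure N A = ennreal n" "n > 0" using Npos Nfin
    by (cases "emeasure N A") auto
  obtain m where m: "emeasure M A = ennreal m" "m \<ge> 0" using Nfin
    by (cases "emeasure M A") auto
  define c where "c = m / n"
  have eq: "emeasure M C = ennreal c * emeasure N C" if C: "compact C" "0 \<notin> C" for C
  proof -
    have "emeasure M C * emeasure N A \<le> emeasure N C * emeasure M A"
      by (rule similarity_invariant_ratio[OF M N pos C A])
    moreover have "emeasure M A * emeasure N C \<le> emeasure N A * emeasure M C"
      by (rule similarity_invariant_ratio[OF M N pos A C])
    ultimately have "emeasure M C * emeasure N A = emeasure N C * emeasure M A" by (simp add: mult.commute)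
    also have "emeasure M A = ennreal c * emeasure N A"
      using m n by (simp add: c_def ennreal_mult[symmetric])
    finally have "emeasure M C * emeasure N A = (ennreal c * emeasure N C) * emeasure N A"
      by (simp add: mult_ac)
    then show ?thesis by (rule ennreal_mult_right_imp_eq) (use n in auto)
  qed
  have "M = scale_measure (ennreal c) N"
  proof (rule measure_eqI_generator_eq[where E="{C. compact (C - {0})}" and \<Omega>=UNIV
      and A=exhaustion])
    show "Int_stable {C::'a set. compact (C - {0})}"
    proof (rule Int_stableI)
      fix a b :: "'a set" assume "a \<in> {C. compact (C - {0})}" "b \<in> {C. compact (C - {0})}"
      then have "compact ((a - {0}) \<inter> (b - {0}))" by (simp add: compact_Int)
      moreover have "(a - {0}) \<inter> (b - {0}) = a \<inter> b - {0}" by auto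
      ultimately show "a \<inter> b \<in> {C. compact (C - {0})}" by simp
    qed
    show "sets M = sigma_sets UNIV {C. compact (C - {0})}" using M.sets_eq sigma_sets_compact_punctured by simp
    show "sets (scale_measure (ennreal c) N) = sigma_sets UNIV {C. compact (C - {0})}"
      using N.sets_eq sigma_sets_compact_punctured by simp
    fix X :: "'a set" assume "X \<in> {C. compact (C - {0})}"
    then have X: "compact (X - {0})" by simp
    have Xb: "X - {0} \<in> sets borel" by (rule borel_compact[OF X])
    \<comment> \<open>The origin is null for both measures, so a generator may be replaced by its
      part away from the origin, to which \<open>eq\<close> applies.\<close>
    have 0: "emeasure M' X = emeasure M' (X - {0})" if "sets M' = sets borel" "emeasure M' {0} = 0" for M' :: "'a measure"
    proof -
      have "emeasure M' ((X - {0}) \<union> (X \<inter> {0})) = emeasure M' (X - {0})"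
      proof (rule emeasure_Un_null_set)
        show "X - {0} \<in> sets M'" using that(1) Xb by simp
        have "X \<inter> {0} = {} \<or> X \<inter> {0} = {0}" by blast
        moreover have "{0} \<in> sets M'" unfolding that(1) by (rule borel_closed) simp
        then have "{0} \<in> null_sets M'" using that(2) by (rule null_setsI[rotated])
        ultimately show "X \<inter> {0} \<in> null_sets M'" by (metis null_sets.empty_sets)
      qed
      moreover have "(X - {0}) \<union> (X \<inter> {0}) = X" by auto
      ultimately show ?thesis by simp
    qed
    show "emeasure M X = emeasure (scale_measure (ennreal c) N) X"
      unfolding emeasure_scale_measure 0[OF M.sets_eq M.zero] 0[OF N.sets_eq N.zero] by (rule eq[OF X]) simp
  next
    show "range exhaustion \<subseteq> {C::'a set. compact (C - {0})}"
      using compact_annulus by (auto simp: exhaustion_minus_zero)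
    show "(\<Union>n. exhaustion n) = (UNIV :: 'a set)" by (rule UN_exhaustion)
    show "emeasure M (exhaustion n) \<noteq> \<infinity>" for n by (rule M.finite_exhaustion)
  qed auto
  moreover have "c \<ge> 0" using m n by (simp add: c_def)
  ultimately show ?thesis using that by blast
qed

section \<open>Integration over the affine Grassmannian\<close>

lemma image_orthogonal_comp:
  fixes T :: "'a::euclidean_space \<Rightarrow> 'a"
  assumes T: "orthogonal_transformation T" and v: "v \<in> V\<^sup>\<bottom>"
  shows "T v \<in> (T ` V)\<^sup>\<bottom>"
  using v by (auto simp: orthogonal_comp_def orthogonal_orthogonal_transformation[OF T])

lemma orth_proj_image:
  fixes T :: "'a::euclidean_space \<Rightarrow> 'a"
  assumes T: "orthogonal_transformation T" and V: "subspace V"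
  shows "orth_proj (T ` V) (T x) = T (orth_proj V x)"
proof (rule orth_proj_eqI)
  show "subspace (T ` V)" using T V by (simp add: linear_subspace_image orthogonal_transformation_linear)
  show "T (orth_proj V x) \<in> T ` V" using orth_proj(1)[OF V] by blast
  have "T (x - orth_proj V x) \<in> (T ` V)\<^sup>\<bottom>"
    by (rule image_orthogonal_comp[OF T orth_proj(2)[OF V]])
  then show "T x - T (orth_proj V x) \<in> (T ` V)\<^sup>\<bottom>"
    using T by (simp add: linear_diff orthogonal_transformation_linear)
qed

lemma sphere_area_pos: "sphere_area n > 0"
  unfolding sphere_area_def by (intro divide_pos_pos mult_pos_pos Gamma_real_pos) auto

lemma grassmannian_mass_pos: "grassmannian_mass k d > 0"
  unfolding grassmannian_mass_def by (intro divide_pos_pos mult_pos_pos prod_pos) (auto simp: sphere_area_pos)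

locale grassmannian_measure =
  fixes k :: nat and \<mu> :: "'a::euclidean_space set measure"
  assumes k: "1 \<le> k" "k < DIM('a)" and invariant: "invariant_grassmannian_measure k \<mu>"
begin

lemma space_mu: "space \<mu> = grassmannian k"
  and sets_mu: "sets \<mu> = sets (grassmannian_borel k)"
  and distr_mu: "orthogonal_transformation T \<Longrightarrow> distr \<mu> \<mu> (\<lambda>\<alpha>. T ` \<alpha>) = \<mu>"
  and mass_mu: "emeasure \<mu> (space \<mu>) = ennreal (grassmannian_mass k DIM('a))"
  using invariant unfolding invariant_grassmannian_measure_def by auto

lemma grassmannianD: "\<alpha> \<in> space \<mu> \<Longrightarrow> subspace \<alpha>" "\<alpha> \<in> space \<mu> \<Longrightarrow> dim \<alpha> = k"
    "\<alpha> \<in> space \<mu> \<Longrightarrow> dim (\<alpha>\<^sup>\<bottom>) = DIM('a) - k"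
  using dim_orthogonal_comp by (auto simp: space_mu grassmannian_def)

sublocale finite_measure \<mu>
  by (rule finite_measureI) (simp add: mass_mu)

sublocale mu_lborel: pair_sigma_finite \<mu> "lborel :: 'a measure" ..

lemma measurable_mu: "measurable \<mu> M = measurable (grassmannian_borel k) M"
  using sets_mu by (rule measurable_cong_sets) simp

lemma measurable_Blinfun: "(\<lambda>\<alpha>. Blinfun (orth_proj \<alpha>)) \<in> borel_measurable \<mu>"
  unfolding measurable_mu grassmannian_borel_def by (rule measurable_vimage_algebra1) simp

lemma blinfun_apply_orth_proj: "\<alpha> \<in> space \<mu> \<Longrightarrow> blinfun_apply (Blinfun (orth_proj \<alpha>)) = orth_proj \<alpha>"
  by (intro bounded_linear_Blinfun_apply bounded_linear_orth_proj grassmannianD)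

lemma measurable_orth_proj_fixed: "(\<lambda>\<alpha>. orth_proj \<alpha> b) \<in> borel_measurable \<mu>"
proof -
  have "(\<lambda>\<alpha>. blinfun_apply (Blinfun (orth_proj \<alpha>)) b) \<in> borel_measurable \<mu>"
    by (rule borel_measurable_continuous_on[OF _ measurable_Blinfun, of "\<lambda>P. blinfun_apply P b"])
      (intro continuous_intros)
  then show ?thesis
    by (subst measurable_cong[where g="\<lambda>\<alpha>. blinfun_apply (Blinfun (orth_proj \<alpha>)) b"])
      (simp_all add: blinfun_apply_orth_proj)
qed

text \<open>Joint measurability follows from separate measurability because the map is linear in x:
  expanded in coordinates it involves only the finitely many functions
  \<open>orth_proj \<alpha> b\<close> of \<alpha>.\<close>

lemma measurable_orth_proj_pair [measurable]:
  "(\<lambda>(\<alpha>, x). orth_proj \<alpha> x) \<in> borel_measurable (\<mu> \<Otimes>\<^sub>M (borel :: 'a measure))"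
proof -
  note [measurable] = measurable_orth_proj_fixed
  have "(\<lambda>(\<alpha>, x). orth_proj \<alpha> x) \<in> borel_measurable (\<mu> \<Otimes>\<^sub>M borel) \<longleftrightarrow>
    (\<lambda>(\<alpha>, x). \<Sum>b\<in>Basis. (x \<bullet> b) *\<^sub>R orth_proj \<alpha> b) \<in> borel_measurable (\<mu> \<Otimes>\<^sub>M (borel :: 'a measure))"
  proof (rule measurable_cong)
    fix z :: "'a set \<times> 'a" assume "z \<in> space (\<mu> \<Otimes>\<^sub>M borel)"
    then obtain \<alpha> x where z: "z = (\<alpha>, x)" "\<alpha> \<in> space \<mu>" by (auto simp: space_pair_measure)
    have lin: "linear (orth_proj \<alpha>)" using linear_orth_proj grassmannianD z(2) by blast
    have "orth_proj \<alpha> x = orth_proj \<alpha> (\<Sum>b\<in>Basis. (x \<bullet> b) *\<^sub>R b)" by (simp add: euclidean_representation)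
    also have "\<dots> = (\<Sum>b\<in>Basis. (x \<bullet> b) *\<^sub>R orth_proj \<alpha> b)"
      by (simp add: linear_sum[OF lin] linear_scale[OF lin])
    finally show "(case z of (\<alpha>, x) \<Rightarrow> orth_proj \<alpha> x) = (case z of (\<alpha>, x) \<Rightarrow> \<Sum>b\<in>Basis. (x \<bullet> b) *\<^sub>R orth_proj \<alpha> b)"
      by (simp add: z)
  qed
  moreover have "(\<lambda>(\<alpha>, x). \<Sum>b\<in>Basis. (x \<bullet> b) *\<^sub>R orth_proj \<alpha> b) \<in> borel_measurable (\<mu> \<Otimes>\<^sub>M (borel :: 'a measure))"
    by measurable
  ultimately show ?thesis by blast
qed

text \<open>The projection onto the rotated plane is the projection onto \<alpha> conjugated by T.
  Conjugation is continuous on operators, and the \<sigma>-algebra is pulled back from the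
  operators.\<close>

lemma measurable_rotate:
  assumes T: "orthogonal_transformation T"
  shows "(\<lambda>\<alpha>. T ` \<alpha>) \<in> measurable \<mu> \<mu>"
proof -
  have img: "T ` \<alpha> \<in> grassmannian k" if "\<alpha> \<in> space \<mu>" for \<alpha>
  proof -
    have "dim (T ` \<alpha>) = dim \<alpha>"
      using T orthogonal_transformation_inj[OF T]
      by (intro dim_image_eq orthogonal_transformation_linear) (auto intro: inj_on_subset)
    then show ?thesis using grassmannianD[OF that] T
      by (simp add: grassmannian_def linear_subspace_image orthogonal_transformation_linear)
  qed
  define S where "S = inv T"
  have S: "orthogonal_transformation S" unfolding S_def by (rule orthogonal_transformation_inv[OF T])
  have TS: "T (S y) = y" for y
    unfolding S_def by (simp add: T orthogonal_transformation_surj surj_f_inv_f)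
  have "(\<lambda>\<alpha>. Blinfun (orth_proj (T ` \<alpha>))) \<in> borel_measurable \<mu>"
  proof (subst measurable_cong[where g="\<lambda>\<alpha>. Blinfun T o\<^sub>L (Blinfun (orth_proj \<alpha>) o\<^sub>L Blinfun S)"])
    fix \<alpha> assume a: "\<alpha> \<in> space \<mu>"
    have bl: "bounded_linear (orth_proj (T ` \<alpha>))"
      using img[OF a] by (intro bounded_linear_orth_proj) (simp add: grassmannian_def)
    show "Blinfun (orth_proj (T ` \<alpha>)) = Blinfun T o\<^sub>L (Blinfun (orth_proj \<alpha>) o\<^sub>L Blinfun S)"
    proof (rule blinfun_eqI)
      fix x
      have "orth_proj (T ` \<alpha>) (T (S x)) = T (orth_proj \<alpha> (S x))"
        by (rule orth_proj_image[OF T grassmannianD(1)[OF a]])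
      then show "blinfun_apply (Blinfun (orth_proj (T ` \<alpha>))) x = blinfun_apply (Blinfun T o\<^sub>L (Blinfun (orth_proj \<alpha>) o\<^sub>L Blinfun S)) x"
        by (simp add: bounded_linear_Blinfun_apply[OF bl] blinfun_apply_orth_proj[OF a] TS
          bounded_linear_Blinfun_apply[OF orthogonal_transformation_bounded_linear[OF T]]
          bounded_linear_Blinfun_apply[OF orthogonal_transformation_bounded_linear[OF S]])
    qed
  next
    show "(\<lambda>\<alpha>. Blinfun T o\<^sub>L (Blinfun (orth_proj \<alpha>) o\<^sub>L Blinfun S)) \<in> borel_measurable \<mu>"
      by (rule borel_measurable_continuous_on[OF _ measurable_Blinfun, of "\<lambda>P. Blinfun T o\<^sub>L (P o\<^sub>L Blinfun S)"])
        (intro continuous_intros)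
  qed
  then have "(\<lambda>\<alpha>. T ` \<alpha>) \<in> measurable \<mu> (grassmannian_borel k)"
    unfolding grassmannian_borel_def using img by (intro measurable_vimage_algebra2) auto
  then show ?thesis using measurable_cong_sets[OF refl sets_mu] by blast
qed

abbreviation fiber_integral :: "('a \<Rightarrow> ennreal) \<Rightarrow> 'a set \<Rightarrow> ennreal" where
  "fiber_integral g \<alpha> \<equiv> (\<integral>\<^sup>+\<eta>. g \<eta> \<partial>subspace_lborel (\<alpha>\<^sup>\<bottom>))"

text \<open>
  The fiber measures are defined by a choice of bases, so that their measurable dependence on \<open>\<alpha>\<close> is not
  apparent. With a Gaussian factor along \<open>\<alpha>\<close> the fiber integral becomes an integral over the whole
  space, whose integrand depends on \<open>\<alpha>\<close> only through the orthogonal projection.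
\<close>

definition gauss_weight :: "'a set \<Rightarrow> 'a \<Rightarrow> ennreal" where
  "gauss_weight \<alpha> x = ennreal (inverse (sqrt (2 * pi) ^ k) * exp (- ((norm (orth_proj \<alpha> x))\<^sup>2 / 2)))"

lemma measurable_gauss_weight[measurable]:
  "(\<lambda>(\<alpha>, x). gauss_weight \<alpha> x) \<in> borel_measurable (\<mu> \<Otimes>\<^sub>M (borel :: 'a measure))"
  unfolding gauss_weight_def by measurable

lemma fiber_integral_eq:
  assumes a: "\<alpha> \<in> space \<mu>" and [measurable]: "g \<in> borel_measurable borel"
  shows "fiber_integral g \<alpha> = (\<integral>\<^sup>+x. g (x - orth_proj \<alpha> x) * gauss_weight \<alpha> x \<partial>lborel)"
proof -
  note [measurable] = measurable_orth_proj[OF grassmannianD(1)[OF a]]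
  let ?A = "sqrt (2 * pi) ^ k"
  have "(\<integral>\<^sup>+x. g (x - orth_proj \<alpha> x) * gauss_weight \<alpha> x \<partial>lborel) =
    (\<integral>\<^sup>+x. ennreal (inverse ?A) * (g (x - orth_proj \<alpha> x) * ennreal (exp (- ((norm (orth_proj \<alpha> x))\<^sup>2 / (2 * 1\<^sup>2))))) \<partial>lborel)"
    unfolding gauss_weight_def by (intro nn_integral_cong) (simp add: ennreal_mult mult_ac)
  also have "\<dots> = ennreal (inverse ?A) * (\<integral>\<^sup>+x. g (x - orth_proj \<alpha> x) * ennreal (exp (- ((norm (orth_proj \<alpha> x))\<^sup>2 / (2 * 1\<^sup>2)))) \<partial>lborel)"
    by (rule nn_integral_cmult) measurable
  also have "\<dots> = ennreal (inverse ?A) * (fiber_integral g \<alpha> * ennreal ?A)"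
    by (subst nn_integral_subspace_gaussian_weight[OF grassmannianD(1)[OF a]]) (simp_all add: grassmannianD(2)[OF a])
  also have "\<dots> = (ennreal (inverse ?A) * ennreal ?A) * fiber_integral g \<alpha>" by (simp add: mult_ac)
  also have "ennreal (inverse ?A) * ennreal ?A = 1"
    by (subst ennreal_mult[symmetric]) auto
  finally show ?thesis by simp
qed

text \<open>This is the mixture of the fiber measures over \<mu>. Written as an image of a weighted
  product measure, it is a measure by construction, independently of the bases chosen in the
  fibers.\<close>

definition nu :: "'a measure" where
  "nu = distr (density (\<mu> \<Otimes>\<^sub>M lborel) (\<lambda>(\<alpha>, x). gauss_weight \<alpha> x)) borel (\<lambda>(\<alpha>, x). x - orth_proj \<alpha> x)"

lemma sets_nu[simp, measurable_cong]: "sets nu = sets borel" by (simp add: nu_def)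
lemma space_nu[simp]: "space nu = UNIV" by (simp add: nu_def)

lemma nn_integral_nu:
  assumes [measurable]: "g \<in> borel_measurable borel"
  shows "(\<integral>\<^sup>+x. g x \<partial>nu) = (\<integral>\<^sup>+\<alpha>. fiber_integral g \<alpha> \<partial>\<mu>)"
proof -
  have "(\<integral>\<^sup>+x. g x \<partial>nu) = (\<integral>\<^sup>+z. (case z of (\<alpha>, x) \<Rightarrow> gauss_weight \<alpha> x) * g (case z of (\<alpha>, x) \<Rightarrow> x - orth_proj \<alpha> x) \<partial>(\<mu> \<Otimes>\<^sub>M lborel))"
    unfolding nu_def by (subst nn_integral_distr) (auto simp: nn_integral_density)
  also have "\<dots> = (\<integral>\<^sup>+\<alpha>. (\<integral>\<^sup>+x. gauss_weight \<alpha> x * g (x - orth_proj \<alpha> x) \<partial>lborel) \<partial>\<mu>)"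
    by (subst lborel.nn_integral_fst[symmetric]) auto
  also have "\<dots> = (\<integral>\<^sup>+\<alpha>. fiber_integral g \<alpha> \<partial>\<mu>)"
    by (intro nn_integral_cong) (simp add: fiber_integral_eq mult.commute)
  finally show ?thesis .
qed

lemma fiber_integral_measurable[measurable]:
  assumes [measurable]: "g \<in> borel_measurable borel"
  shows "fiber_integral g \<in> borel_measurable \<mu>"
proof -
  have "(\<lambda>\<alpha>. \<integral>\<^sup>+x. g (x - orth_proj \<alpha> x) * gauss_weight \<alpha> x \<partial>lborel) \<in> borel_measurable \<mu>"
    by measurable
  then show ?thesis by (subst measurable_cong[OF fiber_integral_eq]) auto
qed

text \<open>The bases chosen for the two complements need not correspond under T. The Gaussian
  formula removes them from both sides and leaves the rotation invariance of
  \<open>lborel\<close>.\<close>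

lemma fiber_integral_rotate:
  assumes a: "\<alpha> \<in> space \<mu>" and [measurable]: "g \<in> borel_measurable borel" and T: "orthogonal_transformation T"
  shows "fiber_integral (\<lambda>x. g (T x)) \<alpha> = fiber_integral g (T ` \<alpha>)"
proof -
  have Ta: "T ` \<alpha> \<in> space \<mu>" using measurable_rotate[OF T] a by (rule measurable_space)
  note [measurable] = orthogonal_transformation_measurable[OF T] measurable_orth_proj[OF grassmannianD(1)[OF Ta]]
  have [measurable]: "gauss_weight (T ` \<alpha>) \<in> borel_measurable borel" unfolding gauss_weight_def by measurable
  have "fiber_integral (\<lambda>x. g (T x)) \<alpha> = (\<integral>\<^sup>+x. g (T (x - orth_proj \<alpha> x)) * gauss_weight \<alpha> x \<partial>lborel)"
    by (rule fiber_integral_eq[OF a]) measurable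
  also have "\<dots> = (\<integral>\<^sup>+x. g (T x - orth_proj (T ` \<alpha>) (T x)) * gauss_weight (T ` \<alpha>) (T x) \<partial>lborel)"
    using T by (intro nn_integral_cong) (simp add: orth_proj_image[OF T grassmannianD(1)[OF a]] linear_diff
        orthogonal_transformation_linear gauss_weight_def orthogonal_transformation_norm)
  also have "\<dots> = (\<integral>\<^sup>+x. g (x - orth_proj (T ` \<alpha>) x) * gauss_weight (T ` \<alpha>) x \<partial>lborel)"
    by (rule nn_integral_lborel_orthogonal[OF T]) measurable
  also have "\<dots> = fiber_integral g (T ` \<alpha>)"
    by (rule fiber_integral_eq[OF Ta, symmetric]) measurable
  finally show ?thesis .
qed

lemma nu_rotate:
  assumes [measurable]: "g \<in> borel_measurable borel" and T: "orthogonal_transformation T"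
  shows "(\<integral>\<^sup>+x. g (T x) \<partial>nu) = (\<integral>\<^sup>+x. g x \<partial>nu)"
proof -
  note [measurable] = orthogonal_transformation_measurable[OF T] measurable_rotate[OF T]
  have "(\<integral>\<^sup>+x. g (T x) \<partial>nu) = (\<integral>\<^sup>+\<alpha>. fiber_integral g (T ` \<alpha>) \<partial>\<mu>)"
    by (subst nn_integral_nu) (auto intro!: nn_integral_cong simp: fiber_integral_rotate T)
  also have "\<dots> = (\<integral>\<^sup>+\<alpha>. fiber_integral g \<alpha> \<partial>distr \<mu> \<mu> (\<lambda>\<alpha>. T ` \<alpha>))"
    by (rule nn_integral_distr[symmetric]) measurable
  also have "\<dots> = (\<integral>\<^sup>+x. g x \<partial>nu)" by (simp add: distr_mu[OF T] nn_integral_nu)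
  finally show ?thesis .
qed

lemma nu_scale:
  assumes [measurable]: "g \<in> borel_measurable borel" and t: "t > 0"
  shows "(\<integral>\<^sup>+x. g (t *\<^sub>R x) \<partial>nu) = ennreal (inverse (t ^ (DIM('a) - k))) * (\<integral>\<^sup>+x. g x \<partial>nu)"
proof -
  have "(\<integral>\<^sup>+x. g (t *\<^sub>R x) \<partial>nu) = (\<integral>\<^sup>+\<alpha>. ennreal (inverse (t ^ (DIM('a) - k))) * fiber_integral g \<alpha> \<partial>\<mu>)"
    using t by (subst nn_integral_nu)
      (auto intro!: nn_integral_cong simp: nn_integral_subspace_lborel_scale grassmannianD)
  then show ?thesis by (simp add: nn_integral_cmult nn_integral_nu)
qed

text \<open>One test function serves twice: its integral is finite, which bounds the measure of
  balls, and nonzero, which later excludes a vanishing constant in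
  \<open>fiber_integral_formula\<close>.\<close>

lemma nu_gaussian:
  "(\<integral>\<^sup>+x. ennreal (exp (- ((norm x)\<^sup>2 / 2))) \<partial>nu) =
    ennreal (sqrt (2 * pi) ^ (DIM('a) - k)) * ennreal (grassmannian_mass k DIM('a))"
proof -
  have "(\<integral>\<^sup>+x. ennreal (exp (- ((norm x)\<^sup>2 / 2))) \<partial>nu) = (\<integral>\<^sup>+\<alpha>. ennreal (sqrt (2 * pi) ^ (DIM('a) - k)) \<partial>\<mu>)"
  proof (subst nn_integral_nu, simp, rule nn_integral_cong)
    fix \<alpha> assume a: "\<alpha> \<in> space \<mu>"
    show "fiber_integral (\<lambda>x. ennreal (exp (- ((norm x)\<^sup>2 / 2)))) \<alpha> = ennreal (sqrt (2 * pi) ^ (DIM('a) - k))"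
      using nn_integral_gaussian_subspace[OF subspace_orthogonal_comp, of 1 \<alpha>] by (simp add: grassmannianD[OF a])
  qed
  then show ?thesis by (simp add: mass_mu)
qed

lemma nu_cball_finite: "emeasure nu (cball 0 b) < \<infinity>"
proof -
  have "emeasure nu (cball 0 b) = (\<integral>\<^sup>+x. indicator (cball 0 b) x \<partial>nu)" by simp
  also have "\<dots> \<le> (\<integral>\<^sup>+x. ennreal (exp (b\<^sup>2 / 2)) * ennreal (exp (- ((norm x)\<^sup>2 / 2))) \<partial>nu)"
  proof (rule nn_integral_mono)
    fix x
    show "indicator (cball 0 b) x \<le> ennreal (exp (b\<^sup>2 / 2)) * ennreal (exp (- ((norm x)\<^sup>2 / 2)))"
    proof (cases "x \<in> cball 0 b")
      case True
      then have "(norm x)\<^sup>2 \<le> b\<^sup>2" by (auto intro: power_mono)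
      then have "1 \<le> exp (b\<^sup>2 / 2) * exp (- ((norm x)\<^sup>2 / 2))" by (simp flip: exp_add)
      then show ?thesis using True by (simp add: ennreal_mult[symmetric])
    qed simp
  qed
  also have "\<dots> < \<infinity>"
    by (subst nn_integral_cmult) (auto simp: nu_gaussian ennreal_mult_less_top)
  finally show ?thesis .
qed

text \<open>The origin is fixed by the dilation by 2, so its finite mass equals itself times
  \<open>inverse (2 ^ (DIM('a) - k))\<close>. This factor is below 1 because
  \<open>k < DIM('a)\<close>.\<close>

lemma nu_zero: "emeasure nu {0} = 0"
proof -
  have scaled: "(\<integral>\<^sup>+x. indicator {0} (2 *\<^sub>R x) \<partial>nu) = ennreal (inverse (2 ^ (DIM('a) - k))) * (\<integral>\<^sup>+x. indicator {0} x \<partial>nu)"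
    by (rule nu_scale) auto
  have eq: "emeasure nu {0} = ennreal (inverse (2 ^ (DIM('a) - k))) * emeasure nu {0}"
  proof -
    have "(\<integral>\<^sup>+x. indicator {0} (2 *\<^sub>R x) \<partial>nu) = (\<integral>\<^sup>+x. indicator {0} x \<partial>nu)"
      by (intro nn_integral_cong) (simp add: indicator_def)
    with scaled show ?thesis by simp
  qed
  have "emeasure nu {0} \<le> emeasure nu (cball 0 1)" by (intro emeasure_mono) auto
  then have "emeasure nu {0} < \<infinity>" using nu_cball_finite[of 1] by (rule le_less_trans)
  then obtain r where r: "emeasure nu {0} = ennreal r" "r \<ge> 0" by (cases "emeasure nu {0}") auto
  with eq have "ennreal r = ennreal (inverse (2 ^ (DIM('a) - k)) * r)" by (simp add: ennreal_mult)
  then have "r = inverse (2 ^ (DIM('a) - k)) * r" using r by (subst (asm) ennreal_inj) auto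
  moreover have "inverse (2 ^ (DIM('a) - k)) < (1::real)" using k by (simp add: inverse_less_1_iff one_less_power)
  ultimately have "r = 0" by (metis less_irrefl mult_cancel_right1)
  then show ?thesis using r by simp
qed

end

text \<open>The weight is homogeneous of degree -n, which cancels the factor
  \<open>inverse (t ^ n)\<close> that a dilation produces in M; rotations do not change the
  weight.\<close>

lemma similarity_invariant_density:
  fixes M :: "'a::euclidean_space measure"
  assumes M: "sets M = sets borel"
    and rot: "\<And>T g. orthogonal_transformation T \<Longrightarrow> g \<in> borel_measurable borel \<Longrightarrow> (\<integral>\<^sup>+x. g (T x) \<partial>M) = (\<integral>\<^sup>+x. g x \<partial>M)"
    and sc: "\<And>t g. t > 0 \<Longrightarrow> g \<in> borel_measurable borel \<Longrightarrow> (\<integral>\<^sup>+x. g (t *\<^sub>R x) \<partial>M) = ennreal (inverse (t ^ n)) * (\<integral>\<^sup>+x. g x \<partial>M)"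
    and fin: "\<And>b. emeasure M (cball 0 b) < \<infinity>" and z: "emeasure M {0} = 0"
  shows "similarity_invariant (density M (\<lambda>x. ennreal (inverse (norm x ^ n))))"
proof
  note [measurable_cong] = M
  let ?w = "\<lambda>x::'a. ennreal (inverse (norm x ^ n))"
  show "sets (density M ?w) = sets borel" using M by simp
  have em: "emeasure (density M ?w) A = (\<integral>\<^sup>+x. ?w x * indicator A x \<partial>M)" if [measurable]: "A \<in> sets borel" for A
    by (rule emeasure_density) measurable
  {
    fix T :: "'a \<Rightarrow> 'a" and A :: "'a set" assume T: "orthogonal_transformation T" and A[measurable]: "A \<in> sets borel"
    note [measurable] = orthogonal_transformation_measurable[OF T]
    have TA: "T -` A \<in> sets borel" by (rule measurable_sets_borel[OF _ A]) measurable
    have "emeasure (density M ?w) (T -` A) = (\<integral>\<^sup>+x. ?w (T x) * indicator A (T x) \<partial>M)"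
      unfolding em[OF TA] by (intro nn_integral_cong) (simp add: orthogonal_transformation_norm[OF T] indicator_def)
    also have "\<dots> = (\<integral>\<^sup>+x. ?w x * indicator A x \<partial>M)" by (rule rot[OF T]) measurable
    finally show "emeasure (density M ?w) (T -` A) = emeasure (density M ?w) A" by (simp add: em A)
  }
  {
    fix t :: real and A :: "'a set" assume t: "t > 0" and A[measurable]: "A \<in> sets borel"
    have TA: "(\<lambda>x. t *\<^sub>R x) -` A \<in> sets borel" by (rule measurable_sets_borel[OF _ A]) measurable
    have "emeasure (density M ?w) ((\<lambda>x. t *\<^sub>R x) -` A) = (\<integral>\<^sup>+x. ennreal (t ^ n) * (?w (t *\<^sub>R x) * indicator A (t *\<^sub>R x)) \<partial>M)"
      unfolding em[OF TA]
    proof (intro nn_integral_cong)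
      fix x :: 'a
      have "inverse (norm x ^ n) = t ^ n * inverse (norm (t *\<^sub>R x) ^ n)" using t by (simp add: power_mult_distrib field_simps)
      then have "?w x = ennreal (t ^ n) * ?w (t *\<^sub>R x)" using t by (simp only: ennreal_mult[symmetric]) (simp add: ennreal_mult[symmetric])
      then show "?w x * indicator ((\<lambda>x. t *\<^sub>R x) -` A) x = ennreal (t ^ n) * (?w (t *\<^sub>R x) * indicator A (t *\<^sub>R x))"
        by (simp add: indicator_def)
    qed
    also have "\<dots> = ennreal (t ^ n) * (\<integral>\<^sup>+x. ?w (t *\<^sub>R x) * indicator A (t *\<^sub>R x) \<partial>M)"
      by (rule nn_integral_cmult) measurable
    also have "\<dots> = ennreal (t ^ n) * (ennreal (inverse (t ^ n)) * (\<integral>\<^sup>+x. ?w x * indicator A x \<partial>M))"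
      by (subst sc[OF t, of "\<lambda>x. ?w x * indicator A x"]) auto
    also have "\<dots> = (\<integral>\<^sup>+x. ?w x * indicator A x \<partial>M)"
      using t by (simp add: mult.assoc[symmetric] ennreal_mult[symmetric])
    finally show "emeasure (density M ?w) ((\<lambda>x. t *\<^sub>R x) -` A) = emeasure (density M ?w) A" by (simp add: em A)
  }
  {
    fix a b :: real assume a: "a > 0"
    have "emeasure (density M ?w) {x. a \<le> norm x \<and> norm x \<le> b} \<le> (\<integral>\<^sup>+x. ennreal (inverse (a ^ n)) * indicator (cball 0 b) x \<partial>M)"
    proof (subst em, measurable, rule nn_integral_mono)
      fix x :: 'a
      have "a \<le> norm x \<Longrightarrow> inverse (norm x ^ n) \<le> inverse (a ^ n)"
        using a by (intro le_imp_inverse_le power_mono) auto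
      then show "?w x * indicator {x. a \<le> norm x \<and> norm x \<le> b} x \<le> ennreal (inverse (a ^ n)) * indicator (cball 0 b) x"
        by (auto simp: indicator_def intro: ennreal_leI)
    qed
    also have "\<dots> = ennreal (inverse (a ^ n)) * emeasure M (cball 0 b)"
      by (rule nn_integral_cmult_indicator) (simp add: M)
    also have "\<dots> < \<infinity>" using fin[of b] by (simp add: ennreal_mult_less_top)
    finally show "emeasure (density M ?w) {x. a \<le> norm x \<and> norm x \<le> b} < \<infinity>" .
  }
  have "{0::'a} \<in> sets borel" by (rule borel_closed) simp
  \<comment> \<open>At the origin the weight is 0 or 1 according to whether n is positive; the bound
    by infinity covers both, as the origin is null for M.\<close>
  then have "emeasure (density M ?w) {0} \<le> (\<integral>\<^sup>+x. \<infinity> * indicator {0} x \<partial>M)"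
    by (subst em) (auto intro!: nn_integral_mono simp: indicator_def)
  also have "\<dots> = \<infinity> * emeasure M {0}" by (rule nn_integral_cmult_indicator) (simp add: M)
  finally show "emeasure (density M ?w) {0} = 0" using z by simp
qed

lemma nn_integral_density_inverse_norm:
  fixes M :: "'a::euclidean_space measure"
  assumes M: "sets M = sets borel" and z: "emeasure M {0} = 0" and [measurable]: "g \<in> borel_measurable borel"
  shows "(\<integral>\<^sup>+x. g x * ennreal (norm x ^ m) \<partial>density M (\<lambda>x. ennreal (inverse (norm x ^ n)))) =
    (\<integral>\<^sup>+x. g x * ennreal (norm x ^ m * inverse (norm x ^ n)) \<partial>M)"
proof -
  note [measurable_cong] = M
  show ?thesis
    by (subst nn_integral_density) (auto simp: mult_ac ennreal_mult intro!: nn_integral_cong)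
qed

context grassmannian_measure
begin

text \<open>The measure \<open>nu\<close> is homogeneous of degree \<open>DIM('a) - k\<close> and
  \<open>lborel\<close> of degree \<open>DIM('a)\<close>. Divided by these powers of the norm both
  are similarity invariant, hence proportional; multiplying back by the first power leaves
  \<open>inverse (norm x ^ k)\<close> on the side of \<open>lborel\<close>.\<close>

theorem fiber_integral_formula:
  obtains c :: real where "c > 0"
    and "\<And>g. g \<in> borel_measurable borel \<Longrightarrow> (\<integral>\<^sup>+\<alpha>. fiber_integral g \<alpha> \<partial>\<mu>) = ennreal c * (\<integral>\<^sup>+x. g x * ennreal (inverse (norm x ^ k)) \<partial>lborel)"
proof -
  let ?m = "DIM('a) - k"
  let ?M = "density nu (\<lambda>x. ennreal (inverse (norm x ^ ?m)))"
  let ?N = "density (lborel :: 'a measure) (\<lambda>x. ennreal (inverse (norm x ^ DIM('a))))"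
  have M: "similarity_invariant ?M"
    by (rule similarity_invariant_density[OF sets_nu nu_rotate nu_scale nu_cball_finite nu_zero])
  have N: "similarity_invariant ?N"
    by (rule similarity_invariant_density)
      (simp_all add: nn_integral_lborel_orthogonal nn_integral_lborel_scale emeasure_lborel_cball_finite[unfolded infinity_ennreal_def])
  have pos: "emeasure ?N U > 0" if U: "open U" "U \<noteq> {}" "0 \<notin> U" for U
  proof (rule ccontr)
    assume "\<not> emeasure ?N U > 0"
    then have "emeasure ?N U = 0" by (simp add: zero_less_iff_neq_zero)
    moreover have [measurable]: "U \<in> sets borel" using U by simp
    ultimately have "(\<integral>\<^sup>+x. ennreal (inverse (norm x ^ DIM('a))) * indicator U x \<partial>lborel) = 0"
      by (subst (asm) emeasure_density) auto
    then have "AE x in lborel. ennreal (inverse (norm x ^ DIM('a))) * indicator U x = 0"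
      by (subst (asm) nn_integral_0_iff_AE) auto
    then have "AE x in lborel. x \<notin> U"
      by (rule eventually_mono) (use U(3) in \<open>auto simp: indicator_def split: if_splits\<close>)
    then have "emeasure lborel U = 0" by (subst (asm) AE_iff_measurable[of U]) auto
    then have "U \<in> null_sets lborel" by (simp add: null_sets_def)
    then have "negligible U" by (simp add: negligible_iff_null_sets null_sets_completionI)
    then show False using open_not_negligible U by blast
  qed
  obtain c where c: "c \<ge> 0" "?M = scale_measure (ennreal c) ?N"
    using similarity_invariant_unique[OF M N pos] by metis
  have formula: "(\<integral>\<^sup>+\<alpha>. fiber_integral g \<alpha> \<partial>\<mu>) = ennreal c * (\<integral>\<^sup>+x. g x * ennreal (inverse (norm x ^ k)) \<partial>lborel)"
    if [measurable]: "g \<in> borel_measurable borel" for g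
  proof -
    \<comment> \<open>At the origin \<open>norm x ^ ?m * inverse (norm x ^ ?m)\<close> evaluates to
      0 and not to 1, since \<open>?m\<close> is positive.\<close>
    have "AE x in nu. x \<noteq> 0"
      using nu_zero by (subst AE_iff_measurable[of "{0}"]) auto
    then have "(\<integral>\<^sup>+x. g x \<partial>nu) = (\<integral>\<^sup>+x. g x * ennreal (norm x ^ ?m * inverse (norm x ^ ?m)) \<partial>nu)"
      by (intro nn_integral_cong_AE) (auto elim!: eventually_mono)
    also have "\<dots> = (\<integral>\<^sup>+x. g x * ennreal (norm x ^ ?m) \<partial>?M)"
      by (rule nn_integral_density_inverse_norm[symmetric]) (simp_all add: nu_zero)
    also have "\<dots> = ennreal c * (\<integral>\<^sup>+x. g x * ennreal (norm x ^ ?m) \<partial>?N)"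
      unfolding c(2) by (rule nn_integral_scale_measure) simp
    also have "(\<integral>\<^sup>+x. g x * ennreal (norm x ^ ?m) \<partial>?N) = (\<integral>\<^sup>+x. g x * ennreal (norm x ^ ?m * inverse (norm x ^ DIM('a))) \<partial>lborel)"
      by (rule nn_integral_density_inverse_norm) simp_all
    also have "\<dots> = (\<integral>\<^sup>+x. g x * ennreal (inverse (norm x ^ k)) \<partial>lborel)"
    proof (rule nn_integral_cong_AE, rule eventually_mono[OF AE_lborel_singleton[of 0]])
      fix x :: 'a assume "x \<noteq> 0"
      then have "norm x ^ ?m * inverse (norm x ^ DIM('a)) = inverse (norm x ^ k)"
        using k by (simp add: power_diff field_simps)
      then show "g x * ennreal (norm x ^ ?m * inverse (norm x ^ DIM('a))) = g x * ennreal (inverse (norm x ^ k))" by simp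
    qed
    finally show ?thesis by (simp add: nn_integral_nu)
  qed
  have "c \<noteq> 0"
  proof
    assume "c = 0"
    with formula[of "\<lambda>x. ennreal (exp (- ((norm x)\<^sup>2 / 2)))"] nu_gaussian
    have "ennreal (sqrt (2 * pi) ^ (DIM('a) - k)) * ennreal (grassmannian_mass k DIM('a)) = 0"
      by (simp add: nn_integral_nu)
    then show False using grassmannian_mass_pos[of k "DIM('a)"] by simp
  qed
  with c(1) formula show ?thesis by (intro that[of c]) auto
qed

end

section \<open>Smooth functions and bump functions\<close>

definition pd :: "'a::euclidean_space \<Rightarrow> ('a \<Rightarrow> complex) \<Rightarrow> 'a \<Rightarrow> complex" where
  "pd v g x = frechet_derivative g (at x) v"

lemma iter_deriv_Nil[simp]: "iter_deriv [] \<phi> = \<phi>"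
  by (simp add: iter_deriv_def)

lemma iter_deriv_Cons[simp]: "iter_deriv (v # vs) \<phi> = pd v (iter_deriv vs \<phi>)"
  by (simp add: iter_deriv_def pd_def fun_eq_iff)

lemma iter_deriv_append: "iter_deriv (us @ vs) \<phi> = iter_deriv us (iter_deriv vs \<phi>)"
  by (simp add: iter_deriv_def)

lemma pd_eqI: "(g has_derivative g') (at x) \<Longrightarrow> pd v g x = g' v"
  unfolding pd_def using frechet_derivative_at by metis

lemma has_derivative_frechet:
  "g differentiable (at x) \<Longrightarrow> (g has_derivative (\<lambda>v. pd v g x)) (at x)"
  unfolding pd_def by (simp add: frechet_derivative_works eta_contract_eq)

lemma smoothD:
  assumes "smooth \<phi>"
  shows "set vs \<subseteq> Basis \<Longrightarrow> iter_deriv vs \<phi> differentiable (at x)" "\<phi> differentiable (at x)"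
proof -
  show d: "set vs \<subseteq> Basis \<Longrightarrow> iter_deriv vs \<phi> differentiable (at x)" for vs
    using assms by (auto simp: smooth_def)
  show "\<phi> differentiable (at x)" using d[of "[]"] by simp
qed

lemma smooth_iter_deriv: "smooth \<phi> \<Longrightarrow> set vs \<subseteq> Basis \<Longrightarrow> smooth (iter_deriv vs \<phi>)"
  by (auto simp: smooth_def iter_deriv_append[symmetric])

lemma smooth_pd: "smooth \<phi> \<Longrightarrow> b \<in> Basis \<Longrightarrow> smooth (pd b \<phi>)"
  using smooth_iter_deriv[of \<phi> "[b]"] by simp

lemma smooth_continuous: "smooth \<phi> \<Longrightarrow> continuous_on S \<phi>"
  using smoothD(2) differentiable_imp_continuous_within continuous_at_imp_continuous_on by metis

lemma smooth_coinduct: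
  assumes "P \<phi>" and step: "\<And>g x. P g \<Longrightarrow> g differentiable (at x)" "\<And>g b. P g \<Longrightarrow> b \<in> Basis \<Longrightarrow> P (pd b g)"
  shows "smooth \<phi>"
proof -
  have "P (iter_deriv vs \<phi>)" if "set vs \<subseteq> Basis" for vs
    using that by (induction vs) (use assms in auto)
  then show ?thesis using step(1) by (auto simp: smooth_def)
qed

text \<open>The product rule leads out of a family of functions closed under derivatives, but not
  out of the algebra generated by it. So smoothness can be checked on generators whose derivatives
  are polynomial expressions in the generators.\<close>

inductive_set func_algebra :: "('a \<Rightarrow> complex) set \<Rightarrow> ('a \<Rightarrow> complex) set" for G where
  gen: "g \<in> G \<Longrightarrow> g \<in> func_algebra G"
| const: "(\<lambda>_. c) \<in> func_algebra G"
| add: "f \<in> func_algebra G \<Longrightarrow> g \<in> func_algebra G \<Longrightarrow> (\<lambda>x. f x + g x) \<in> func_algebra G"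
| mult: "f \<in> func_algebra G \<Longrightarrow> g \<in> func_algebra G \<Longrightarrow> (\<lambda>x. f x * g x) \<in> func_algebra G"

lemma pd_const: "pd v (\<lambda>_. c) = (\<lambda>_. 0)"
  by (intro ext pd_eqI) (auto intro!: derivative_eq_intros)

lemma pd_add:
  assumes "f differentiable (at x)" "g differentiable (at x)"
  shows "pd v (\<lambda>x. f x + g x) x = pd v f x + pd v g x"
  by (rule pd_eqI) (intro has_derivative_add has_derivative_frechet assms)

lemma pd_mult:
  assumes "f differentiable (at x)" "g differentiable (at x)"
  shows "pd v (\<lambda>x. f x * g x) x = f x * pd v g x + pd v f x * g x"
  by (rule pd_eqI) (intro has_derivative_mult has_derivative_frechet assms)

lemma smooth_func_algebra:
  assumes d: "\<And>g x. g \<in> G \<Longrightarrow> g differentiable (at x)"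
    and p: "\<And>g b. g \<in> G \<Longrightarrow> b \<in> Basis \<Longrightarrow> pd b g \<in> func_algebra G"
    and h: "h \<in> func_algebra G"
  shows "smooth h"
proof (rule smooth_coinduct[where P="\<lambda>h. h \<in> func_algebra G"])
  have diff: "\<forall>x. g differentiable (at x)" if "g \<in> func_algebra G" for g
    using that by induction (auto simp: d intro: differentiable_add differentiable_mult)
  then show "\<And>g x. g \<in> func_algebra G \<Longrightarrow> g differentiable (at x)" by blast
  show "pd b g \<in> func_algebra G" if "g \<in> func_algebra G" "b \<in> Basis" for g b
    using that(1)
  proof induction
    case (gen g)
    then show ?case using p that(2) by blast
  next
    case (const c)
    then show ?case by (simp add: pd_const func_algebra.const)
  next
    case (add f g)
    have "pd b (\<lambda>x. f x + g x) = (\<lambda>x. pd b f x + pd b g x)"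
      using diff add by (intro ext pd_add) auto
    then show ?case using add by (simp add: func_algebra.add)
  next
    case (mult f g)
    have "pd b (\<lambda>x. f x * g x) = (\<lambda>x. f x * pd b g x + pd b f x * g x)"
      using diff mult by (intro ext pd_mult) auto
    then show ?case using mult by (simp add: func_algebra.add func_algebra.mult)
  qed
qed (rule h)

lemma smooth_in_algebra: "h \<in> func_algebra (Collect smooth) \<Longrightarrow> smooth h"
  by (rule smooth_func_algebra[of "Collect smooth"]) (auto intro: smoothD smooth_pd func_algebra.gen)

lemma smooth_const: "smooth (\<lambda>_. c)"
  by (intro smooth_in_algebra func_algebra.const)

lemma smooth_add: "smooth f \<Longrightarrow> smooth g \<Longrightarrow> smooth (\<lambda>x. f x + g x)"
  by (intro smooth_in_algebra func_algebra.add func_algebra.gen) auto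

lemma smooth_mult: "smooth f \<Longrightarrow> smooth g \<Longrightarrow> smooth (\<lambda>x. f x * g x)"
  by (intro smooth_in_algebra func_algebra.mult func_algebra.gen) auto

lemma smooth_minus: "smooth f \<Longrightarrow> smooth (\<lambda>x. - f x)"
  using smooth_mult[OF smooth_const[of "-1"]] by simp

lemma smooth_diff: "smooth f \<Longrightarrow> smooth g \<Longrightarrow> smooth (\<lambda>x. f x - g x)"
  using smooth_add[OF _ smooth_minus] by simp

lemma smooth_sum: "finite I \<Longrightarrow> (\<And>i. i \<in> I \<Longrightarrow> smooth (f i)) \<Longrightarrow> smooth (\<lambda>x. \<Sum>i\<in>I. f i x)"
  by (induction I rule: finite_induct) (auto intro: smooth_const smooth_add)

lemma smooth_prod: "finite I \<Longrightarrow> (\<And>i. i \<in> I \<Longrightarrow> smooth (f i)) \<Longrightarrow> smooth (\<lambda>x. \<Prod>i\<in>I. f i x)"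
  by (induction I rule: finite_induct) (auto intro: smooth_const smooth_mult)

text \<open>Adjoining f to the smooth functions gives a generating set that is again closed under
  partial derivatives.\<close>

lemma smoothI_derivative:
  assumes "\<And>x. (f has_derivative f' x) (at x)" "\<And>b. b \<in> Basis \<Longrightarrow> smooth (\<lambda>x. f' x b)"
  shows "smooth f"
proof -
  have "pd b f = (\<lambda>x. f' x b)" for b using pd_eqI[OF assms(1)] by auto
  then show ?thesis
    using assms by (intro smooth_func_algebra[of "insert f (Collect smooth)"])
      (auto intro: func_algebra.gen smoothD smooth_pd differentiableI)
qed

lemma smooth_inner: "smooth (\<lambda>x. complex_of_real (x \<bullet> v))"
  by (rule smoothI_derivative[where f'="\<lambda>_ h. complex_of_real (h \<bullet> v)"])
    (auto intro!: derivative_eq_intros smooth_const)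

lemma smooth_norm_sq: "smooth (\<lambda>x::'a::euclidean_space. complex_of_real ((norm (x - a))\<^sup>2))"
proof -
  have eq: "(\<lambda>x. complex_of_real ((norm (x - a))\<^sup>2)) = (\<lambda>x. \<Sum>b\<in>Basis. (complex_of_real (x \<bullet> b) - complex_of_real (a \<bullet> b)) * (complex_of_real (x \<bullet> b) - complex_of_real (a \<bullet> b)))"
    by (intro ext, subst power2_norm_eq_inner, subst euclidean_inner) (simp add: inner_diff_left)
  show ?thesis unfolding eq
    by (intro smooth_sum smooth_mult smooth_diff smooth_inner smooth_const) simp
qed

text \<open>A recursion of this shape is satisfied by exponentials and by the functions \<open>t\<^sup>-\<^sup>n e\<^sup>-\<^sup>1\<^sup>/\<^sup>t\<close> below.\<close>

lemma smooth_compose_family: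
  fixes \<beta> :: "nat \<Rightarrow> real \<Rightarrow> complex"
  assumes \<beta>: "\<And>n t. (\<beta> n has_vector_derivative (c n * \<beta> (Suc n) t + d n * \<beta> (Suc (Suc n)) t)) (at t)"
    and q: "smooth (\<lambda>x. complex_of_real (q x))"
  shows "smooth (\<lambda>x. \<beta> n (q x))"
proof -
  let ?q = "\<lambda>x. complex_of_real (q x)"
  \<comment> \<open>The chain rule expresses a derivative of \<open>\<beta> n (q x)\<close> through
    later members of the family and a derivative of q, all of which lie in the algebra generated by
    this set.\<close>
  let ?G = "range (\<lambda>n x. \<beta> n (q x)) \<union> Collect smooth"
  have qd: "(q has_derivative (\<lambda>v. Re (pd v ?q x))) (at x)" for x
    using has_derivative_Re[OF has_derivative_frechet[OF smoothD(2)[OF q]]] by simp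
  have real: "pd v ?q x = of_real (Re (pd v ?q x))" for v x
    by (rule pd_eqI) (intro has_derivative_of_real qd)
  have der: "((\<lambda>x. \<beta> n (q x)) has_derivative (\<lambda>v. pd v ?q x * (c n * \<beta> (Suc n) (q x) + d n * \<beta> (Suc (Suc n)) (q x)))) (at x)" for n x
  proof -
    have "((\<lambda>x. \<beta> n (q x)) has_derivative (\<lambda>v. Re (pd v ?q x) *\<^sub>R (c n * \<beta> (Suc n) (q x) + d n * \<beta> (Suc (Suc n)) (q x)))) (at x)"
      using has_derivative_compose[OF qd, of "\<beta> n" "\<lambda>h. h *\<^sub>R (c n * \<beta> (Suc n) (q x) + d n * \<beta> (Suc (Suc n)) (q x))"]
        \<beta>[of n "q x"] by (simp add: has_vector_derivative_def)
    then show ?thesis by (subst real) (simp add: scaleR_conv_of_real)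
  qed
  show ?thesis
  proof (rule smooth_func_algebra[of ?G])
    show "g differentiable (at x)" if "g \<in> ?G" for g x
      using that der smoothD(2) by (auto simp: differentiable_def)
    show "pd b g \<in> func_algebra ?G" if g: "g \<in> ?G" and b: "b \<in> Basis" for g b
    proof (cases "smooth g")
      case True
      then show ?thesis using b by (auto intro: func_algebra.gen smooth_pd)
    next
      case False
      then obtain n where n: "g = (\<lambda>x. \<beta> n (q x))" using g by blast
      have "pd b g = (\<lambda>x. pd b ?q x * (c n * \<beta> (Suc n) (q x) + d n * \<beta> (Suc (Suc n)) (q x)))"
        unfolding n by (intro ext pd_eqI[OF der])
      also have "\<dots> \<in> func_algebra ?G"
        using smooth_pd[OF q b] by (intro func_algebra.mult func_algebra.add func_algebra.const) (auto intro: func_algebra.gen)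
      finally show ?thesis .
    qed
  qed (auto intro: func_algebra.gen)
qed

lemma smooth_cis:
  assumes q: "smooth (\<lambda>x. complex_of_real (q x))"
  shows "smooth (\<lambda>x. cis (q x))"
  by (rule smooth_compose_family[where \<beta>="\<lambda>_. cis" and c="\<lambda>_. \<i>" and d="\<lambda>_. 0", OF _ q])
    (auto intro!: derivative_eq_intros simp: has_vector_derivative_def scaleR_conv_of_real mult_ac)

section \<open>Flat functions and bumps\<close>

definition flat :: "nat \<Rightarrow> real \<Rightarrow> real" where
  "flat n t = (if t > 0 then (1 / t) ^ n * exp (- (1 / t)) else 0)"

lemma flat_tendsto_0: "(flat n \<longlongrightarrow> 0) (at_right 0)"
proof -
  have "((\<lambda>u. u ^ n / exp u) \<longlongrightarrow> (0::real)) at_top" by (rule tendsto_power_div_exp_0)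
  then have "((\<lambda>t. (1 / t) ^ n / exp (1 / t)) \<longlongrightarrow> (0::real)) (at_right 0)"
    by (rule filterlim_compose) (simp add: filterlim_inverse_at_top_right inverse_eq_divide[symmetric])
  moreover have "eventually (\<lambda>t. (1 / t) ^ n / exp (1 / t) = flat n t) (at_right 0)"
    unfolding eventually_at_right_field by (intro exI[of _ 1]) (auto simp: flat_def exp_minus field_simps)
  ultimately show ?thesis by (rule Lim_transform_eventually)
qed

text \<open>Away from 0 this is the product rule. At 0 the difference quotient from the right is
  \<open>flat (Suc n)\<close> itself, which tends to 0 because the exponential beats every
  power.\<close>

lemma flat_derivative:
  "(flat n has_real_derivative (- real n * flat (Suc n) t + flat (Suc (Suc n)) t)) (at t)"
proof -
  consider "t > 0" | "t < 0" | "t = 0" by linarith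
  then show ?thesis
  proof cases
    case 1
    have "((\<lambda>t. (1 / t) ^ n * exp (- (1 / t))) has_real_derivative (- real n * flat (Suc n) t + flat (Suc (Suc n)) t)) (at t)"
    proof -
      have u: "((\<lambda>t. 1 / t) has_real_derivative - ((1 / t)\<^sup>2)) (at t)"
        using 1 by (auto intro!: derivative_eq_intros simp: power2_eq_square)
      define u where "u = 1 / t"
      have "((\<lambda>t. (1 / t) ^ n * exp (- (1 / t))) has_real_derivative
          (real n * (- u\<^sup>2 * u ^ (n - Suc 0))) * exp (- u) + (exp (- u) * - (- u\<^sup>2)) * u ^ n) (at t)"
        unfolding u_def by (intro DERIV_mult DERIV_power DERIV_fun_exp DERIV_minus u)
      moreover have "(real n * (- u\<^sup>2 * u ^ (n - Suc 0))) * exp (- u) + (exp (- u) * - (- u\<^sup>2)) * u ^ n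
          = - real n * (u ^ Suc n * exp (- u)) + u ^ Suc (Suc n) * exp (- u)"
        by (cases n) (simp_all add: power2_eq_square algebra_simps)
      ultimately show ?thesis using 1 by (simp only: flat_def u_def if_True)
    qed
    then show ?thesis
      by (rule has_field_derivative_transform_within_open[where S="{0<..}"]) (use 1 in \<open>auto simp: flat_def\<close>)
  next
    case 2
    have "((\<lambda>t. 0) has_real_derivative 0) (at t)" by simp
    then have "(flat n has_real_derivative 0) (at t)"
      by (rule has_field_derivative_transform_within_open[where S="{..<0}"]) (use 2 in \<open>auto simp: flat_def\<close>)
    then show ?thesis using 2 by (simp add: flat_def)
  next
    case 3
    have "((\<lambda>h. (flat n (0 + h) - flat n 0) / h) \<longlongrightarrow> 0) (at 0)"
    proof (rule filterlim_split_at)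
      have "eventually (\<lambda>h. flat (Suc n) h = (flat n (0 + h) - flat n 0) / h) (at_right 0)"
        unfolding eventually_at_right_field by (intro exI[of _ 1]) (auto simp: flat_def field_simps)
      with flat_tendsto_0[of "Suc n"] show "((\<lambda>h. (flat n (0 + h) - flat n 0) / h) \<longlongrightarrow> 0) (at_right 0)"
        by (rule Lim_transform_eventually)
      have "eventually (\<lambda>h. 0 = (flat n (0 + h) - flat n 0) / h) (at_left 0)"
        unfolding eventually_at_left_field by (intro exI[of _ "-1"]) (auto simp: flat_def)
      then show "((\<lambda>h. (flat n (0 + h) - flat n 0) / h) \<longlongrightarrow> 0) (at_left 0)"
        by (rule Lim_transform_eventually[OF tendsto_const])
    qed
    then show ?thesis unfolding 3 by (simp add: DERIV_def flat_def)
  qed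
qed

lemma smooth_flat:
  assumes q: "smooth (\<lambda>x. complex_of_real (q x))"
  shows "smooth (\<lambda>x. complex_of_real (flat n (q x)))"
proof (rule smooth_compose_family[where \<beta>="\<lambda>n t. complex_of_real (flat n t)" and c="\<lambda>n. - of_nat n" and d="\<lambda>_. 1", OF _ q])
  fix n t
  show "((\<lambda>t. complex_of_real (flat n t)) has_vector_derivative (- of_nat n * complex_of_real (flat (Suc n) t) + 1 * complex_of_real (flat (Suc (Suc n)) t))) (at t)"
    using has_vector_derivative_of_real[OF flat_derivative[of n t]] by simp
qed

lemma flat_nonneg: "flat n t \<ge> 0" by (simp add: flat_def)
lemma flat0_le_1: "flat 0 t \<le> 1" by (simp add: flat_def)
lemma flat0_mono: "s \<le> t \<Longrightarrow> flat 0 s \<le> flat 0 t" by (auto simp: flat_def frac_le)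
lemma flat_nonpos: "t \<le> 0 \<Longrightarrow> flat n t = 0" by (simp add: flat_def)
lemma flat_pos: "t > 0 \<Longrightarrow> flat n t > 0" by (simp add: flat_def)

lemma fun_support_subset: "closed K \<Longrightarrow> (\<And>x. x \<notin> K \<Longrightarrow> \<phi> x = 0) \<Longrightarrow> fun_support \<phi> \<subseteq> K"
  unfolding fun_support_def by (rule closure_minimal) auto

lemma fun_supportD: "x \<notin> fun_support \<phi> \<Longrightarrow> \<phi> x = 0"
  unfolding fun_support_def using closure_subset[of "{x. \<phi> x \<noteq> 0}"] by blast

lemma test_functionsI:
  assumes "smooth \<phi>" "compact K" "\<And>x. x \<notin> K \<Longrightarrow> \<phi> x = 0"
  shows "\<phi> \<in> test_functions"
proof -
  have "fun_support \<phi> \<subseteq> K" by (rule fun_support_subset) (use assms compact_imp_closed in auto)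
  then have "compact (fun_support \<phi>)"
    using assms(2) by (metis bounded_subset closed_closure compact_eq_bounded_closed fun_support_def)
  then show ?thesis using assms(1) by (simp add: test_functions_def)
qed

text \<open>Composing \<open>flat 0\<close> with itself gives a smooth step without any division of functions.\<close>

lemma bump_exists:
  fixes a :: "'a::euclidean_space"
  assumes "0 < r" "r < R"
  obtains h where "h \<in> test_functions" "\<And>x. x \<in> cball a r \<Longrightarrow> h x = 1" "\<And>x. x \<notin> cball a R \<Longrightarrow> h x = 0"
    "\<And>x. norm (h x) \<le> 1"
proof -
  \<comment> \<open>The value of the inner step at distance R: beyond R the argument of the outer
    step is nonpositive, within distance r it is exactly c, whence the normalization by
    \<open>flat 0 c\<close>.\<close>
  define c where "c = flat 0 (R\<^sup>2 - r\<^sup>2)"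
  have "R\<^sup>2 - r\<^sup>2 > 0" using assms by (simp add: power_strict_mono)
  then have c: "c > 0" unfolding c_def by (rule flat_pos)
  define h where "h x = complex_of_real (flat 0 (c - flat 0 ((norm (x - a))\<^sup>2 - r\<^sup>2))) * complex_of_real (1 / flat 0 c)" for x :: 'a
  have "smooth (\<lambda>x. complex_of_real (flat 0 ((norm (x - a))\<^sup>2 - r\<^sup>2)))"
    by (rule smooth_flat) (unfold of_real_diff, intro smooth_diff smooth_norm_sq smooth_const)
  then have "smooth (\<lambda>x. complex_of_real (flat 0 (c - flat 0 ((norm (x - a))\<^sup>2 - r\<^sup>2))))"
    by (intro smooth_flat) (unfold of_real_diff, intro smooth_diff smooth_const)
  then have sm: "smooth h" unfolding h_def by (intro smooth_mult smooth_const)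
  have out: "h x = 0" if "x \<notin> cball a R" for x
  proof -
    have "R\<^sup>2 \<le> (norm (x - a))\<^sup>2" using that assms by (intro power_mono) (auto simp: dist_norm norm_minus_commute)
    then have "c \<le> flat 0 ((norm (x - a))\<^sup>2 - r\<^sup>2)" unfolding c_def by (intro flat0_mono) simp
    then show ?thesis by (simp add: h_def flat_nonpos)
  qed
  show ?thesis
  proof
    show "h \<in> test_functions" by (rule test_functionsI[OF sm compact_cball out])
    show "h x = 1" if "x \<in> cball a r" for x
    proof -
      have "(norm (x - a))\<^sup>2 \<le> r\<^sup>2" using that by (intro power_mono) (auto simp: dist_norm norm_minus_commute)
      then show ?thesis using flat_pos[OF c, of 0] by (simp add: h_def flat_nonpos)
    qed
    show "norm (h x) \<le> 1" for x
    proof -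
      have "flat 0 (c - flat 0 ((norm (x - a))\<^sup>2 - r\<^sup>2)) \<le> flat 0 c" by (intro flat0_mono) (simp add: flat_nonneg)
      then show ?thesis using flat_pos[OF c, of 0] flat_nonneg by (simp add: h_def norm_mult norm_divide flip: of_real_divide)
    qed
  qed (use out in blast)
qed

text \<open>\<open>flat 0\<close> vanishes for nonpositive arguments and tends to 1 at infinity, so
  it is applied to the growing multiple \<open>Suc n\<close> of the signed distances to the faces of
  the box. These functions carry statements about test functions over to indicators.\<close>

lemma box_bumps:
  fixes a b :: "'a::euclidean_space"
  obtains h where "\<And>n. h n \<in> test_functions" "\<And>n x. norm (h n x) \<le> 1"
    "\<And>x. (\<lambda>n. h n x) \<longlonglongrightarrow> indicator (box a b) x" "\<And>n x. x \<notin> box a b \<Longrightarrow> h n x = 0"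
proof -
  define h where "h n x = (\<Prod>i\<in>Basis. complex_of_real (flat 0 (real (Suc n) * (x \<bullet> i - a \<bullet> i))) * complex_of_real (flat 0 (real (Suc n) * (b \<bullet> i - x \<bullet> i))))" for n :: nat and x :: 'a
  have sm: "smooth (h n)" for n
    unfolding h_def
    by (intro smooth_prod smooth_mult smooth_flat finite_Basis; unfold of_real_mult of_real_diff; intro smooth_mult smooth_diff smooth_inner smooth_const)
  have out: "h n x = 0" if "x \<notin> box a b" for n x
  proof -
    have "\<exists>i\<in>Basis. x \<bullet> i \<le> a \<bullet> i \<or> b \<bullet> i \<le> x \<bullet> i" using that by (force simp: mem_box not_less)
    then obtain i where i: "i \<in> Basis" "x \<bullet> i \<le> a \<bullet> i \<or> b \<bullet> i \<le> x \<bullet> i" by blast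
    then have "flat 0 (real (Suc n) * (x \<bullet> i - a \<bullet> i)) = 0 \<or> flat 0 (real (Suc n) * (b \<bullet> i - x \<bullet> i)) = 0"
      by (auto intro!: flat_nonpos mult_nonneg_nonpos)
    then show ?thesis unfolding h_def using i(1) by (intro prod_zero) (auto intro!: bexI[of _ i])
  qed
  have lim: "(\<lambda>n. complex_of_real (flat 0 (real (Suc n) * t))) \<longlonglongrightarrow> 1" if "t > 0" for t
  proof -
    have "(\<lambda>n. 1 / (real (Suc n) * t)) \<longlonglongrightarrow> 0"
      using tendsto_mult_left_zero[OF LIMSEQ_inverse_real_of_nat, of "inverse t"] by (simp add: divide_inverse)
    then have "(\<lambda>n. exp (- (1 / (real (Suc n) * t)))) \<longlonglongrightarrow> exp (- 0)" by (intro tendsto_intros)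
    moreover have "flat 0 (real (Suc n) * t) = exp (- (1 / (real (Suc n) * t)))" for n
      using that by (simp add: flat_def)
    ultimately have "(\<lambda>n. flat 0 (real (Suc n) * t)) \<longlonglongrightarrow> 1" by simp
    from tendsto_of_real[OF this] show ?thesis by simp
  qed
  show ?thesis
  proof
    show "h n \<in> test_functions" for n
      by (rule test_functionsI[OF sm compact_cbox[of a b]]) (use out box_subset_cbox in blast)
    show "norm (h n x) \<le> 1" for n x
      unfolding h_def prod_norm[symmetric]
      by (intro prod_le_1) (auto simp: norm_mult flat_nonneg flat0_le_1 intro!: mult_le_one)
    show "(\<lambda>n. h n x) \<longlonglongrightarrow> indicator (box a b) x" for x
    proof (cases "x \<in> box a b")
      case True
      have "(\<lambda>n. h n x) \<longlonglongrightarrow> (\<Prod>i\<in>(Basis::'a set). 1 * 1)"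
        unfolding h_def by (intro tendsto_prod tendsto_mult lim) (use True in \<open>auto simp: mem_box\<close>)
      then show ?thesis using True by simp
    qed (simp add: out)
  qed (rule out)
qed

section \<open>Schwartz functions\<close>

lemma schwartz_iff:
  "\<phi> \<in> schwartz_space \<longleftrightarrow> smooth \<phi> \<and>
    (\<forall>vs N. set vs \<subseteq> Basis \<longrightarrow> (\<exists>C. \<forall>x. (1 + norm x) ^ N * norm (iter_deriv vs \<phi> x) \<le> C))"
  by (auto simp: schwartz_space_def bounded_iff)

lemma schwartz_smooth: "\<phi> \<in> schwartz_space \<Longrightarrow> smooth \<phi>" by (simp add: schwartz_iff)

lemma schwartz_bound:
  assumes "\<phi> \<in> schwartz_space" "set vs \<subseteq> Basis"
  obtains C where "C \<ge> 0" "\<And>x. (1 + norm x) ^ N * norm (iter_deriv vs \<phi> x) \<le> C"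
proof -
  obtain C where C: "\<And>x. (1 + norm x) ^ N * norm (iter_deriv vs \<phi> x) \<le> C"
    using assms unfolding schwartz_iff by blast
  have "C \<ge> 0" by (rule order_trans[OF _ C[of 0]]) simp
  with C that show ?thesis by blast
qed

lemma schwartz_iter_deriv:
  assumes "\<phi> \<in> schwartz_space" "set vs \<subseteq> Basis"
  shows "iter_deriv vs \<phi> \<in> schwartz_space"
proof -
  have "\<exists>C. \<forall>x. (1 + norm x) ^ N * norm (iter_deriv us (iter_deriv vs \<phi>) x) \<le> C" if "set us \<subseteq> Basis" for us N
    using assms that unfolding iter_deriv_append[symmetric] schwartz_iff by (metis Un_least set_append)
  then show ?thesis using assms by (auto simp: schwartz_iff smooth_iter_deriv)
qed

lemma schwartz_pd: "\<phi> \<in> schwartz_space \<Longrightarrow> b \<in> Basis \<Longrightarrow> pd b \<phi> \<in> schwartz_space"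
  using schwartz_iter_deriv[of \<phi> "[b]"] by simp

lemma iter_deriv_add:
  assumes "smooth f" "smooth g" "set vs \<subseteq> Basis"
  shows "iter_deriv vs (\<lambda>x. f x + g x) = (\<lambda>x. iter_deriv vs f x + iter_deriv vs g x)"
  using assms(3)
proof (induction vs)
  case (Cons v vs)
  then have "iter_deriv (v # vs) (\<lambda>x. f x + g x) = pd v (\<lambda>x. iter_deriv vs f x + iter_deriv vs g x)" by simp
  also have "\<dots> = (\<lambda>x. iter_deriv (v # vs) f x + iter_deriv (v # vs) g x)"
    using Cons.prems by (intro ext) (simp add: pd_add smoothD assms)
  finally show ?case .
qed simp

text \<open>The ways of distributing a list of derivatives over two factors, for the Leibniz rule.
  With lists of directions in place of multi-indices, repeated entries take the place of binomial
  coefficients.\<close>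

fun splits :: "'a list \<Rightarrow> ('a list \<times> 'a list) list" where
  "splits [] = [([], [])]"
| "splits (v # vs) = map (\<lambda>(us, ws). (v # us, ws)) (splits vs) @ map (\<lambda>(us, ws). (us, v # ws)) (splits vs)"

lemma splits_subset: "(us, ws) \<in> set (splits vs) \<Longrightarrow> set us \<subseteq> set vs \<and> set ws \<subseteq> set vs"
  by (induction vs arbitrary: us ws) fastforce+

lemma pd_sum_list:
  assumes "\<And>p. p \<in> set ps \<Longrightarrow> F p differentiable (at x)"
  shows "pd v (\<lambda>x. \<Sum>p\<leftarrow>ps. F p x) x = (\<Sum>p\<leftarrow>ps. pd v (F p) x) \<and> (\<lambda>x. \<Sum>p\<leftarrow>ps. F p x) differentiable (at x)"
  using assms by (induction ps) (auto simp: pd_const pd_add intro: differentiable_add)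

lemma iter_deriv_mult:
  assumes f: "smooth f" and g: "smooth g" and "set vs \<subseteq> Basis"
  shows "iter_deriv vs (\<lambda>x. f x * g x) = (\<lambda>x. \<Sum>(us, ws)\<leftarrow>splits vs. iter_deriv us f x * iter_deriv ws g x)"
  using assms(3)
proof (induction vs)
  case (Cons v vs)
  have d: "iter_deriv us f differentiable (at x)" "iter_deriv ws g differentiable (at x)"
    if "(us, ws) \<in> set (splits vs)" for us ws x
    using splits_subset[OF that] Cons.prems by (auto intro!: smoothD(1) f g)
  have "iter_deriv (v # vs) (\<lambda>x. f x * g x) = pd v (\<lambda>x. \<Sum>(us, ws)\<leftarrow>splits vs. iter_deriv us f x * iter_deriv ws g x)"
    using Cons by simp
  also have "\<dots> = (\<lambda>x. \<Sum>(us, ws)\<leftarrow>splits (v # vs). iter_deriv us f x * iter_deriv ws g x)"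
  proof
    fix x
    have "pd v (\<lambda>x. \<Sum>p\<leftarrow>splits vs. iter_deriv (fst p) f x * iter_deriv (snd p) g x) x =
      (\<Sum>p\<leftarrow>splits vs. pd v (\<lambda>x. iter_deriv (fst p) f x * iter_deriv (snd p) g x) x)"
      by (rule pd_sum_list[THEN conjunct1]) (use d in \<open>force intro: differentiable_mult\<close>)
    also have "\<dots> = (\<Sum>p\<leftarrow>splits vs. iter_deriv (fst p) f x * iter_deriv (v # snd p) g x + iter_deriv (v # fst p) f x * iter_deriv (snd p) g x)"
      by (intro arg_cong[where f=sum_list] map_cong refl) (use d in \<open>force simp: pd_mult\<close>)
    also have "\<dots> = (\<Sum>(us, ws)\<leftarrow>splits (v # vs). iter_deriv us f x * iter_deriv ws g x)"
      by (simp add: sum_list_addf o_def split_def del: iter_deriv_Cons)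
    finally show "pd v (\<lambda>x. \<Sum>(us, ws)\<leftarrow>splits vs. iter_deriv us f x * iter_deriv ws g x) x =
       (\<Sum>(us, ws)\<leftarrow>splits (v # vs). iter_deriv us f x * iter_deriv ws g x)" by (simp add: split_def)
  qed
  finally show ?case .
qed simp

lemma schwartz_add: 
  assumes "f \<in> schwartz_space" "g \<in> schwartz_space"
  shows "(\<lambda>x. f x + g x) \<in> schwartz_space"
proof -
  have "\<exists>C. \<forall>x. (1 + norm x) ^ N * norm (iter_deriv vs (\<lambda>x. f x + g x) x) \<le> C" if vs: "set vs \<subseteq> Basis" for vs N
  proof -
    obtain A where A: "\<And>x. (1 + norm x) ^ N * norm (iter_deriv vs f x) \<le> A" using schwartz_bound[OF assms(1) vs] by metis
    obtain B where B: "\<And>x. (1 + norm x) ^ N * norm (iter_deriv vs g x) \<le> B" using schwartz_bound[OF assms(2) vs] by metis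
    have "(1 + norm x) ^ N * norm (iter_deriv vs f x + iter_deriv vs g x) \<le> A + B" for x
    proof -
      have "(1 + norm x) ^ N * norm (iter_deriv vs f x + iter_deriv vs g x)
          \<le> (1 + norm x) ^ N * (norm (iter_deriv vs f x) + norm (iter_deriv vs g x))"
        by (intro mult_left_mono norm_triangle_ineq) simp
      also have "\<dots> \<le> A + B" using A[of x] B[of x] by (simp add: distrib_left)
      finally show ?thesis .
    qed
    then show ?thesis using assms vs by (auto simp: iter_deriv_add schwartz_smooth)
  qed
  then show ?thesis using assms by (simp add: schwartz_iff smooth_add)
qed

lemma sum_list_bound:
  assumes "\<And>p. p \<in> set ps \<Longrightarrow> \<exists>C::real. \<forall>x. F p x \<le> C"
  shows "\<exists>C. \<forall>x. (\<Sum>p\<leftarrow>ps. F p x) \<le> C"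
  using assms
proof (induction ps)
  case (Cons p ps)
  then obtain A B where "\<And>x. F p x \<le> A" "\<And>x. (\<Sum>p\<leftarrow>ps. F p x) \<le> B" by (metis list.set_intros)
  then have "\<forall>x. (\<Sum>p\<leftarrow>p # ps. F p x) \<le> A + B" by (auto intro: add_mono)
  then show ?case by blast
qed auto

lemma norm_sum_list_map:
  fixes f :: "'b \<Rightarrow> 'c::real_normed_vector"
  shows "norm (\<Sum>p\<leftarrow>ps. f p) \<le> (\<Sum>p\<leftarrow>ps. norm (f p))"
  by (induction ps) (auto intro: norm_triangle_le)

lemma iter_deriv_mult_le:
  assumes "smooth f" "smooth g" "set vs \<subseteq> Basis"
  shows "c \<ge> 0 \<Longrightarrow> c * norm (iter_deriv vs (\<lambda>x. f x * g x) x) \<le>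
    (\<Sum>p\<leftarrow>splits vs. c * norm (iter_deriv (fst p) f x * iter_deriv (snd p) g x))"
  unfolding iter_deriv_mult[OF assms] split_def sum_list_const_mult
  by (intro mult_left_mono norm_sum_list_map)

text \<open>By the Leibniz rule each term pairs a derivative of f with one of g; the polynomial
  growth of the former is absorbed by raising the power of the weight on the latter.\<close>

lemma schwartz_mult_slow:
  assumes f: "smooth f" "\<And>vs. set vs \<subseteq> Basis \<Longrightarrow> \<exists>C M. \<forall>x. norm (iter_deriv vs f x) \<le> C * (1 + norm x) ^ M"
    and g: "g \<in> schwartz_space"
  shows "(\<lambda>x. f x * g x) \<in> schwartz_space"
proof -
  have "\<exists>C. \<forall>x. (1 + norm x) ^ N * norm (iter_deriv vs (\<lambda>x. f x * g x) x) \<le> C" if vs: "set vs \<subseteq> Basis" for vs N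
  proof -
    have "\<exists>C. \<forall>x. (\<Sum>p\<leftarrow>splits vs. (1 + norm x) ^ N * norm (iter_deriv (fst p) f x * iter_deriv (snd p) g x)) \<le> C"
    proof (rule sum_list_bound)
      fix p assume p: "p \<in> set (splits vs)"
      then have sub: "set (fst p) \<subseteq> Basis" "set (snd p) \<subseteq> Basis" using splits_subset[of "fst p" "snd p" vs] vs by auto
      obtain C M where C: "\<And>x. norm (iter_deriv (fst p) f x) \<le> C * (1 + norm x) ^ M" using f(2)[OF sub(1)] by blast
      have "0 \<le> C" using order_trans[OF norm_ge_zero C[of 0]] by simp
      obtain B where B: "\<And>x. (1 + norm x) ^ (N + M) * norm (iter_deriv (snd p) g x) \<le> B" using schwartz_bound[OF g sub(2)] by metis
      have "(1 + norm x) ^ N * norm (iter_deriv (fst p) f x * iter_deriv (snd p) g x) \<le> C * B" for x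
      proof -
        have "(1 + norm x) ^ N * norm (iter_deriv (fst p) f x * iter_deriv (snd p) g x)
          \<le> (1 + norm x) ^ N * (C * (1 + norm x) ^ M * norm (iter_deriv (snd p) g x))"
          unfolding norm_mult by (intro mult_left_mono mult_right_mono C) auto
        also have "\<dots> = C * ((1 + norm x) ^ (N + M) * norm (iter_deriv (snd p) g x))"
          by (simp add: power_add)
        also have "\<dots> \<le> C * B" by (intro mult_left_mono B) fact
        finally show ?thesis .
      qed
      then show "\<exists>C. \<forall>x. (1 + norm x) ^ N * norm (iter_deriv (fst p) f x * iter_deriv (snd p) g x) \<le> C" by blast
    qed
    then obtain C where C: "\<And>x. (\<Sum>p\<leftarrow>splits vs. (1 + norm x) ^ N * norm (iter_deriv (fst p) f x * iter_deriv (snd p) g x)) \<le> C" by blast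
    have "(1 + norm x) ^ N * norm (iter_deriv vs (\<lambda>x. f x * g x) x) \<le> C" for x
      by (rule order_trans[OF iter_deriv_mult_le[OF f(1) schwartz_smooth[OF g] vs] C]) simp
    then show ?thesis by blast
  qed
  then show ?thesis using f(1) g by (simp add: schwartz_iff smooth_mult)
qed

lemma iter_deriv_const: "\<exists>d. iter_deriv vs (\<lambda>_. c) = (\<lambda>_. d)"
  by (induction vs) (auto simp: pd_const)

lemma schwartz_cmult: "g \<in> schwartz_space \<Longrightarrow> (\<lambda>x. c * g x) \<in> schwartz_space"
proof (rule schwartz_mult_slow[OF smooth_const])
  fix vs :: "'a list"
  obtain d where "iter_deriv vs (\<lambda>_. c) = (\<lambda>_. d)" using iter_deriv_const by blast
  then show "\<exists>C M. \<forall>x. norm (iter_deriv vs (\<lambda>_. c) x) \<le> C * (1 + norm x) ^ M"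
    by (intro exI[of _ "norm d"] exI[of _ 0]) simp
qed

lemma schwartz_diff: "f \<in> schwartz_space \<Longrightarrow> g \<in> schwartz_space \<Longrightarrow> (\<lambda>x. f x - g x) \<in> schwartz_space"
  using schwartz_add[OF _ schwartz_cmult[of g "-1"]] by simp

lemma schwartz_inner_mult:
  assumes "g \<in> schwartz_space"
  shows "(\<lambda>x. complex_of_real (x \<bullet> v) * g x) \<in> schwartz_space"
proof (rule schwartz_mult_slow[OF smooth_inner _ assms])
  fix vs :: "'a list"
  have pdi: "pd b (\<lambda>x. complex_of_real (x \<bullet> v)) = (\<lambda>_. complex_of_real (b \<bullet> v))" for b
    by (intro ext pd_eqI) (auto intro!: derivative_eq_intros)
  show "\<exists>C M. \<forall>x. norm (iter_deriv vs (\<lambda>x. complex_of_real (x \<bullet> v)) x) \<le> C * (1 + norm x) ^ M"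
  \<comment> \<open>The last entry of the list is the derivative taken first, and it already turns
    the linear function into a constant.\<close>
  proof (cases vs rule: rev_cases)
    case Nil
    have "\<bar>x \<bullet> v\<bar> \<le> norm v * (1 + norm x) ^ 1" for x :: 'a
      using Cauchy_Schwarz_ineq2[of x v] by (simp add: distrib_left mult.commute add_increasing)
    then show ?thesis unfolding Nil by (intro exI[of _ "norm v"] exI[of _ 1]) simp
  next
    case (snoc us u)
    obtain d where "iter_deriv us (\<lambda>_. complex_of_real (u \<bullet> v)) = (\<lambda>_. d)" using iter_deriv_const by blast
    then have "iter_deriv vs (\<lambda>x. complex_of_real (x \<bullet> v)) = (\<lambda>_. d)"
      by (simp add: snoc iter_deriv_append pdi)
    then show ?thesis by (intro exI[of _ "norm d"] exI[of _ 0]) simp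
  qed
qed

lemma iter_deriv_scale:
  assumes "smooth \<phi>" "set vs \<subseteq> Basis"
  shows "iter_deriv vs (\<lambda>x. \<phi> (c *\<^sub>R x)) = (\<lambda>x. of_real c ^ length vs * iter_deriv vs \<phi> (c *\<^sub>R x))"
  using assms(2)
proof (induction vs)
  case (Cons v vs)
  have "pd v (\<lambda>x. of_real c ^ length vs * iter_deriv vs \<phi> (c *\<^sub>R x)) x = of_real c ^ length (v # vs) * iter_deriv (v # vs) \<phi> (c *\<^sub>R x)" for x
  proof -
    have lin: "linear (\<lambda>v. pd v (iter_deriv vs \<phi>) (c *\<^sub>R x))"
      using Cons.prems by (intro has_derivative_linear[OF has_derivative_frechet] smoothD assms) auto
    have "((\<lambda>x. iter_deriv vs \<phi> (c *\<^sub>R x)) has_derivative (\<lambda>v. pd (c *\<^sub>R v) (iter_deriv vs \<phi>) (c *\<^sub>R x))) (at x)"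
      using Cons.prems
      by (intro has_derivative_compose[of "\<lambda>x. c *\<^sub>R x" "\<lambda>v. c *\<^sub>R v" x UNIV "iter_deriv vs \<phi>"] has_derivative_frechet smoothD assms)
        (auto intro!: derivative_eq_intros)
    then have "((\<lambda>x. of_real c ^ length vs * iter_deriv vs \<phi> (c *\<^sub>R x)) has_derivative (\<lambda>v. of_real c ^ length vs * pd (c *\<^sub>R v) (iter_deriv vs \<phi>) (c *\<^sub>R x))) (at x)"
      by (intro has_derivative_mult_right)
    from pd_eqI[OF this] show ?thesis using linear_scale[OF lin] by (simp add: scaleR_conv_of_real)
  qed
  then have "pd v (\<lambda>x. of_real c ^ length vs * iter_deriv vs \<phi> (c *\<^sub>R x)) = (\<lambda>x. of_real c ^ length (v # vs) * iter_deriv (v # vs) \<phi> (c *\<^sub>R x))" by (rule ext)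
  moreover have "iter_deriv vs (\<lambda>x. \<phi> (c *\<^sub>R x)) = (\<lambda>x. of_real c ^ length vs * iter_deriv vs \<phi> (c *\<^sub>R x))"
    using Cons by simp
  ultimately show ?case by (simp only: iter_deriv_Cons)
qed simp

lemma smooth_scale:
  assumes "smooth \<phi>"
  shows "smooth (\<lambda>x. \<phi> (c *\<^sub>R x))"
proof -
  have "iter_deriv vs (\<lambda>x. \<phi> (c *\<^sub>R x)) differentiable (at x)" if vs: "set vs \<subseteq> Basis" for vs x
  proof -
    have "((\<lambda>x. iter_deriv vs \<phi> (c *\<^sub>R x)) has_derivative (\<lambda>v. pd (c *\<^sub>R v) (iter_deriv vs \<phi>) (c *\<^sub>R x))) (at x)"
      using vs
      by (intro has_derivative_compose[of "\<lambda>x. c *\<^sub>R x" "\<lambda>v. c *\<^sub>R v" x UNIV "iter_deriv vs \<phi>"] has_derivative_frechet smoothD assms)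
        (auto intro!: derivative_eq_intros)
    then have "(\<lambda>x. iter_deriv vs \<phi> (c *\<^sub>R x)) differentiable (at x)" by (auto simp: differentiable_def)
    then show ?thesis using vs assms by (simp add: iter_deriv_scale differentiable_mult)
  qed
  then show ?thesis by (auto simp: smooth_def)
qed

lemma schwartz_reflect:
  assumes "\<phi> \<in> schwartz_space"
  shows "(\<lambda>x. \<phi> (- x)) \<in> schwartz_space"
proof -
  have "\<exists>C. \<forall>x. (1 + norm x) ^ N * norm (iter_deriv vs (\<lambda>x. \<phi> ((-1) *\<^sub>R x)) x) \<le> C" if vs: "set vs \<subseteq> Basis" for vs N
  proof -
    obtain C where C: "\<And>x. (1 + norm x) ^ N * norm (iter_deriv vs \<phi> x) \<le> C" using schwartz_bound[OF assms vs] by metis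
    then show ?thesis using C[of "- _"] vs assms
      by (subst iter_deriv_scale) (auto simp: schwartz_smooth norm_mult norm_power intro!: exI[of _ C])
  qed
  moreover have "smooth (\<lambda>x. \<phi> ((-1) *\<^sub>R x))" using assms by (intro smooth_scale schwartz_smooth)
  ultimately have "(\<lambda>x. \<phi> ((-1) *\<^sub>R x)) \<in> schwartz_space" by (simp add: schwartz_iff)
  then show ?thesis by simp
qed

lemma iter_deriv_zero_open:
  assumes "open U" "\<And>x. x \<in> U \<Longrightarrow> \<phi> x = 0"
  shows "x \<in> U \<Longrightarrow> iter_deriv vs \<phi> x = 0"
proof (induction vs arbitrary: x)
  case (Cons v vs)
  have "((\<lambda>_. 0) has_derivative (\<lambda>_. 0)) (at x)" by simp
  then have "(iter_deriv vs \<phi> has_derivative (\<lambda>_. 0)) (at x)"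
    by (rule has_derivative_transform_within_open[OF _ assms(1) Cons.prems]) (simp add: Cons.IH)
  from pd_eqI[OF this] show ?case by simp
qed (use assms in auto)

lemma test_smooth: "\<phi> \<in> test_functions \<Longrightarrow> smooth \<phi>" by (simp add: test_functions_def)

lemma test_in_schwartz:
  assumes "\<phi> \<in> test_functions"
  shows "\<phi> \<in> schwartz_space"
proof -
  let ?K = "fun_support \<phi>"
  have K: "compact ?K" and sm: "smooth \<phi>" using assms by (auto simp: test_functions_def)
  have "\<exists>C. \<forall>x. (1 + norm x) ^ N * norm (iter_deriv vs \<phi> x) \<le> C" if vs: "set vs \<subseteq> Basis" for vs N
  proof -
    let ?h = "\<lambda>x. (1 + norm x) ^ N * norm (iter_deriv vs \<phi> x)"
    have "continuous_on ?K ?h" using smooth_continuous[OF smooth_iter_deriv[OF sm vs]] by (intro continuous_intros)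
    then have "bounded (?h ` ?K)" using K compact_continuous_image compact_imp_bounded by blast
    then obtain C where C: "\<And>x. x \<in> ?K \<Longrightarrow> norm (?h x) \<le> C" by (auto simp: bounded_iff)
    have "iter_deriv vs \<phi> x = 0" if "x \<notin> ?K" for x
      by (rule iter_deriv_zero_open[of "- ?K"]) (use that K compact_imp_closed fun_supportD in auto)
    then have "?h x \<le> max C 0" for x using C[of x] by (cases "x \<in> ?K") auto
    then show ?thesis by blast
  qed
  then show ?thesis using sm by (simp add: schwartz_iff)
qed

lemma test_mult:
  assumes "\<phi> \<in> test_functions" "smooth g"
  shows "(\<lambda>x. \<phi> x * g x) \<in> test_functions"
  using assms by (intro test_functionsI[of _ "fun_support \<phi>"]) (auto simp: test_functions_def smooth_mult fun_supportD)

text \<open>The product vanishes for norms below \<open>Suc m\<close>, so one spare power of the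
  weight yields the factor \<open>1 / Suc m\<close>. The derivatives of the dilated cutoffs stay
  bounded uniformly in m, since each derivative brings a factor \<open>inverse (Suc m)\<close>,
  which is at most 1.\<close>

lemma schwartz_seminorm_cutoff:
  assumes h: "h \<in> test_functions" "\<And>x. x \<in> cball 0 1 \<Longrightarrow> h x = 1" and \<psi>: "\<psi> \<in> schwartz_space"
  shows "(\<lambda>m. schwartz_seminorm N (\<lambda>x. (1 - h (inverse (Suc m) *\<^sub>R x)) * \<psi> x)) \<longlonglongrightarrow> 0"
proof -
  have "(\<lambda>m. SUP x. (1 + norm x) ^ N * norm (iter_deriv vs (\<lambda>x. (1 - h (inverse (Suc m) *\<^sub>R x)) * \<psi> x) x)) \<longlonglongrightarrow> 0"
    if vs: "set vs \<subseteq> Basis" for vs :: "'a list"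
  proof -
    define a where "a x = 1 - h x" for x
    have sa: "smooth a" unfolding a_def by (intro smooth_diff smooth_const test_smooth h)
    have da: "\<exists>C. \<forall>x. norm (iter_deriv us a x) \<le> C" if us: "set us \<subseteq> Basis" for us
    proof -
      obtain d where d: "iter_deriv us (\<lambda>_. 1) = (\<lambda>_::'a. d::complex)" using iter_deriv_const by blast
      obtain C where C: "\<And>x. (1 + norm x) ^ 0 * norm (iter_deriv us (\<lambda>x. (-1) * h x) x) \<le> C"
        using schwartz_bound[OF schwartz_cmult[OF test_in_schwartz[OF h(1)]] us] by metis
      have "a = (\<lambda>x. 1 + (-1) * h x)" by (simp add: a_def fun_eq_iff)
      then have "iter_deriv us a = (\<lambda>x. d + iter_deriv us (\<lambda>x. (-1) * h x) x)"
        using us d by (simp only:) (subst iter_deriv_add; simp add: smooth_const smooth_minus test_smooth h(1))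
      then have "norm (iter_deriv us a x) \<le> norm d + C" for x
        using norm_triangle_ineq[of d "iter_deriv us (\<lambda>x. (-1) * h x) x"] C[of x] by simp
      then show ?thesis by blast
    qed
    let ?a = "\<lambda>m x. a (inverse (real (Suc m)) *\<^sub>R x)"
    have bound: "\<exists>B. \<forall>m x. (1 + norm x) ^ Suc N * norm (iter_deriv us (?a m) x * iter_deriv ws \<psi> x) \<le> B"
      if us: "set us \<subseteq> Basis" and ws: "set ws \<subseteq> Basis" for us ws
    proof -
      obtain C where C: "\<And>x. norm (iter_deriv us a x) \<le> C" using da[OF us] by blast
      have C0: "C \<ge> 0" using order_trans[OF norm_ge_zero C] .
      obtain B where B: "\<And>x. (1 + norm x) ^ Suc N * norm (iter_deriv ws \<psi> x) \<le> B" using schwartz_bound[OF \<psi> ws] by metis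
      have "(1 + norm x) ^ Suc N * norm (iter_deriv us (?a m) x * iter_deriv ws \<psi> x) \<le> C * B" for m x
      proof -
        have "norm (iter_deriv us (?a m) x) = inverse (real (Suc m)) ^ length us * norm (iter_deriv us a (inverse (real (Suc m)) *\<^sub>R x))"
          unfolding iter_deriv_scale[OF sa us] norm_mult norm_power norm_of_real by simp
        also have "\<dots> \<le> 1 * C"
          by (intro mult_mono C power_le_one) (auto simp: inverse_le_1_iff)
        finally have "norm (iter_deriv us (?a m) x) \<le> C" by simp
        then have "norm (iter_deriv us (?a m) x) * ((1 + norm x) ^ Suc N * norm (iter_deriv ws \<psi> x)) \<le> C * B"
          using B[of x] C0 by (intro mult_mono) auto
        then show ?thesis by (simp add: norm_mult mult_ac)
      qed
      then show ?thesis by blast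
    qed
    have "\<exists>B. \<forall>z. (\<Sum>p\<leftarrow>splits vs. (1 + norm (snd z)) ^ Suc N * norm (iter_deriv (fst p) (?a (fst z)) (snd z) * iter_deriv (snd p) \<psi> (snd z))) \<le> B"
    proof (rule sum_list_bound)
      fix p assume "p \<in> set (splits vs)"
      then have sub: "set (fst p) \<subseteq> Basis" "set (snd p) \<subseteq> Basis" using splits_subset[of "fst p" "snd p" vs] vs by auto
      then show "\<exists>B. \<forall>z. (1 + norm (snd z)) ^ Suc N * norm (iter_deriv (fst p) (?a (fst z)) (snd z) * iter_deriv (snd p) \<psi> (snd z)) \<le> B"
        using bound by fastforce
    qed
    then obtain B where B: "\<And>m x. (\<Sum>p\<leftarrow>splits vs. (1 + norm x) ^ Suc N * norm (iter_deriv (fst p) (?a m) x * iter_deriv (snd p) \<psi> x)) \<le> B"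
      by fastforce
    let ?D = "\<lambda>m x. iter_deriv vs (\<lambda>x. ?a m x * \<psi> x) x"
    have le: "(1 + norm x) ^ N * norm (?D m x) \<le> B / Suc m" for m x
    proof -
      have B1: "(1 + norm x) ^ Suc N * norm (?D m x) \<le> B"
        by (rule order_trans[OF iter_deriv_mult_le[OF smooth_scale[OF sa] schwartz_smooth[OF \<psi>] vs] B]) simp
      have B0: "B \<ge> 0" by (rule order_trans[OF _ B1]) simp
      show ?thesis
      proof (cases "norm x < Suc m")
        case True
        \<comment> \<open>The function is identically zero on an open ball around x, hence so are
          its derivatives there.\<close>
        have "?D m x = 0"
        proof (rule iter_deriv_zero_open[of "ball 0 (Suc m)"])
          show "?a m y * \<psi> y = 0" if "y \<in> ball 0 (Suc m)" for y
          proof -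
            have "inverse (real (Suc m)) *\<^sub>R y \<in> cball 0 1" using that by (simp add: field_simps)
            then show ?thesis using h(2) by (simp add: a_def)
          qed
        qed (use True in auto)
        then show ?thesis using B0 by simp
      next
        case False
        have "real (Suc m) * ((1 + norm x) ^ N * norm (?D m x)) \<le> (1 + norm x) * ((1 + norm x) ^ N * norm (?D m x))"
          using False by (intro mult_right_mono) auto
        also have "\<dots> \<le> B" using B1 by (simp add: mult_ac)
        finally show ?thesis by (simp add: field_simps)
      qed
    qed
    show ?thesis
    proof (rule tendsto_sandwich[of "\<lambda>_. 0" _ _ "\<lambda>m. B / Suc m"])
      show "eventually (\<lambda>m. 0 \<le> (SUP x. (1 + norm x) ^ N * norm (iter_deriv vs (\<lambda>x. (1 - h (inverse (Suc m) *\<^sub>R x)) * \<psi> x) x))) sequentially"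
      proof (intro always_eventually allI)
        fix m
        have "bdd_above (range (\<lambda>x. (1 + norm x) ^ N * norm (?D m x)))" using le by (intro bdd_aboveI[of _ "B / Suc m"]) auto
        then have "(1 + norm (0::'a)) ^ N * norm (?D m 0) \<le> (SUP x. (1 + norm x) ^ N * norm (?D m x))" by (rule cSUP_upper[rotated]) simp
        then have "0 \<le> (SUP x. (1 + norm x) ^ N * norm (?D m x))" by (rule order_trans[rotated]) simp
        then show "0 \<le> (SUP x. (1 + norm x) ^ N * norm (iter_deriv vs (\<lambda>x. (1 - h (inverse (Suc m) *\<^sub>R x)) * \<psi> x) x))"
          by (simp only: a_def)
      qed
      show "eventually (\<lambda>m. (SUP x. (1 + norm x) ^ N * norm (iter_deriv vs (\<lambda>x. (1 - h (inverse (Suc m) *\<^sub>R x)) * \<psi> x) x)) \<le> B / Suc m) sequentially"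
        using le by (intro always_eventually allI cSUP_least) (auto simp: a_def)
      show "(\<lambda>m. B / Suc m) \<longlonglongrightarrow> 0"
        using tendsto_mult_right_zero[OF LIMSEQ_inverse_real_of_nat, of B] by (simp add: divide_inverse)
    qed simp
  qed
  then have "(\<lambda>m. \<Sum>vs | set vs \<subseteq> (Basis::'a set) \<and> length vs \<le> N. SUP x. (1 + norm x) ^ N * norm (iter_deriv vs (\<lambda>x. (1 - h (inverse (Suc m) *\<^sub>R x)) * \<psi> x) x))
      \<longlonglongrightarrow> (\<Sum>vs | set vs \<subseteq> (Basis::'a set) \<and> length vs \<le> N. 0)"
    by (intro tendsto_sum) auto
  then show ?thesis by (simp add: schwartz_seminorm_def)
qed

text \<open>The function is dominated by a product of one-dimensional functions
  \<open>inverse (1 + t\<^sup>2)\<close>, one for each coordinate. Each contributes two powers of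
  \<open>1 + norm x\<close>, which explains the exponent.\<close>

lemma integrable_inverse_poly:
  "integrable lborel (\<lambda>x::'a::euclidean_space. 1 / (1 + norm x) ^ (2 * DIM('a)))"
proof -
  interpret P: product_sigma_finite "\<lambda>_::'a. lborel::real measure" by standard
  have i1: "integrable lborel (\<lambda>t::real. inverse (1 + t\<^sup>2))"
    using integrable_inverse_1_plus_square by (simp add: set_integrable_def)
  have "integrable (\<Pi>\<^sub>M b\<in>(Basis::'a set). (lborel::real measure)) (\<lambda>c. \<Prod>b\<in>Basis. inverse (1 + (c b)\<^sup>2))"
    by (rule P.product_integrable_prod) (simp_all add: i1)
  then have "integrable (\<Pi>\<^sub>M b\<in>(Basis::'a set). (lborel::real measure)) (\<lambda>c. (\<lambda>x. \<Prod>b\<in>Basis. inverse (1 + (x \<bullet> b)\<^sup>2)) (\<Sum>b\<in>Basis. c b *\<^sub>R b))"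
    by (rule Bochner_Integration.integrable_cong[THEN iffD1, rotated 2]) (auto intro!: prod.cong)
  then have int: "integrable lborel (\<lambda>x::'a. \<Prod>b\<in>Basis. inverse (1 + (x \<bullet> b)\<^sup>2))"
    unfolding lborel_eq[where 'a='a] by (subst integrable_distr_eq) auto
  show ?thesis
  proof (rule Bochner_Integration.integrable_bound[OF int])
    show "AE x::'a in lborel. norm (1 / (1 + norm x) ^ (2 * DIM('a))) \<le> norm (\<Prod>b\<in>Basis. inverse (1 + (x \<bullet> b)\<^sup>2))"
    proof (rule AE_I2)
      fix x :: 'a
      have "(\<Prod>b\<in>(Basis::'a set). inverse ((1 + norm x)\<^sup>2)) \<le> (\<Prod>b\<in>Basis. inverse (1 + (x \<bullet> b)\<^sup>2))"
      proof (intro prod_mono conjI)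
        fix b :: 'a assume b: "b \<in> Basis"
        have "(x \<bullet> b)\<^sup>2 \<le> (norm x)\<^sup>2" using Basis_le_norm[OF b, of x] by (metis abs_ge_zero power2_abs power_mono)
        then have "1 + (x \<bullet> b)\<^sup>2 \<le> (1 + norm x)\<^sup>2" by (simp add: power2_sum add_increasing2)
        then show "inverse ((1 + norm x)\<^sup>2) \<le> inverse (1 + (x \<bullet> b)\<^sup>2)"
          by (intro le_imp_inverse_le) (auto simp: add_pos_nonneg)
      qed simp
      moreover have "(\<Prod>b\<in>(Basis::'a set). inverse ((1 + norm x)\<^sup>2)) = 1 / (1 + norm x) ^ (2 * DIM('a))"
        by (simp add: power_mult power_inverse inverse_eq_divide[symmetric])
      ultimately show "norm (1 / (1 + norm x) ^ (2 * DIM('a))) \<le> norm (\<Prod>b\<in>Basis. inverse (1 + (x \<bullet> b)\<^sup>2))"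
        by (simp add: prod_nonneg)
    qed
  qed simp
qed

lemma integrable_poly_decay:
  fixes g :: "'a::euclidean_space \<Rightarrow> 'b::{banach, second_countable_topology}"
  assumes "g \<in> borel_measurable borel" "\<And>x. (1 + norm x) ^ (2 * DIM('a)) * norm (g x) \<le> C"
  shows "integrable lborel g"
proof (rule Bochner_Integration.integrable_bound)
  show "integrable lborel (\<lambda>x::'a. C * (1 / (1 + norm x) ^ (2 * DIM('a))))"
    by (intro integrable_mult_right integrable_inverse_poly)
  show "AE x in lborel. norm (g x) \<le> norm (C * (1 / (1 + norm x) ^ (2 * DIM('a))))"
  proof (rule AE_I2)
    fix x :: 'a
    have p: "(1 + norm x) ^ (2 * DIM('a)) > 0" by (simp add: add_pos_nonneg)
    have "norm (g x) \<le> C / (1 + norm x) ^ (2 * DIM('a))"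
      using assms(2)[of x] p by (simp add: pos_le_divide_eq mult.commute)
    also have "\<dots> \<le> norm (C * (1 / (1 + norm x) ^ (2 * DIM('a))))"
      using abs_ge_self[of "C / (1 + norm x) ^ (2 * DIM('a))"] by (simp only: real_norm_def times_divide_eq_right mult_1_right)
    finally show "norm (g x) \<le> norm (C * (1 / (1 + norm x) ^ (2 * DIM('a))))" .
  qed
qed (use assms in simp)

lemma smooth_measurable: "smooth \<phi> \<Longrightarrow> \<phi> \<in> borel_measurable borel"
  by (intro borel_measurable_continuous_onI smooth_continuous)

lemma schwartz_measurable: "\<phi> \<in> schwartz_space \<Longrightarrow> \<phi> \<in> borel_measurable borel"
  by (intro smooth_measurable schwartz_smooth)

lemma integrable_slow_schwartz:
  fixes F :: "'a::euclidean_space \<Rightarrow> complex"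
  assumes [measurable]: "F \<in> borel_measurable borel" and F: "\<And>x. norm (F x) \<le> C * (1 + norm x) ^ M"
    and \<phi>: "\<phi> \<in> schwartz_space"
  shows "integrable lborel (\<lambda>x. F x * \<phi> x)"
proof -
  note [measurable] = schwartz_measurable[OF \<phi>]
  have "0 \<le> C" using order_trans[OF norm_ge_zero F[of 0]] by simp
  obtain B where B: "\<And>x. (1 + norm x) ^ (2 * DIM('a) + M) * norm (iter_deriv [] \<phi> x) \<le> B" using schwartz_bound[OF \<phi>, of "[]" "2 * DIM('a) + M"] by auto
  show ?thesis
  proof (rule integrable_poly_decay)
    fix x
    have "(1 + norm x) ^ (2 * DIM('a)) * norm (F x * \<phi> x) \<le> (1 + norm x) ^ (2 * DIM('a)) * (C * (1 + norm x) ^ M * norm (\<phi> x))"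
      unfolding norm_mult by (intro mult_left_mono mult_right_mono F) auto
    also have "\<dots> = C * ((1 + norm x) ^ (2 * DIM('a) + M) * norm (\<phi> x))" by (simp add: power_add)
    also have "\<dots> \<le> C * B" using B[of x] \<open>0 \<le> C\<close> by (intro mult_left_mono) auto
    finally show "(1 + norm x) ^ (2 * DIM('a)) * norm (F x * \<phi> x) \<le> C * B" .
  qed measurable
qed

lemma schwartz_integrable: "\<phi> \<in> schwartz_space \<Longrightarrow> integrable lborel \<phi>"
  using integrable_slow_schwartz[of "\<lambda>_. 1" 1 0 \<phi>] by simp

section \<open>The Fourier transform of Schwartz functions\<close>

lemma measurable_cis[measurable]: "cis \<in> borel_measurable borel"
  by (intro borel_measurable_continuous_onI continuous_intros)

abbreviation fconst :: "'a::euclidean_space itself \<Rightarrow> real" where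
  "fconst T \<equiv> (2 * pi) powr (- real DIM('a) / 2)"

lemma fconst_eq: "fconst TYPE('a::euclidean_space) = inverse (sqrt (2 * pi) ^ DIM('a))"
proof -
  have "sqrt (2 * pi) ^ DIM('a) = (2 * pi) powr (real DIM('a) / 2)"
    by (simp add: powr_half_sqrt[symmetric] powr_realpow[symmetric] powr_powr)
  then show ?thesis by (simp add: powr_minus[symmetric])
qed

lemma fourier_integrable:
  fixes \<phi> :: "'a::euclidean_space \<Rightarrow> complex"
  assumes "integrable lborel \<phi>"
  shows "integrable lborel (\<lambda>x. cis (- (x \<bullet> \<xi>)) * \<phi> x)"
proof -
  have [measurable]: "\<phi> \<in> borel_measurable borel" using borel_measurable_integrable[OF assms] by simp
  show ?thesis by (rule Bochner_Integration.integrable_bound[OF assms]) (auto simp: norm_mult)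
qed

lemma fourier_bound:
  fixes \<phi> :: "'a::euclidean_space \<Rightarrow> complex"
  shows "norm (fourier \<phi> \<xi>) \<le> fconst TYPE('a) * (\<integral>x. norm (\<phi> x) \<partial>lborel)"
proof -
  have "norm (\<integral>x. cis (- (x \<bullet> \<xi>)) * \<phi> x \<partial>lborel) \<le> (\<integral>x. norm (cis (- (x \<bullet> \<xi>)) * \<phi> x) \<partial>lborel)"
    by (rule integral_norm_bound)
  then show ?thesis by (simp add: fourier_def norm_mult mult_left_mono)
qed

lemma fourier_diff:
  fixes \<phi> \<psi> :: "'a::euclidean_space \<Rightarrow> complex"
  assumes "integrable lborel \<phi>" "integrable lborel \<psi>"
  shows "fourier (\<lambda>x. \<phi> x - \<psi> x) \<xi> = fourier \<phi> \<xi> - fourier \<psi> \<xi>"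
  using assms by (simp add: fourier_def right_diff_distrib fourier_integrable)

lemma fourier_cmult: "fourier (\<lambda>x. c * \<phi> x) \<xi> = c * fourier \<phi> \<xi>"
  by (simp add: fourier_def mult.left_commute)

lemma cis_quadratic_bound: "norm (cis u - 1 - \<i> * of_real u) \<le> u\<^sup>2"
proof -
  have "norm (iexp u - (\<Sum>k\<le>1. (\<i> * of_real u) ^ k / fact k)) \<le> \<bar>u\<bar> ^ Suc 1 / fact (Suc 1)"
    by (rule iexp_approx1)
  also have "\<dots> \<le> u\<^sup>2" by (simp add: power2_eq_square[symmetric])
  finally show ?thesis by (simp add: cis_conv_exp diff_diff_eq)
qed

text \<open>The second-order remainder of the exponential is at most the square of the phase
  \<open>x \<bullet> h\<close>, so the error is at most the square of \<open>norm h\<close> times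
  the second absolute moment of \<theta>, which is finite.\<close>

lemma fourier_has_derivative:
  fixes \<theta> :: "'a::euclidean_space \<Rightarrow> complex"
  assumes \<theta>: "\<theta> \<in> schwartz_space"
  shows "(fourier \<theta> has_derivative (\<lambda>h. fourier (\<lambda>x. (- \<i> * of_real (x \<bullet> h)) * \<theta> x) \<xi>)) (at \<xi>)"
proof -
  let ?c = "fconst TYPE('a)"
  let ?L = "\<lambda>h. fourier (\<lambda>x. (- \<i> * of_real (x \<bullet> h)) * \<theta> x) \<xi>"
  have int: "integrable lborel \<theta>" by (rule schwartz_integrable[OF \<theta>])
  have inth: "integrable lborel (\<lambda>x. (- \<i> * of_real (x \<bullet> h)) * \<theta> x)" for h
    using schwartz_integrable[OF schwartz_cmult[OF schwartz_inner_mult[OF \<theta>]], of "- \<i>" h] by (simp add: mult_ac)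
  note [measurable] = schwartz_measurable[OF \<theta>]
  have int2: "integrable lborel (\<lambda>x. (norm x)\<^sup>2 * norm (\<theta> x))"
  proof -
    have "integrable lborel (\<lambda>x. complex_of_real ((norm x)\<^sup>2) * \<theta> x)"
    proof (rule integrable_slow_schwartz[of _ 1 2, OF _ _ \<theta>])
      show "norm (complex_of_real ((norm x)\<^sup>2)) \<le> 1 * (1 + norm x)\<^sup>2" for x :: 'a
        by (simp add: norm_power power_mono)
    qed measurable
    from integrable_norm[OF this] show ?thesis by (simp add: norm_mult norm_power)
  qed
  define K where "K = ?c * (\<integral>x. (norm x)\<^sup>2 * norm (\<theta> x) \<partial>lborel)"
  have lin: "linear ?L"
  proof (rule linearI)
    fix h h'
    have "(\<lambda>x. (- \<i> * of_real (x \<bullet> (h + h'))) * \<theta> x) = (\<lambda>x. (- \<i> * of_real (x \<bullet> h)) * \<theta> x - (\<i> * of_real (x \<bullet> h')) * \<theta> x)"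
      by (intro ext) (simp add: inner_add_right algebra_simps)
    then have "?L (h + h') = fourier (\<lambda>x. (- \<i> * of_real (x \<bullet> h)) * \<theta> x - (\<i> * of_real (x \<bullet> h')) * \<theta> x) \<xi>"
      by (simp only:)
    also have "\<dots> = ?L h - fourier (\<lambda>x. (\<i> * of_real (x \<bullet> h')) * \<theta> x) \<xi>"
      using inth[of h] inth[of h'] by (intro fourier_diff) auto
    also have "fourier (\<lambda>x. (\<i> * of_real (x \<bullet> h')) * \<theta> x) \<xi> = - ?L h'"
      using fourier_cmult[of "-1" "\<lambda>x. (\<i> * of_real (x \<bullet> h')) * \<theta> x" \<xi>] by simp
    finally show "?L (h + h') = ?L h + ?L h'" by simp
  next
    fix r h
    show "?L (r *\<^sub>R h) = r *\<^sub>R ?L h"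
      using fourier_cmult[of "of_real r" "\<lambda>x. (- \<i> * of_real (x \<bullet> h)) * \<theta> x" \<xi>]
      by (simp add: scaleR_conv_of_real mult_ac)
  qed
  show ?thesis
  proof (rule has_derivativeI_sandwich[of 1 _ _ _ _ "\<lambda>y. K * norm (y - \<xi>)"])
    show "bounded_linear ?L" using lin linear_conv_bounded_linear by blast
    show "((\<lambda>y. K * norm (y - \<xi>)) \<longlongrightarrow> 0) (at \<xi>)" by (auto intro!: tendsto_eq_intros)
    fix y assume "y \<noteq> \<xi>"
    let ?h = "y - \<xi>"
    have eq: "fourier \<theta> y - fourier \<theta> \<xi> - ?L ?h =
      of_real ?c * (\<integral>x. cis (- (x \<bullet> \<xi>)) * (cis (- (x \<bullet> ?h)) - 1 - \<i> * of_real (- (x \<bullet> ?h))) * \<theta> x \<partial>lborel)"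
    proof -
      have "(\<integral>x. cis (- (x \<bullet> \<xi>)) * (cis (- (x \<bullet> ?h)) - 1 - \<i> * of_real (- (x \<bullet> ?h))) * \<theta> x \<partial>lborel)
        = (\<integral>x. cis (- (x \<bullet> y)) * \<theta> x - cis (- (x \<bullet> \<xi>)) * \<theta> x - cis (- (x \<bullet> \<xi>)) * ((- \<i> * of_real (x \<bullet> ?h)) * \<theta> x) \<partial>lborel)"
        by (intro Bochner_Integration.integral_cong refl) (simp add: algebra_simps cis_mult inner_diff_right)
      also have "\<dots> = (\<integral>x. cis (- (x \<bullet> y)) * \<theta> x \<partial>lborel) - (\<integral>x. cis (- (x \<bullet> \<xi>)) * \<theta> x \<partial>lborel)
          - (\<integral>x. cis (- (x \<bullet> \<xi>)) * ((- \<i> * of_real (x \<bullet> ?h)) * \<theta> x) \<partial>lborel)"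
      proof -
        note i = fourier_integrable[OF int, of y] fourier_integrable[OF int, of \<xi>] fourier_integrable[OF inth[of ?h], of \<xi>]
        show ?thesis
          by (simp only: Bochner_Integration.integral_diff[OF Bochner_Integration.integrable_diff[OF i(1,2)] i(3)]
            Bochner_Integration.integral_diff[OF i(1,2)])
      qed
      finally show ?thesis by (simp only: fourier_def right_diff_distrib)
    qed
    have "norm (\<integral>x. cis (- (x \<bullet> \<xi>)) * (cis (- (x \<bullet> ?h)) - 1 - \<i> * of_real (- (x \<bullet> ?h))) * \<theta> x \<partial>lborel)
      \<le> (\<integral>x. (norm ?h)\<^sup>2 * ((norm x)\<^sup>2 * norm (\<theta> x)) \<partial>lborel)"
    proof (rule order_trans[OF integral_norm_bound integral_mono'])
      show "integrable lborel (\<lambda>x. (norm ?h)\<^sup>2 * ((norm x)\<^sup>2 * norm (\<theta> x)))"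
        using int2 by (rule integrable_mult_right)
      fix x :: 'a
      show "0 \<le> (norm ?h)\<^sup>2 * ((norm x)\<^sup>2 * norm (\<theta> x))" by simp
      show "norm (cis (- (x \<bullet> \<xi>)) * (cis (- (x \<bullet> ?h)) - 1 - \<i> * of_real (- (x \<bullet> ?h))) * \<theta> x) \<le> (norm ?h)\<^sup>2 * ((norm x)\<^sup>2 * norm (\<theta> x))"
      proof -
        have "norm (cis (- (x \<bullet> ?h)) - 1 - \<i> * of_real (- (x \<bullet> ?h))) \<le> (- (x \<bullet> ?h))\<^sup>2" by (rule cis_quadratic_bound)
        also have "\<dots> \<le> (norm x * norm ?h)\<^sup>2"
          using Cauchy_Schwarz_ineq2[of x ?h] by (metis abs_ge_zero power2_abs power2_minus power_mono)
        finally have le: "norm (cis (- (x \<bullet> ?h)) - 1 - \<i> * of_real (- (x \<bullet> ?h))) \<le> (norm x * norm ?h)\<^sup>2" .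
        have "norm (cis (- (x \<bullet> \<xi>)) * (cis (- (x \<bullet> ?h)) - 1 - \<i> * of_real (- (x \<bullet> ?h))) * \<theta> x) \<le> (norm x * norm ?h)\<^sup>2 * norm (\<theta> x)"
          unfolding norm_mult norm_cis mult_1 by (rule mult_right_mono[OF le norm_ge_zero])
        then show ?thesis by (simp only: power_mult_distrib mult.assoc mult.left_commute)
      qed
    qed
    then have "norm (fourier \<theta> y - fourier \<theta> \<xi> - ?L ?h) \<le> ?c * ((norm ?h)\<^sup>2 * (\<integral>x. (norm x)\<^sup>2 * norm (\<theta> x) \<partial>lborel))"
      unfolding eq norm_mult by (simp add: mult_left_mono)
    also have "\<dots> = K * norm ?h * norm ?h" by (simp add: K_def power2_eq_square mult_ac)
    finally show "norm (fourier \<theta> y - fourier \<theta> \<xi> - ?L ?h) / norm ?h \<le> K * norm ?h"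
      using \<open>y \<noteq> \<xi>\<close> by (simp add: pos_divide_le_eq)
  qed simp
qed

lemma pd_fourier:
  assumes "\<theta> \<in> schwartz_space"
  shows "pd b (fourier \<theta>) = fourier (\<lambda>x. (- \<i>) * (of_real (x \<bullet> b) * \<theta> x))"
  using pd_eqI[OF fourier_has_derivative[OF assms]] by (simp add: fun_eq_iff mult_ac)

text \<open>The shape of \<theta>' does not matter later: every statement on Fourier transforms of
  Schwartz functions thereby extends to their derivatives.\<close>

lemma iter_deriv_fourier:
  assumes "\<theta> \<in> schwartz_space" "set vs \<subseteq> Basis"
  shows "\<exists>\<theta>'\<in>schwartz_space. iter_deriv vs (fourier \<theta>) = fourier \<theta>'"
  using assms(2)
proof (induction vs)
  case (Cons v vs)
  then obtain \<theta>' where t: "\<theta>' \<in> schwartz_space" "iter_deriv vs (fourier \<theta>) = fourier \<theta>'" by auto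
  then show ?case
    using schwartz_cmult[OF schwartz_inner_mult[OF t(1), of v], of "- \<i>"]
    by (intro bexI[of _ "\<lambda>x. (- \<i>) * (of_real (x \<bullet> v) * \<theta>' x)"]) (simp_all add: pd_fourier)
qed (use assms in auto)

lemma smooth_fourier:
  assumes "\<theta> \<in> schwartz_space"
  shows "smooth (fourier \<theta>)"
proof -
  have "iter_deriv vs (fourier \<theta>) differentiable (at x)" if vs: "set vs \<subseteq> Basis" for vs x
  proof -
    obtain \<theta>' where t: "\<theta>' \<in> schwartz_space" "iter_deriv vs (fourier \<theta>) = fourier \<theta>'"
      using iter_deriv_fourier[OF assms vs] by blast
    then show ?thesis using fourier_has_derivative[OF t(1)] by (auto simp: differentiable_def)
  qed
  then show ?thesis by (auto simp: smooth_def)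
qed

lemma integral_translation:
  fixes g :: "'a::euclidean_space \<Rightarrow> complex"
  assumes "integrable lborel g"
  shows "integrable lborel (\<lambda>x. g (x + a))" "(\<integral>x. g (x + a) \<partial>lborel) = (\<integral>x. g x \<partial>lborel)"
proof -
  have [measurable]: "g \<in> borel_measurable borel" using borel_measurable_integrable[OF assms] by simp
  have "integrable (distr lborel borel ((+) a)) g" using assms by (simp add: lborel_distr_plus)
  then show "integrable lborel (\<lambda>x. g (x + a))" by (subst (asm) integrable_distr_eq) (auto simp: add.commute)
  have "(\<integral>x. g x \<partial>lborel) = (\<integral>x. g x \<partial>distr lborel borel ((+) a))" by (simp add: lborel_distr_plus)
  also have "\<dots> = (\<integral>x. g (x + a) \<partial>lborel)" by (subst integral_distr) (auto simp: add.commute)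
  finally show "(\<integral>x. g (x + a) \<partial>lborel) = (\<integral>x. g x \<partial>lborel)" by simp
qed

text \<open>Integration by parts in disguise: difference quotients have integral 0 by translation
  invariance, and they converge to the derivative under an integrable majorant.\<close>

lemma integral_pd_eq_0:
  fixes g :: "'a::euclidean_space \<Rightarrow> complex"
  assumes g: "g \<in> schwartz_space" and b: "b \<in> Basis"
  shows "(\<integral>x. pd b g x \<partial>lborel) = 0"
proof -
  let ?N = "2 * DIM('a)"
  let ?q = "\<lambda>n x. of_nat (Suc n) * (g (x + inverse (real (Suc n)) *\<^sub>R b) - g x)"
  note int = schwartz_integrable[OF g]
  note [measurable] = schwartz_measurable[OF g] schwartz_measurable[OF schwartz_pd[OF g b]]
  obtain C where C: "C \<ge> 0" "\<And>x. (1 + norm x) ^ ?N * norm (iter_deriv [b] g x) \<le> C"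
    using schwartz_bound[OF g, of "[b]" ?N] b by auto
  have hd: "((\<lambda>t. g (x + t *\<^sub>R b)) has_vector_derivative pd b g (x + t *\<^sub>R b)) (at t)" for x t
  proof -
    have d: "(g has_derivative (\<lambda>v. pd v g (x + t *\<^sub>R b))) (at (x + t *\<^sub>R b))"
      by (intro has_derivative_frechet smoothD(2) schwartz_smooth g)
    have "((\<lambda>t. g (x + t *\<^sub>R b)) has_derivative (\<lambda>h. pd (h *\<^sub>R b) g (x + t *\<^sub>R b))) (at t)"
      by (rule has_derivative_compose[of "\<lambda>t. x + t *\<^sub>R b" "\<lambda>h. h *\<^sub>R b" t UNIV g, OF _ d]) (auto intro!: derivative_eq_intros)
    then show ?thesis
      using linear_scale[OF has_derivative_linear[OF d]] by (simp add: has_vector_derivative_def)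
  qed
  have "(\<lambda>n. \<integral>x. ?q n x \<partial>lborel) \<longlonglongrightarrow> (\<integral>x. pd b g x \<partial>lborel)"
  proof (rule integral_dominated_convergence[where w="\<lambda>x. (2 ^ ?N * C) * (1 / (1 + norm x) ^ ?N)"])
    show "integrable lborel (\<lambda>x::'a. (2 ^ ?N * C) * (1 / (1 + norm x) ^ ?N))"
      by (intro integrable_mult_right integrable_inverse_poly)
    show "AE x in lborel. (\<lambda>n. ?q n x) \<longlonglongrightarrow> pd b g x"
    proof (rule AE_I2)
      fix x
      have "((\<lambda>h. norm (g (x + (0 + h) *\<^sub>R b) - g (x + 0 *\<^sub>R b) - h *\<^sub>R pd b g (x + 0 *\<^sub>R b)) / norm h) \<longlongrightarrow> 0) (at 0)"
        using hd[of x 0] unfolding has_vector_derivative_def has_derivative_at by blast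
      moreover have "filterlim (\<lambda>n. inverse (real (Suc n))) (at 0) sequentially"
        using LIMSEQ_inverse_real_of_nat by (auto simp: filterlim_at simp del: of_nat_Suc)
      ultimately have "(\<lambda>n. norm (g (x + (0 + inverse (real (Suc n))) *\<^sub>R b) - g (x + 0 *\<^sub>R b) - inverse (real (Suc n)) *\<^sub>R pd b g (x + 0 *\<^sub>R b)) / norm (inverse (real (Suc n)))) \<longlonglongrightarrow> 0"
        by (rule filterlim_compose)
      moreover have "norm (g (x + (0 + inverse (real (Suc n))) *\<^sub>R b) - g (x + 0 *\<^sub>R b) - inverse (real (Suc n)) *\<^sub>R pd b g (x + 0 *\<^sub>R b)) / norm (inverse (real (Suc n)))
          = norm (?q n x - pd b g x)" for n
      proof -
        have "?q n x - pd b g x = of_nat (Suc n) * (g (x + inverse (real (Suc n)) *\<^sub>R b) - g x - of_real (inverse (real (Suc n))) * pd b g x)"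
          by (simp add: right_diff_distrib del: of_nat_Suc)
        then show ?thesis
          by (simp add: norm_mult scaleR_conv_of_real divide_inverse mult.commute del: of_nat_Suc)
      qed
      ultimately have "(\<lambda>n. norm (?q n x - pd b g x)) \<longlonglongrightarrow> 0" by (simp only:)
      then show "(\<lambda>n. ?q n x) \<longlonglongrightarrow> pd b g x" by (rule LIM_zero_cancel[OF tendsto_norm_zero_cancel])
    qed
    fix n
    show "AE x in lborel. norm (?q n x) \<le> (2 ^ ?N * C) * (1 / (1 + norm x) ^ ?N)"
    proof (rule AE_I2)
      fix x :: 'a
      let ?s = "inverse (real (Suc n))"
      have s: "0 < ?s" "?s \<le> 1" by (auto simp: inverse_le_1_iff)
      have "\<exists>t\<in>{0<..<?s}. norm (g (x + ?s *\<^sub>R b) - g (x + 0 *\<^sub>R b)) \<le> norm ((?s - 0) *\<^sub>R pd b g (x + t *\<^sub>R b))"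
        using hd s by (intro mvt_general[where f'="\<lambda>t h. h *\<^sub>R pd b g (x + t *\<^sub>R b)"] continuous_at_imp_continuous_on)
          (auto simp: has_vector_derivative_def intro: has_derivative_continuous)
      then obtain t where t: "0 < t" "t < ?s" "norm (g (x + ?s *\<^sub>R b) - g x) \<le> ?s * norm (pd b g (x + t *\<^sub>R b))"
        using s by (auto simp: simp del: of_nat_Suc)
      have "norm (?q n x) \<le> real (Suc n) * (?s * norm (pd b g (x + t *\<^sub>R b)))"
        unfolding norm_mult norm_of_nat by (intro mult_left_mono t) simp
      also have "\<dots> = norm (pd b g (x + t *\<^sub>R b))" by (simp add: field_simps)
      \<comment> \<open>The intermediate point is at distance at most 1 from x, which changes
        \<open>1 + norm x\<close> at most by a factor 2; hence the power of 2.\<close>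
      also have "\<dots> \<le> (2 ^ ?N * C) * (1 / (1 + norm x) ^ ?N)"
      proof -
        have "norm x \<le> norm (x + t *\<^sub>R b) + norm (t *\<^sub>R b)" using norm_triangle_ineq4[of "x + t *\<^sub>R b" "t *\<^sub>R b"] by simp
        moreover have "norm (t *\<^sub>R b) \<le> 1" using t s b by simp
        moreover have "1 + u \<le> 2 * (1 + v)" if "u \<le> v + w" "w \<le> 1" "0 \<le> v" for u v w :: real
        proof -
          have "1 + u \<le> (1 + v) + 1" using that(1,2) by simp
          also have "\<dots> \<le> (1 + v) + (1 + v)" using that(3) by (intro add_left_mono) simp
          finally show ?thesis by simp
        qed
        ultimately have "1 + norm x \<le> 2 * (1 + norm (x + t *\<^sub>R b))" using norm_ge_zero by blast
        then have "(1 + norm x) ^ ?N \<le> (2 * (1 + norm (x + t *\<^sub>R b))) ^ ?N" by (intro power_mono) auto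
        then have "(1 + norm x) ^ ?N * norm (pd b g (x + t *\<^sub>R b)) \<le> (2 * (1 + norm (x + t *\<^sub>R b))) ^ ?N * norm (pd b g (x + t *\<^sub>R b))"
          by (intro mult_right_mono) auto
        also have "\<dots> = 2 ^ ?N * ((1 + norm (x + t *\<^sub>R b)) ^ ?N * norm (pd b g (x + t *\<^sub>R b)))"
          by (simp only: power_mult_distrib mult.assoc)
        also have "\<dots> \<le> 2 ^ ?N * C" using C(2)[of "x + t *\<^sub>R b"] by (intro mult_left_mono) auto
        finally show ?thesis by (simp add: pos_le_divide_eq add_pos_nonneg mult.commute)
      qed
      finally show "norm (?q n x) \<le> (2 ^ ?N * C) * (1 / (1 + norm x) ^ ?N)" .
    qed
  qed measurable
  moreover have "(\<integral>x. ?q n x \<partial>lborel) = 0" for n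
    using integral_translation[OF int] by (subst integral_mult_right_zero) (simp add: int)
  ultimately have "(\<lambda>_::nat. 0) \<longlonglongrightarrow> (\<integral>x. pd b g x \<partial>lborel)" by (simp only:)
  then show ?thesis by (simp add: LIMSEQ_const_iff)
qed

lemma smooth_cis_inner: "smooth (\<lambda>x. cis (- (x \<bullet> \<xi>)))"
  by (rule smooth_cis) (unfold of_real_minus, rule smooth_minus[OF smooth_inner])

lemma pd_cis_inner: "pd b (\<lambda>x. c * cis (- (x \<bullet> \<xi>))) = (\<lambda>x. (c * (- \<i> * of_real (b \<bullet> \<xi>))) * cis (- (x \<bullet> \<xi>)))"
  by (intro ext pd_eqI) (auto intro!: derivative_eq_intros simp: has_vector_derivative_def scaleR_conv_of_real mult_ac)

lemma schwartz_cis_mult: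
  assumes "\<theta> \<in> schwartz_space"
  shows "(\<lambda>x. cis (- (x \<bullet> \<xi>)) * \<theta> x) \<in> schwartz_space"
proof (rule schwartz_mult_slow[OF smooth_cis_inner _ assms])
  fix vs :: "'a list"
  have "\<exists>d. iter_deriv vs (\<lambda>x. cis (- (x \<bullet> \<xi>))) = (\<lambda>x. d * cis (- (x \<bullet> \<xi>)))"
  proof (induction vs)
    case Nil
    show ?case by (intro exI[of _ 1]) simp
  next
    case (Cons v vs)
    then obtain d where d: "iter_deriv vs (\<lambda>x. cis (- (x \<bullet> \<xi>))) = (\<lambda>x. d * cis (- (x \<bullet> \<xi>)))" by blast
    show ?case by (intro exI[of _ "d * (- \<i> * of_real (v \<bullet> \<xi>))"]) (simp only: iter_deriv_Cons d pd_cis_inner)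
  qed
  then obtain d where "iter_deriv vs (\<lambda>x. cis (- (x \<bullet> \<xi>))) = (\<lambda>x. d * cis (- (x \<bullet> \<xi>)))" by blast
  then show "\<exists>C M. \<forall>x. norm (iter_deriv vs (\<lambda>x. cis (- (x \<bullet> \<xi>))) x) \<le> C * (1 + norm x) ^ M"
    by (intro exI[of _ "norm d"] exI[of _ 0]) (simp add: norm_mult)
qed

text \<open>The derivative of \<theta> times the exponential integrates to 0, and the product rule
  splits it into the two sides.\<close>

lemma fourier_pd:
  assumes \<theta>: "\<theta> \<in> schwartz_space" and b: "b \<in> Basis"
  shows "fourier (pd b \<theta>) \<xi> = \<i> * of_real (b \<bullet> \<xi>) * fourier \<theta> \<xi>"
proof -
  have eq: "pd b (\<lambda>x. cis (- (x \<bullet> \<xi>)) * \<theta> x) x = cis (- (x \<bullet> \<xi>)) * pd b \<theta> x + (- \<i> * of_real (b \<bullet> \<xi>)) * (cis (- (x \<bullet> \<xi>)) * \<theta> x)" for x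
    using pd_cis_inner[of b 1 \<xi>] pd_mult[OF smoothD(2)[OF smooth_cis_inner] smoothD(2)[OF schwartz_smooth[OF \<theta>]], of b \<xi> x]
    by simp
  have "0 = (\<integral>x. pd b (\<lambda>x. cis (- (x \<bullet> \<xi>)) * \<theta> x) x \<partial>lborel)"
    by (rule integral_pd_eq_0[OF schwartz_cis_mult[OF \<theta>] b, symmetric])
  also have "\<dots> = (\<integral>x. cis (- (x \<bullet> \<xi>)) * pd b \<theta> x \<partial>lborel) + (\<integral>x. (- \<i> * of_real (b \<bullet> \<xi>)) * (cis (- (x \<bullet> \<xi>)) * \<theta> x) \<partial>lborel)"
    unfolding eq
    by (rule Bochner_Integration.integral_add)
      (intro integrable_mult_right fourier_integrable schwartz_integrable schwartz_pd \<theta> b)+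
  also have "\<dots> = (\<integral>x. cis (- (x \<bullet> \<xi>)) * pd b \<theta> x \<partial>lborel) - \<i> * of_real (b \<bullet> \<xi>) * (\<integral>x. cis (- (x \<bullet> \<xi>)) * \<theta> x \<partial>lborel)"
    by simp
  finally show ?thesis by (simp add: fourier_def)
qed

text \<open>One factor \<open>1 + norm \<xi>\<close> is at most 1 plus the sum of the absolute
  coordinates of \<xi>, and each coordinate is absorbed into a derivative of \<theta>. The induction
  therefore runs over all Schwartz functions at once.\<close>

lemma fourier_decay:
  fixes \<theta> :: "'a::euclidean_space \<Rightarrow> complex"
  assumes "\<theta> \<in> schwartz_space"
  shows "\<exists>C. \<forall>\<xi>. (1 + norm \<xi>) ^ N * norm (fourier \<theta> \<xi>) \<le> C"
  using assms
proof (induction N arbitrary: \<theta>)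
  case 0
  then show ?case using fourier_bound[of \<theta>] by auto
next
  case (Suc N)
  obtain A where A: "\<And>\<xi>. (1 + norm \<xi>) ^ N * norm (fourier \<theta> \<xi>) \<le> A" using Suc by blast
  have "\<forall>b\<in>Basis. \<exists>C. \<forall>\<xi>. (1 + norm \<xi>) ^ N * norm (fourier (pd b \<theta>) \<xi>) \<le> C"
    using Suc schwartz_pd by blast
  then obtain B where B: "\<And>b \<xi>. b \<in> Basis \<Longrightarrow> (1 + norm \<xi>) ^ N * norm (fourier (pd b \<theta>) \<xi>) \<le> B b" by metis
  have "(1 + norm \<xi>) ^ Suc N * norm (fourier \<theta> \<xi>) \<le> A + (\<Sum>b\<in>Basis. B b)" for \<xi>
  proof -
    have "norm \<xi> \<le> (\<Sum>b\<in>Basis. \<bar>\<xi> \<bullet> b\<bar>)" by (rule norm_le_l1)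
    then have "(1 + norm \<xi>) * ((1 + norm \<xi>) ^ N * norm (fourier \<theta> \<xi>)) \<le> (1 + (\<Sum>b\<in>Basis. \<bar>\<xi> \<bullet> b\<bar>)) * ((1 + norm \<xi>) ^ N * norm (fourier \<theta> \<xi>))"
      by (intro mult_right_mono) auto
    also have "\<dots> = (1 + norm \<xi>) ^ N * norm (fourier \<theta> \<xi>) + (\<Sum>b\<in>Basis. (1 + norm \<xi>) ^ N * norm (fourier (pd b \<theta>) \<xi>))"
    proof -
      have e: "\<bar>\<xi> \<bullet> b\<bar> * ((1 + norm \<xi>) ^ N * norm (fourier \<theta> \<xi>)) = (1 + norm \<xi>) ^ N * norm (fourier (pd b \<theta>) \<xi>)"
        if "b \<in> Basis" for b
        using fourier_pd[OF Suc.prems that] by (simp add: norm_mult inner_commute)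
      show ?thesis unfolding distrib_right sum_distrib_right mult_1
        by (rule arg_cong[OF sum.cong[OF refl e]])
    qed
    also have "\<dots> \<le> A + (\<Sum>b\<in>Basis. B b)" by (intro add_mono A sum_mono B)
    finally show ?thesis by (simp add: mult.assoc)
  qed
  then show ?case by blast
qed

lemma fourier_schwartz:
  assumes "\<theta> \<in> schwartz_space"
  shows "fourier \<theta> \<in> schwartz_space"
proof -
  have "\<exists>C. \<forall>x. (1 + norm x) ^ N * norm (iter_deriv vs (fourier \<theta>) x) \<le> C" if vs: "set vs \<subseteq> Basis" for vs N
    using iter_deriv_fourier[OF assms vs] fourier_decay by metis
  then show ?thesis using smooth_fourier[OF assms] by (simp add: schwartz_iff)
qed

section \<open>Multiplication formula, Gaussians and Fourier inversion\<close>

lemma fourier_multiplication_formula: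
  fixes \<phi> \<psi> :: "'a::euclidean_space \<Rightarrow> complex"
  assumes \<phi>: "integrable lborel \<phi>" and \<psi>: "integrable lborel \<psi>"
  shows "(\<integral>x. \<phi> x * fourier \<psi> x \<partial>lborel) = (\<integral>x. fourier \<phi> x * \<psi> x \<partial>lborel)"
proof -
  have [measurable]: "\<phi> \<in> borel_measurable borel" "\<psi> \<in> borel_measurable borel"
    using borel_measurable_integrable[OF \<phi>] borel_measurable_integrable[OF \<psi>] by simp_all
  let ?c = "complex_of_real (fconst TYPE('a))"
  let ?f = "\<lambda>x y. cis (- (x \<bullet> y)) * \<phi> x * \<psi> y"
  have m: "(\<lambda>(x, y). ?f x y) \<in> borel_measurable (lborel \<Otimes>\<^sub>M lborel)" by measurable
  have int: "integrable (lborel \<Otimes>\<^sub>M lborel) (\<lambda>(x, y). ?f x y)"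
  proof (rule lborel_pair.Fubini_integrable[OF m])
    have "(\<lambda>x. \<integral>y. norm (case (x, y) of (x, y) \<Rightarrow> ?f x y) \<partial>lborel) = (\<lambda>x. norm (\<phi> x) * (\<integral>y. norm (\<psi> y) \<partial>lborel))"
      by (simp add: norm_mult)
    then show "integrable lborel (\<lambda>x. \<integral>y. norm (case (x, y) of (x, y) \<Rightarrow> ?f x y) \<partial>lborel)"
      using integrable_norm[OF \<phi>] by simp
    have "integrable lborel (\<lambda>y. ?f x y)" for x
      by (rule Bochner_Integration.integrable_bound[OF integrable_mult_right[OF \<psi>, of "\<phi> x"]]) (auto simp: norm_mult)
    then show "AE x in lborel. integrable lborel (\<lambda>y. case (x, y) of (x, y) \<Rightarrow> ?f x y)" by simp
  qed
  have "(\<integral>x. \<phi> x * fourier \<psi> x \<partial>lborel) = (\<integral>x. ?c * (\<integral>y. ?f x y \<partial>lborel) \<partial>lborel)"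
  proof (intro Bochner_Integration.integral_cong refl)
    fix x
    have "(\<integral>y. ?f x y \<partial>lborel) = (\<integral>y. \<phi> x * (cis (- (y \<bullet> x)) * \<psi> y) \<partial>lborel)"
      by (simp add: inner_commute mult_ac)
    also have "\<dots> = \<phi> x * (\<integral>y. cis (- (y \<bullet> x)) * \<psi> y \<partial>lborel)" by simp
    finally show "\<phi> x * fourier \<psi> x = ?c * (\<integral>y. ?f x y \<partial>lborel)" by (simp add: fourier_def)
  qed
  also have "\<dots> = ?c * (\<integral>x. (\<integral>y. ?f x y \<partial>lborel) \<partial>lborel)" by simp
  also have "(\<integral>x. (\<integral>y. ?f x y \<partial>lborel) \<partial>lborel) = (\<integral>y. (\<integral>x. ?f x y \<partial>lborel) \<partial>lborel)"
    by (rule lborel_pair.Fubini_integral[OF int, symmetric])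
  also have "?c * \<dots> = (\<integral>y. ?c * (\<integral>x. ?f x y \<partial>lborel) \<partial>lborel)" by simp
  also have "\<dots> = (\<integral>y. fourier \<phi> y * \<psi> y \<partial>lborel)"
  proof (intro Bochner_Integration.integral_cong refl)
    fix y
    have "(\<integral>x. ?f x y \<partial>lborel) = (\<integral>x. cis (- (x \<bullet> y)) * \<phi> x \<partial>lborel) * \<psi> y" by simp
    then show "?c * (\<integral>x. ?f x y \<partial>lborel) = fourier \<phi> y * \<psi> y" by (simp add: fourier_def)
  qed
  finally show ?thesis .
qed

lemma gaussian_1d_fourier:
  "integrable lborel (\<lambda>x. cis (t * x) * of_real (exp (- (x\<^sup>2 / 2))))"
  "(\<integral>x. cis (t * x) * of_real (exp (- (x\<^sup>2 / 2))) \<partial>lborel) = of_real (sqrt (2 * pi) * exp (- (t\<^sup>2 / 2)))"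
proof -
  have d: "exp (- (x\<^sup>2 / 2)) = sqrt (2 * pi) * std_normal_density x" for x
    by (simp add: std_normal_density_def)
  have i: "integrable lborel (\<lambda>x. exp (- (x\<^sup>2 / 2)) :: real)"
    unfolding d by (intro integrable_mult_right) simp
  show "integrable lborel (\<lambda>x. cis (t * x) * of_real (exp (- (x\<^sup>2 / 2))))"
    by (rule Bochner_Integration.integrable_bound[OF i]) (auto simp: norm_mult)
  have "(\<integral>x. cis (t * x) * of_real (exp (- (x\<^sup>2 / 2))) \<partial>lborel) = (\<integral>x. of_real (sqrt (2 * pi)) * (std_normal_density x *\<^sub>R iexp (t * x)) \<partial>lborel)"
    by (intro Bochner_Integration.integral_cong refl) (simp add: d cis_conv_exp scaleR_conv_of_real mult_ac)
  also have "\<dots> = of_real (sqrt (2 * pi)) * (\<integral>x. std_normal_density x *\<^sub>R iexp (t * x) \<partial>lborel)"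
    by (rule integral_mult_right_zero)
  also have "(\<integral>x. std_normal_density x *\<^sub>R iexp (t * x) \<partial>lborel) = char std_normal_distribution t"
    unfolding char_def by (subst integral_density) auto
  also have "\<dots> = of_real (exp (- (t\<^sup>2 / 2)))" by (simp add: char_std_normal_distribution)
  finally show "(\<integral>x. cis (t * x) * of_real (exp (- (x\<^sup>2 / 2))) \<partial>lborel) = of_real (sqrt (2 * pi) * exp (- (t\<^sup>2 / 2)))" by simp
qed

lemma cis_sum: "finite A \<Longrightarrow> cis (\<Sum>i\<in>A. f i) = (\<Prod>i\<in>A. cis (f i))"
  by (induction A rule: finite_induct) (simp_all add: cis_mult[symmetric])

lemma gaussian_fourier:
  fixes \<xi> :: "'a::euclidean_space"
  shows "integrable lborel (\<lambda>x. cis (x \<bullet> \<xi>) * of_real (exp (- ((norm x)\<^sup>2 / 2))))" (is ?A)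
  "(\<integral>x. cis (x \<bullet> \<xi>) * of_real (exp (- ((norm x)\<^sup>2 / 2))) \<partial>lborel) = of_real (sqrt (2 * pi) ^ DIM('a) * exp (- ((norm \<xi>)\<^sup>2 / 2)))" (is ?B)
proof -
  interpret P: product_sigma_finite "\<lambda>_::'a. lborel::real measure" by standard
  let ?P = "\<Pi>\<^sub>M b\<in>(Basis::'a set). (lborel::real measure)"
  let ?g = "\<lambda>b x. cis ((\<xi> \<bullet> b) * x) * of_real (exp (- (x\<^sup>2 / 2)))"
  have nsq: "(norm x)\<^sup>2 = (\<Sum>b\<in>Basis. (x \<bullet> b)\<^sup>2)" for x :: 'a
    by (subst power2_norm_eq_inner, subst euclidean_inner) (simp add: power2_eq_square)
  have prod: "cis (x \<bullet> \<xi>) * of_real (exp (- ((norm x)\<^sup>2 / 2))) = (\<Prod>b\<in>Basis. ?g b (x \<bullet> b))" for x :: 'a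
  proof -
    have "cis (x \<bullet> \<xi>) = (\<Prod>b\<in>Basis. cis ((\<xi> \<bullet> b) * (x \<bullet> b)))"
      by (subst euclidean_inner) (simp add: cis_sum mult.commute)
    moreover have "exp (- ((norm x)\<^sup>2 / 2)) = (\<Prod>b\<in>Basis. exp (- ((x \<bullet> b)\<^sup>2 / 2)))"
      by (simp add: nsq exp_sum[symmetric] sum_negf sum_divide_distrib)
    ultimately show ?thesis by (simp add: prod.distrib)
  qed
  have sumb: "(\<Sum>i\<in>Basis. c i *\<^sub>R i) \<bullet> b = c b" if "b \<in> Basis" for c :: "'a \<Rightarrow> real" and b
    using that by simp
  have pi: "integrable ?P (\<lambda>c. \<Prod>b\<in>Basis. ?g b (c b))"
    by (rule P.product_integrable_prod) (simp_all add: gaussian_1d_fourier(1))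
  have cong: "(\<Prod>b\<in>Basis. ?g b ((\<Sum>i\<in>Basis. c i *\<^sub>R i) \<bullet> b)) = (\<Prod>b\<in>Basis. ?g b (c b))" for c :: "'a \<Rightarrow> real"
    by (intro prod.cong refl) (simp only: sumb)
  have m1: "(\<lambda>c. \<Sum>i\<in>Basis. c i *\<^sub>R i) \<in> measurable ?P (borel :: 'a measure)" by measurable
  have m2: "(\<lambda>x. \<Prod>b\<in>Basis. ?g b (x \<bullet> b)) \<in> borel_measurable (borel :: 'a measure)" by measurable
  show ?A unfolding prod lborel_eq[where 'a='a]
    by (subst integrable_distr_eq[OF m1 m2]) (simp only: cong pi)
  have "(\<integral>x. (\<Prod>b\<in>Basis. ?g b (x \<bullet> b)) \<partial>(lborel::'a measure)) = (\<integral>c. (\<Prod>b\<in>Basis. ?g b (c b)) \<partial>?P)"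
    unfolding lborel_eq[where 'a='a]
    by (subst integral_distr[OF m1 m2]) (simp only: cong)
  also have "\<dots> = (\<Prod>b\<in>Basis. (\<integral>x. ?g b x \<partial>lborel))"
    by (rule P.product_integral_prod) (simp_all add: gaussian_1d_fourier(1))
  also have "\<dots> = (\<Prod>b\<in>Basis. of_real (sqrt (2 * pi) * exp (- ((\<xi> \<bullet> b)\<^sup>2 / 2))))"
    by (simp only: gaussian_1d_fourier(2))
  also have "\<dots> = of_real (sqrt (2 * pi) ^ DIM('a) * exp (- ((norm \<xi>)\<^sup>2 / 2)))"
    unfolding of_real_prod[symmetric]
    by (simp only: nsq prod.distrib exp_sum[OF finite_Basis, symmetric] sum_negf sum_divide_distrib prod_constant)
  finally show ?B unfolding prod .
qed

lemma integral_affine: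
  fixes g :: "'a::euclidean_space \<Rightarrow> complex"
  assumes [measurable]: "g \<in> borel_measurable borel" and c: "c > 0"
  shows "(\<integral>x. g x \<partial>lborel) = of_real (c ^ DIM('a)) * (\<integral>x. g (t + c *\<^sub>R x) \<partial>lborel)"
proof -
  have "(\<integral>x. g x \<partial>lborel) = (\<integral>x. (c ^ DIM('a)) *\<^sub>R g x \<partial>distr lborel borel (\<lambda>x. t + c *\<^sub>R x))"
    using c by (subst lborel_affine[of c t]) (simp_all add: integral_density)
  also have "\<dots> = (\<integral>x. (c ^ DIM('a)) *\<^sub>R g (t + c *\<^sub>R x) \<partial>lborel)"
    by (subst integral_distr) auto
  finally show ?thesis by (simp add: scaleR_conv_of_real)
qed

text \<open>A Gaussian of growing width is inserted into the inverse integral. As the width grows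
  the integral tends to the wanted one; the multiplication formula turns it into an average of
  \<phi> around \<open>- x\<close> against a shrinking Gaussian, which tends to the value of \<phi>
  there.\<close>

theorem fourier_inversion:
  fixes \<phi> :: "'a::euclidean_space \<Rightarrow> complex"
  assumes \<phi>: "\<phi> \<in> schwartz_space"
  shows "fourier (fourier \<phi>) x = \<phi> (- x)"
proof -
  let ?c = "fconst TYPE('a)" and ?e = "\<lambda>n. inverse (real (Suc n))"
  let ?G = "\<lambda>z::'a. exp (- ((norm z)\<^sup>2 / 2))"
  note int = schwartz_integrable[OF \<phi>] and intf = schwartz_integrable[OF fourier_schwartz[OF \<phi>]]
  note [measurable] = schwartz_measurable[OF \<phi>] schwartz_measurable[OF fourier_schwartz[OF \<phi>]]
  obtain B where B: "\<And>y. norm (\<phi> y) \<le> B" using schwartz_bound[OF \<phi>, of "[]" 0] by auto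
  have Gint: "integrable lborel (\<lambda>z. ?G z)"
    using integrable_norm[OF gaussian_fourier(1)[of 0]] by simp
  have Gtot: "(\<integral>z. of_real (?G z) \<partial>lborel) = complex_of_real (sqrt (2 * pi) ^ DIM('a))"
    using gaussian_fourier(2)[of "0::'a"] by simp
  define I where "I n = (\<integral>\<xi>. (cis (- (\<xi> \<bullet> x)) * fourier \<phi> \<xi>) * of_real (?G (?e n *\<^sub>R \<xi>)) \<partial>lborel)" for n
  have e0: "?e \<longlonglongrightarrow> 0" by (rule LIMSEQ_inverse_real_of_nat)
  have "I \<longlonglongrightarrow> (\<integral>\<xi>. (cis (- (\<xi> \<bullet> x)) * fourier \<phi> \<xi>) * of_real (?G (0 *\<^sub>R \<xi>)) \<partial>lborel)"
    unfolding I_def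
  proof (rule integral_dominated_convergence[where w="\<lambda>\<xi>. norm (fourier \<phi> \<xi>)"])
    show "AE \<xi> in lborel. (\<lambda>n. cis (- (\<xi> \<bullet> x)) * fourier \<phi> \<xi> * complex_of_real (?G (?e n *\<^sub>R \<xi>))) \<longlonglongrightarrow> cis (- (\<xi> \<bullet> x)) * fourier \<phi> \<xi> * complex_of_real (?G (0 *\<^sub>R \<xi>))"
      by (intro AE_I2 tendsto_intros e0) simp_all
    show "AE \<xi> in lborel. norm (cis (- (\<xi> \<bullet> x)) * fourier \<phi> \<xi> * complex_of_real (?G (?e n *\<^sub>R \<xi>))) \<le> norm (fourier \<phi> \<xi>)" for n
      by (intro AE_I2) (simp add: norm_mult mult_left_le)
  qed (use intf in \<open>auto intro: integrable_norm\<close>)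
  then have lim1: "I \<longlonglongrightarrow> (\<integral>\<xi>. cis (- (\<xi> \<bullet> x)) * fourier \<phi> \<xi> \<partial>lborel)" by simp
  have I_eq: "I n = (\<integral>z. \<phi> (- x + ?e n *\<^sub>R z) * of_real (?G z) \<partial>lborel)" for n
  proof -
    let ?\<psi> = "\<lambda>\<xi>. cis (- (\<xi> \<bullet> x)) * of_real (?G (?e n *\<^sub>R \<xi>))"
    have epos: "?e n > 0" "inverse (?e n) > 0" by simp_all
    have G2: "(\<integral>\<xi>. cis (- (\<xi> \<bullet> w)) * of_real (?G (?e n *\<^sub>R \<xi>)) \<partial>lborel) = of_real (inverse (?e n) ^ DIM('a)) * of_real (sqrt (2 * pi) ^ DIM('a) * ?G (inverse (?e n) *\<^sub>R w))" for w :: 'a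
    proof -
      have "(\<integral>\<xi>. cis (- (\<xi> \<bullet> w)) * of_real (?G (?e n *\<^sub>R \<xi>)) \<partial>lborel)
        = of_real (inverse (?e n) ^ DIM('a)) * (\<integral>\<xi>. cis (- ((0 + inverse (?e n) *\<^sub>R \<xi>) \<bullet> w)) * of_real (?G (?e n *\<^sub>R (0 + inverse (?e n) *\<^sub>R \<xi>))) \<partial>lborel)"
        by (intro integral_affine epos borel_measurable_continuous_onI continuous_intros) simp_all
      also have "(\<integral>\<xi>. cis (- ((0 + inverse (?e n) *\<^sub>R \<xi>) \<bullet> w)) * of_real (?G (?e n *\<^sub>R (0 + inverse (?e n) *\<^sub>R \<xi>))) \<partial>lborel)
        = (\<integral>\<xi>. cis (\<xi> \<bullet> (- inverse (?e n) *\<^sub>R w)) * of_real (?G \<xi>) \<partial>lborel)"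
        by (intro Bochner_Integration.integral_cong refl) (simp del: of_nat_Suc)
      also have "\<dots> = of_real (sqrt (2 * pi) ^ DIM('a) * ?G (- inverse (?e n) *\<^sub>R w))" by (rule gaussian_fourier(2))
      finally show ?thesis by simp
    qed
    have \<psi>int: "integrable lborel ?\<psi>"
    proof -
      have "integrable lborel (\<lambda>\<xi>. ?G (0 + ?e n *\<^sub>R \<xi>))"
      proof -
        have "integrable (density (distr lborel borel (\<lambda>x. 0 + ?e n *\<^sub>R x)) (\<lambda>_. ennreal (\<bar>?e n\<bar> ^ DIM('a)))) (\<lambda>z. ?G z)"
          using Gint epos by (subst lborel_affine[of "?e n" "0::'a", symmetric]) simp_all
        then have "integrable (distr lborel borel (\<lambda>x. 0 + ?e n *\<^sub>R x)) (\<lambda>z. (\<bar>?e n\<bar> ^ DIM('a)) *\<^sub>R ?G z)"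
          by (subst (asm) integrable_density) auto
        then have "integrable lborel (\<lambda>\<xi>. (\<bar>?e n\<bar> ^ DIM('a)) *\<^sub>R ?G (0 + ?e n *\<^sub>R \<xi>))"
          by (subst (asm) integrable_distr_eq) auto
        then show ?thesis using epos by (simp del: of_nat_Suc)
      qed
      then show ?thesis by (rule Bochner_Integration.integrable_bound) (auto simp: norm_mult)
    qed
    have "I n = (\<integral>\<xi>. fourier \<phi> \<xi> * ?\<psi> \<xi> \<partial>lborel)" unfolding I_def by (simp add: mult_ac)
    also have "\<dots> = (\<integral>y. \<phi> y * fourier ?\<psi> y \<partial>lborel)"
      by (rule fourier_multiplication_formula[OF int \<psi>int, symmetric])
    also have "\<dots> = (\<integral>y. of_real (inverse (?e n) ^ DIM('a)) * (\<phi> y * of_real (?G (inverse (?e n) *\<^sub>R (y + x)))) \<partial>lborel)"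
    proof (intro Bochner_Integration.integral_cong refl)
      fix y
      have "fourier ?\<psi> y = of_real ?c * (\<integral>\<xi>. cis (- (\<xi> \<bullet> (y + x))) * of_real (?G (?e n *\<^sub>R \<xi>)) \<partial>lborel)"
        unfolding fourier_def by (simp add: cis_mult inner_add_right mult.assoc[symmetric] del: of_nat_Suc)
      also have "\<dots> = of_real (inverse (?e n) ^ DIM('a)) * of_real (?G (inverse (?e n) *\<^sub>R (y + x)))"
        unfolding G2 fconst_eq by (simp del: of_nat_Suc)
      finally show "\<phi> y * fourier ?\<psi> y = of_real (inverse (?e n) ^ DIM('a)) * (\<phi> y * of_real (?G (inverse (?e n) *\<^sub>R (y + x))))"
        by (simp only: mult_ac)
    qed
    also have "\<dots> = of_real (inverse (?e n) ^ DIM('a)) * (\<integral>y. \<phi> y * of_real (?G (inverse (?e n) *\<^sub>R (y + x))) \<partial>lborel)" by simp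
    \<comment> \<open>Substitution \<open>y = - x + ?e n *\<^sub>R z\<close>; its Jacobian cancels
      the power of \<open>inverse (?e n)\<close> in front.\<close>
    also have "(\<integral>y. \<phi> y * of_real (?G (inverse (?e n) *\<^sub>R (y + x))) \<partial>lborel)
      = of_real (?e n ^ DIM('a)) * (\<integral>z. \<phi> (- x + ?e n *\<^sub>R z) * of_real (?G (inverse (?e n) *\<^sub>R ((- x + ?e n *\<^sub>R z) + x))) \<partial>lborel)"
      by (intro integral_affine epos borel_measurable_continuous_onI continuous_intros smooth_continuous[OF schwartz_smooth[OF \<phi>]]) simp_all
    also have "of_real (inverse (?e n) ^ DIM('a)) * (of_real (?e n ^ DIM('a)) * (\<integral>z. \<phi> (- x + ?e n *\<^sub>R z) * of_real (?G (inverse (?e n) *\<^sub>R ((- x + ?e n *\<^sub>R z) + x))) \<partial>lborel))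
      = (\<integral>z. \<phi> (- x + ?e n *\<^sub>R z) * of_real (?G z) \<partial>lborel)"
      by (simp add: mult.assoc[symmetric] power_inverse del: of_nat_Suc)
    finally show ?thesis .
  qed
  have "I \<longlonglongrightarrow> (\<integral>z. \<phi> (- x) * of_real (?G z) \<partial>lborel)"
    unfolding I_eq
  proof (rule integral_dominated_convergence[where w="\<lambda>z. B * ?G z"])
    have "isCont \<phi> (- x)" using smooth_continuous[OF schwartz_smooth[OF \<phi>], of UNIV] by (simp add: continuous_on_eq_continuous_at)
    moreover have "(\<lambda>n. - x + ?e n *\<^sub>R z) \<longlonglongrightarrow> - x" for z
      using tendsto_add[OF tendsto_const[of "- x"] tendsto_scaleR[OF e0 tendsto_const[of z]]] by simp
    ultimately have "(\<lambda>n. \<phi> (- x + ?e n *\<^sub>R z)) \<longlonglongrightarrow> \<phi> (- x)" for z by (rule isCont_tendsto_compose)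
    then show "AE z in lborel. (\<lambda>n. \<phi> (- x + ?e n *\<^sub>R z) * complex_of_real (?G z)) \<longlonglongrightarrow> \<phi> (- x) * complex_of_real (?G z)"
      by (intro AE_I2 tendsto_intros)
    show "AE z in lborel. norm (\<phi> (- x + ?e n *\<^sub>R z) * complex_of_real (?G z)) \<le> B * ?G z" for n
      by (intro AE_I2) (simp add: norm_mult B)
  qed (use Gint in auto)
  also have "(\<integral>z. \<phi> (- x) * of_real (?G z) \<partial>lborel) = \<phi> (- x) * of_real (sqrt (2 * pi) ^ DIM('a))"
    by (subst integral_mult_right_zero) (simp only: Gtot)
  finally have "(\<integral>\<xi>. cis (- (\<xi> \<bullet> x)) * fourier \<phi> \<xi> \<partial>lborel) = \<phi> (- x) * of_real (sqrt (2 * pi) ^ DIM('a))"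
    using lim1 LIMSEQ_unique by blast
  then show ?thesis unfolding fourier_def[of "fourier \<phi>"] fconst_eq by simp
qed

lemma fourier_inverse_exists:
  fixes \<phi> :: "'a::euclidean_space \<Rightarrow> complex"
  assumes "\<phi> \<in> schwartz_space"
  shows "fourier (\<lambda>\<zeta>. fourier \<phi> (- \<zeta>)) = \<phi>" "(\<lambda>\<zeta>. fourier \<phi> (- \<zeta>)) \<in> schwartz_space"
proof -
  show S: "(\<lambda>\<zeta>. fourier \<phi> (- \<zeta>)) \<in> schwartz_space" by (intro schwartz_reflect fourier_schwartz assms)
  have "fourier (\<lambda>\<zeta>. fourier \<phi> (- \<zeta>)) x = fourier (fourier \<phi>) (- x)" for x
  proof -
    have [measurable]: "fourier \<phi> \<in> borel_measurable borel" by (intro schwartz_measurable fourier_schwartz assms)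
    have "(\<integral>\<zeta>. cis (- (\<zeta> \<bullet> x)) * fourier \<phi> (- \<zeta>) \<partial>lborel) = (\<integral>\<zeta>. cis (- ((- \<zeta>) \<bullet> (- x))) * fourier \<phi> (- \<zeta>) \<partial>lborel)" by simp
    also have "\<dots> = (\<integral>\<zeta>. cis (- (\<zeta> \<bullet> (- x))) * fourier \<phi> \<zeta> \<partial>distr lborel borel uminus)"
      by (subst integral_distr) auto
    also have "distr lborel borel uminus = (lborel :: 'a measure)"
      using lborel_affine[of "-1" "0::'a"] by (simp add: density_1)
    finally show ?thesis by (simp add: fourier_def)
  qed
  then show "fourier (\<lambda>\<zeta>. fourier \<phi> (- \<zeta>)) = \<phi>" using fourier_inversion[OF assms] by (simp add: fun_eq_iff)
qed

text \<open>The positive and the negative part of h are densities of two measures that agree on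
  boxes, a generator stable under intersection. Equal measures have densities that agree almost
  everywhere.\<close>

lemma integral_box_zero_imp_AE_zero:
  fixes h :: "'a::euclidean_space \<Rightarrow> real"
  assumes h: "integrable lborel h" and z: "\<And>a b. (\<integral>x. indicator (box a b) x * h x \<partial>lborel) = 0"
  shows "AE x in lborel. h x = 0"
proof -
  have [measurable]: "h \<in> borel_measurable borel" using borel_measurable_integrable[OF h] by simp
  let ?p = "\<lambda>x. ennreal (max 0 (h x))" and ?n = "\<lambda>x. ennreal (max 0 (- h x))"
  have ip: "integrable lborel (\<lambda>x. max 0 (h x))" and inn: "integrable lborel (\<lambda>x. max 0 (- h x))"
    by (rule Bochner_Integration.integrable_bound[OF h]; simp)+
  have em: "emeasure (density lborel (\<lambda>x. ennreal (max 0 (g x)))) (box a b) = ennreal (\<integral>x. indicator (box a b) x * max 0 (g x) \<partial>lborel)"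
    if g: "integrable lborel (\<lambda>x. max 0 (g x))" and [measurable]: "g \<in> borel_measurable borel" for g and a b :: 'a
  proof -
    have "emeasure (density lborel (\<lambda>x. ennreal (max 0 (g x)))) (box a b) = (\<integral>\<^sup>+x. ennreal (indicator (box a b) x * max 0 (g x)) \<partial>lborel)"
      by (subst emeasure_density) (auto intro!: nn_integral_cong simp: indicator_def)
    also have "\<dots> = ennreal (\<integral>x. indicator (box a b) x * max 0 (g x) \<partial>lborel)"
      by (intro nn_integral_eq_integral Bochner_Integration.integrable_bound[OF g]) (auto simp: indicator_def)
    finally show ?thesis .
  qed
  have eq: "(\<integral>x. indicator (box a b) x * max 0 (h x) \<partial>lborel) = (\<integral>x. indicator (box a b) x * max 0 (- h x) \<partial>lborel)" for a b
  proof -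
    have "0 = (\<integral>x. indicator (box a b) x * max 0 (h x) - indicator (box a b) x * max 0 (- h x) \<partial>lborel)"
    proof -
      have "(\<integral>x. indicator (box a b) x * max 0 (h x) - indicator (box a b) x * max 0 (- h x) \<partial>lborel) = (\<integral>x. indicator (box a b) x * h x \<partial>lborel)"
        by (intro Bochner_Integration.integral_cong refl) (auto simp: max_def indicator_def)
      then show ?thesis using z[of a b] by simp
    qed
    also have "\<dots> = (\<integral>x. indicator (box a b) x * max 0 (h x) \<partial>lborel) - (\<integral>x. indicator (box a b) x * max 0 (- h x) \<partial>lborel)"
      by (intro Bochner_Integration.integral_diff Bochner_Integration.integrable_bound[OF ip] Bochner_Integration.integrable_bound[OF inn])
        (auto simp: indicator_def)
    finally show ?thesis by simp
  qed
  have "density lborel ?p = density lborel ?n"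
  proof (rule measure_eqI_generator_eq[where E="range (\<lambda>(a, b). box a (b::'a))" and \<Omega>=UNIV and A="\<lambda>n. box (- (real n *\<^sub>R One)) (real n *\<^sub>R One)"])
    show "Int_stable (range (\<lambda>(a, b). box a (b::'a)))"
      by (auto simp: Int_stable_def box_Int_box)
    show "sets (density lborel ?p) = sigma_sets UNIV (range (\<lambda>(a, b). box a b))"
      "sets (density lborel ?n) = sigma_sets UNIV (range (\<lambda>(a, b). box a b))"
      by (simp_all add: borel_eq_box)
    show "(\<Union>i::nat. box (- (real i *\<^sub>R One)) (real i *\<^sub>R One)) = (UNIV :: 'a set)" by (rule UN_box_eq_UNIV)
    show "emeasure (density lborel ?p) (box (- (real i *\<^sub>R One)) (real i *\<^sub>R One)) \<noteq> \<infinity>" for i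
      by (subst em) (simp_all add: ip)
    fix X :: "'a set" assume "X \<in> range (\<lambda>(a, b). box a b)"
    then obtain a b where "X = box a b" by auto
    then show "emeasure (density lborel ?p) X = emeasure (density lborel ?n) X"
      using em[OF ip, of a b] em[of "\<lambda>x. - h x" a b] inn eq[of a b] by simp
  qed auto
  then have "AE x in lborel. ?p x = ?n x"
    by (subst (asm) sigma_finite_measure.density_unique_iff[OF sigma_finite_lborel]) auto
  then show ?thesis by (rule eventually_mono) (auto simp: max_def split: if_splits)
qed

text \<open>H itself need not be integrable. A bump makes it integrable without changing it on a
  ball, and dominated convergence along \<open>box_bumps\<close> then leads from test functions to
  boxes.\<close>

lemma AE_zero_of_test_integrals:
  fixes H :: "'a::euclidean_space \<Rightarrow> complex"
  assumes H: "\<And>\<theta>. \<theta> \<in> test_functions \<Longrightarrow> integrable lborel (\<lambda>x. H x * \<theta> x)"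
    and z: "\<And>\<theta>. \<theta> \<in> test_functions \<Longrightarrow> (\<integral>x. H x * \<theta> x \<partial>lborel) = 0"
    and [measurable]: "H \<in> borel_measurable borel"
  shows "AE x in lborel. H x = 0"
proof -
  have ball: "AE x in lborel. x \<in> ball 0 (real (Suc n)) \<longrightarrow> H x = 0" for n
  proof -
    obtain ch where ch: "ch \<in> test_functions" "\<And>x. x \<in> cball (0::'a) (Suc n) \<Longrightarrow> ch x = 1"
      by (rule bump_exists[of "real (Suc n)" "real (Suc n) + 1" "0::'a"]) (simp, simp, blast)
    note [measurable] = smooth_measurable[OF test_smooth[OF ch(1)]]
    define h where "h x = H x * ch x" for x
    have [measurable]: "h \<in> borel_measurable borel" unfolding h_def by measurable
    have hint: "integrable lborel h" unfolding h_def by (rule H[OF ch(1)])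
    have box: "(\<integral>x. indicator (box a b) x * h x \<partial>lborel) = 0" for a b
    proof -
      obtain u where u: "\<And>n. u n \<in> test_functions" "\<And>n x. norm (u n x) \<le> 1"
        "\<And>x. (\<lambda>n. u n x) \<longlonglongrightarrow> indicator (box a b) x"
        using box_bumps[of a b] by metis
      have [measurable]: "u n \<in> borel_measurable borel" for n by (rule smooth_measurable[OF test_smooth[OF u(1)]])
      have "(\<lambda>n. \<integral>x. u n x * h x \<partial>lborel) \<longlonglongrightarrow> (\<integral>x. indicator (box a b) x * h x \<partial>lborel)"
      proof (rule integral_dominated_convergence[where w="\<lambda>x. norm (h x)"])
        show "AE x in lborel. (\<lambda>n. u n x * h x) \<longlonglongrightarrow> indicator (box a b) x * h x" by (intro AE_I2 tendsto_intros u)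
        show "AE x in lborel. norm (u n x * h x) \<le> norm (h x)" for n
          using u(2)[of n] by (intro AE_I2) (simp add: norm_mult mult_left_le_one_le)
      qed (use hint in auto)
      moreover have "(\<integral>x. u n x * h x \<partial>lborel) = 0" for n
        using z[OF test_mult[OF ch(1) test_smooth[OF u(1)]], of n] by (simp add: h_def mult_ac)
      ultimately show ?thesis by (simp add: LIMSEQ_const_iff)
    qed
    have bi: "integrable lborel (\<lambda>x. indicator (box a b) x * h x)" for a b
      by (rule Bochner_Integration.integrable_bound[OF hint]) (auto simp: norm_mult indicator_def)
    have "AE x in lborel. Re (h x) = 0"
    proof (rule integral_box_zero_imp_AE_zero)
      show "integrable lborel (\<lambda>x. Re (h x))" using hint by simp
      fix a b :: 'a
      have "(\<integral>x. indicator (box a b) x * Re (h x) \<partial>lborel) = (\<integral>x. Re (indicator (box a b) x * h x) \<partial>lborel)"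
        by (intro Bochner_Integration.integral_cong refl) (auto simp: indicator_def)
      also have "\<dots> = Re (\<integral>x. indicator (box a b) x * h x \<partial>lborel)" by (rule integral_Re[OF bi])
      finally show "(\<integral>x. indicator (box a b) x * Re (h x) \<partial>lborel) = 0" by (simp only: box zero_complex.simps)
    qed
    moreover have "AE x in lborel. Im (h x) = 0"
    proof (rule integral_box_zero_imp_AE_zero)
      show "integrable lborel (\<lambda>x. Im (h x))" using hint by simp
      fix a b :: 'a
      have "(\<integral>x. indicator (box a b) x * Im (h x) \<partial>lborel) = (\<integral>x. Im (indicator (box a b) x * h x) \<partial>lborel)"
        by (intro Bochner_Integration.integral_cong refl) (auto simp: indicator_def)
      also have "\<dots> = Im (\<integral>x. indicator (box a b) x * h x \<partial>lborel)" by (rule integral_Im[OF bi])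
      finally show "(\<integral>x. indicator (box a b) x * Im (h x) \<partial>lborel) = 0" by (simp only: box zero_complex.simps)
    qed
    ultimately show ?thesis
    proof eventually_elim
      case (elim x)
      show ?case
      proof
        assume "x \<in> ball 0 (real (Suc n))"
        then have "ch x = 1" by (intro ch(2)) auto
        then show "H x = 0" using elim by (simp add: h_def complex_eq_iff)
      qed
    qed
  qed
  have "AE x in lborel. \<forall>n. x \<in> ball 0 (real (Suc n)) \<longrightarrow> H x = 0"
    by (subst AE_all_countable) (use ball in blast)
  then show ?thesis
  proof (rule eventually_mono)
    fix x :: 'a assume a: "\<forall>n. x \<in> ball 0 (real (Suc n)) \<longrightarrow> H x = 0"
    obtain n :: nat where "norm x < n" using reals_Archimedean2 by blast
    then have "x \<in> ball 0 (real (Suc n))" by simp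
    then show "H x = 0" using a by blast
  qed
qed

section \<open>Compactly supported tempered distributions\<close>

lemma test_add: "f \<in> test_functions \<Longrightarrow> g \<in> test_functions \<Longrightarrow> (\<lambda>x. f x + g x) \<in> test_functions"
  by (rule test_functionsI[of _ "fun_support f \<union> fun_support g"])
    (auto simp: test_functions_def smooth_add fun_supportD)

lemma test_mult_right: "g \<in> test_functions \<Longrightarrow> smooth f \<Longrightarrow> (\<lambda>x. f x * g x) \<in> test_functions"
  using test_mult[of g f] by (simp add: mult.commute)

lemma test_diff: "f \<in> test_functions \<Longrightarrow> g \<in> test_functions \<Longrightarrow> (\<lambda>x. f x - g x) \<in> test_functions"
  using test_add[OF _ test_mult_right[OF _ smooth_const[of "-1"]]] by simp

locale tempered =
  fixes f :: "('a::euclidean_space \<Rightarrow> complex) \<Rightarrow> complex"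
  assumes tempered: "tempered_distribution f"
begin

lemma add: "\<phi> \<in> schwartz_space \<Longrightarrow> \<psi> \<in> schwartz_space \<Longrightarrow> f (\<lambda>x. \<phi> x + \<psi> x) = f \<phi> + f \<psi>"
  and cmult: "\<phi> \<in> schwartz_space \<Longrightarrow> f (\<lambda>x. a * \<phi> x) = a * f \<phi>"
  using tempered by (auto simp: tempered_distribution_def)

lemma diff: "\<phi> \<in> schwartz_space \<Longrightarrow> \<psi> \<in> schwartz_space \<Longrightarrow> f (\<lambda>x. \<phi> x - \<psi> x) = f \<phi> - f \<psi>"
  using add[of \<phi> "\<lambda>x. (-1) * \<psi> x"] cmult[of \<psi> "-1"] schwartz_cmult[of \<psi> "-1"] by simp

lemma zero: "f (\<lambda>_. 0) = 0"
proof -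
  have "(\<lambda>_. 0) \<in> (schwartz_space :: ('a \<Rightarrow> complex) set)"
    by (intro test_in_schwartz test_functionsI[of _ "{}"] smooth_const) auto
  from cmult[OF this, of 0] show ?thesis by simp
qed

text \<open>
  A product of factors \<open>1 - h\<close> that vanishes on the support of a test function plays the role of a
  partition of unity.
\<close>

definition null_bump :: "('a \<Rightarrow> complex) \<Rightarrow> bool" where
  "null_bump h \<longleftrightarrow> h \<in> test_functions \<and> (\<forall>g. smooth g \<longrightarrow> f (\<lambda>x. h x * g x) = 0)"

text \<open>The factor \<open>1 - h\<close> subtracts \<open>h x * \<phi> x\<close>, on which f
  vanishes. The statement is generalized over \<phi> because each factor changes the test
  function.\<close>

lemma null_bump_remove:
  assumes "\<forall>h\<in>set hs. null_bump h" "\<phi> \<in> test_functions"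
  shows "f (\<lambda>x. \<phi> x * (\<Prod>h\<leftarrow>hs. (1 - h x))) = f \<phi>"
  using assms
proof (induction hs arbitrary: \<phi>)
  case (Cons h hs)
  have h: "h \<in> test_functions" "f (\<lambda>x. h x * \<phi> x) = 0"
    using Cons.prems by (auto simp: null_bump_def test_smooth)
  have h\<phi>: "(\<lambda>x. h x * \<phi> x) \<in> test_functions" using h(1) Cons.prems(2) by (intro test_mult test_smooth)
  have "f (\<lambda>x. \<phi> x * (\<Prod>h\<leftarrow>h # hs. (1 - h x))) = f (\<lambda>x. (\<phi> x - h x * \<phi> x) * (\<Prod>h\<leftarrow>hs. (1 - h x)))"
    by (rule arg_cong[where f=f]) (simp add: fun_eq_iff algebra_simps)
  also have "\<dots> = f (\<lambda>x. \<phi> x - h x * \<phi> x)"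
    using Cons h\<phi> by (intro Cons.IH test_diff) auto
  also have "\<dots> = f \<phi>"
    using h h\<phi> Cons.prems(2) by (subst diff) (auto intro: test_in_schwartz)
  finally show ?case .
qed simp

text \<open>The definition of the support yields vanishing only locally. Finitely many bumps that f
  annihilates cover the compact support of \<phi>, and the product of the factors
  \<open>1 - h\<close> is 0 on it.\<close>

lemma vanish_off_support:
  assumes \<phi>: "\<phi> \<in> test_functions" and disj: "fun_support \<phi> \<inter> dist_support f = {}"
  shows "f \<phi> = 0"
proof -
  have "\<exists>h r. null_bump h \<and> r > 0 \<and> (\<forall>y\<in>ball x r. h y = 1)" if "x \<in> fun_support \<phi>" for x
  proof -
    have "x \<notin> dist_support f" using that disj by blast
    then obtain U where U: "open U" "x \<in> U" "\<And>\<psi>. \<psi> \<in> test_functions \<Longrightarrow> fun_support \<psi> \<subseteq> U \<Longrightarrow> f \<psi> = 0"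
      unfolding dist_support_def by blast
    obtain e where e: "e > 0" "cball x e \<subseteq> U" using U open_contains_cball by blast
    obtain h where h: "h \<in> test_functions" "\<And>y. y \<in> cball x (e/2) \<Longrightarrow> h y = 1" "\<And>y. y \<notin> cball x e \<Longrightarrow> h y = 0"
      using bump_exists[of "e/2" e x] e(1) by (metis field_sum_of_halves half_gt_zero less_add_same_cancel1)
    have "null_bump h"
      unfolding null_bump_def
    proof (intro conjI allI impI h(1))
      fix g :: "'a \<Rightarrow> complex" assume g: "smooth g"
      have "fun_support (\<lambda>x. h x * g x) \<subseteq> cball x e"
        by (rule fun_support_subset) (auto simp: h(3))
      then show "f (\<lambda>x. h x * g x) = 0" using e(2) by (intro U(3) test_mult h(1) g) auto
    qed
    then show ?thesis using h(2) e(1) by (intro exI[of _ h] exI[of _ "e/2"]) auto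
  qed
  then obtain H R where HR: "\<And>x. x \<in> fun_support \<phi> \<Longrightarrow> null_bump (H x) \<and> R x > 0 \<and> (\<forall>y\<in>ball x (R x). H x y = 1)"
    by metis
  have "compact (fun_support \<phi>)" using \<phi> by (simp add: test_functions_def)
  moreover have "fun_support \<phi> \<subseteq> (\<Union>x\<in>fun_support \<phi>. ball x (R x))" using HR by force
  ultimately obtain D where D: "D \<subseteq> fun_support \<phi>" "finite D" "fun_support \<phi> \<subseteq> (\<Union>x\<in>D. ball x (R x))"
    using compactE_image[of "fun_support \<phi>" "fun_support \<phi>" "\<lambda>x. ball x (R x)"] by (metis open_ball)
  obtain xs where xs: "set xs = D" using finite_list[OF D(2)] by blast
  have "\<phi> x * (\<Prod>h\<leftarrow>map H xs. (1 - h x)) = 0" for x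
  proof (cases "x \<in> fun_support \<phi>")
    case True
    then obtain y where y: "y \<in> D" "x \<in> ball y (R y)" using D(3) by blast
    then have "H y x = 1" using HR D(1) by blast
    then have "0 \<in> set (map (\<lambda>h. 1 - h x) (map H xs))" using y(1) xs by (auto simp: image_iff intro!: bexI[of _ y])
    then have "(\<Prod>h\<leftarrow>map H xs. (1 - h x)) = 0" by (subst prod_list_zero_iff)
    then show ?thesis by simp
  qed (simp add: fun_supportD)
  then have "f (\<lambda>x. \<phi> x * (\<Prod>h\<leftarrow>map H xs. (1 - h x))) = 0" by (simp only: zero)
  moreover have "f (\<lambda>x. \<phi> x * (\<Prod>h\<leftarrow>map H xs. (1 - h x))) = f \<phi>"
    by (rule null_bump_remove[OF _ \<phi>]) (use HR D(1) xs in auto)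
  ultimately show ?thesis by simp
qed

definition is_cutoff :: "('a \<Rightarrow> complex) \<Rightarrow> bool" where
  "is_cutoff h \<longleftrightarrow> h \<in> test_functions \<and> (\<exists>U. open U \<and> dist_support f \<subseteq> U \<and> (\<forall>x\<in>U. h x = 1))"

text \<open>The difference of two cutoffs is 0 on a neighbourhood of the support of f. This makes
  the choice in \<open>cutoff\<close> harmless and lets one cutoff serve many distributions.\<close>

lemma cutoff_independent:
  assumes "is_cutoff h" "is_cutoff h'" "smooth g"
  shows "f (\<lambda>x. h x * g x) = f (\<lambda>x. h' x * g x)"
proof -
  obtain U U' where U: "open U" "dist_support f \<subseteq> U" "\<And>x. x \<in> U \<Longrightarrow> h x = 1"
    and U': "open U'" "dist_support f \<subseteq> U'" "\<And>x. x \<in> U' \<Longrightarrow> h' x = 1"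
    and t: "h \<in> test_functions" "h' \<in> test_functions"
    using assms(1,2) unfolding is_cutoff_def by blast
  have sub: "fun_support (\<lambda>x. h x * g x - h' x * g x) \<subseteq> - (U \<inter> U')"
    using U U' by (intro fun_support_subset) auto
  have "f (\<lambda>x. h x * g x - h' x * g x) = 0"
    by (rule vanish_off_support) (use sub U(2) U'(2) t assms(3) in \<open>auto intro: test_diff test_mult\<close>)
  then show ?thesis
    using diff[OF test_in_schwartz[OF test_mult[OF t(1) assms(3)]] test_in_schwartz[OF test_mult[OF t(2) assms(3)]]] by simp
qed

end

locale compact_tempered = tempered +
  assumes bounded_support: "bounded (dist_support f)"
begin

lemma cutoff_is_cutoff: "is_cutoff (cutoff f)"
proof -
  obtain r where r: "\<And>x. x \<in> dist_support f \<Longrightarrow> norm x \<le> r" "r > 0"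
    using bounded_support bounded_pos by blast
  obtain h where h: "h \<in> test_functions" "\<And>y. y \<in> cball (0::'a) (r + 1) \<Longrightarrow> h y = 1"
    using bump_exists[of "r + 1" "r + 2" "0::'a"] r(2) by (metis add_pos_pos add_strict_left_mono one_less_numeral_iff semiring_norm(76) zero_less_one)
  have "\<exists>h. h \<in> test_functions \<and> (\<exists>U. open U \<and> dist_support f \<subseteq> U \<and> (\<forall>x\<in>U. h x = 1))"
    using h r by (intro exI[of _ h] conjI exI[of _ "ball 0 (r + 1)"]) (auto intro!: le_less_trans[OF r(1)])
  from someI_ex[OF this] show ?thesis unfolding is_cutoff_def cutoff_def by blast
qed

text \<open>The difference of both arguments is not a test function, so vanishing off the support
  does not apply to it directly. Dilated bumps are admissible cutoffs once they are wide enough, and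
  they converge to 1 in the sense controlled by the continuity of f.\<close>

lemma cutoff_schwartz:
  assumes \<psi>: "\<psi> \<in> schwartz_space"
  shows "f (\<lambda>x. cutoff f x * \<psi> x) = f \<psi>"
proof -
  obtain r where r: "\<And>x. x \<in> dist_support f \<Longrightarrow> norm x \<le> r" "r > 0"
    using bounded_support bounded_pos by blast
  obtain h where h: "h \<in> test_functions" "\<And>y. y \<in> cball (0::'a) 1 \<Longrightarrow> h y = 1"
    using bump_exists[of 1 2 "0::'a"] by (metis one_less_numeral_iff semiring_norm(76) zero_less_one)
  let ?h = "\<lambda>m x. h (inverse (Suc m) *\<^sub>R x)"
  have t: "?h m \<in> test_functions" for m
  proof (rule test_functionsI)
    show "smooth (?h m)" by (intro smooth_scale test_smooth h)
    show "compact ((\<lambda>x. real (Suc m) *\<^sub>R x) ` fun_support h)"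
      using h(1) by (intro compact_scaling) (simp add: test_functions_def)
    fix x assume x: "x \<notin> (\<lambda>x. real (Suc m) *\<^sub>R x) ` fun_support h"
    have "inverse (real (Suc m)) *\<^sub>R x \<notin> fun_support h"
    proof
      assume "inverse (real (Suc m)) *\<^sub>R x \<in> fun_support h"
      then have "real (Suc m) *\<^sub>R inverse (real (Suc m)) *\<^sub>R x \<in> (\<lambda>x. real (Suc m) *\<^sub>R x) ` fun_support h" by (rule imageI)
      then show False using x by (simp del: of_nat_Suc)
    qed
    then show "?h m x = 0" by (rule fun_supportD)
  qed
  obtain C N where CN: "\<And>\<phi>. \<phi> \<in> schwartz_space \<Longrightarrow> norm (f \<phi>) \<le> C * schwartz_seminorm N \<phi>"
    using tempered unfolding tempered_distribution_def by blast
  have lim: "(\<lambda>m. f (\<lambda>x. (1 - ?h m x) * \<psi> x)) \<longlonglongrightarrow> 0"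
  proof (rule Lim_null_comparison)
    show "(\<lambda>m. C * schwartz_seminorm N (\<lambda>x. (1 - ?h m x) * \<psi> x)) \<longlonglongrightarrow> 0"
      using tendsto_mult_right_zero[OF schwartz_seminorm_cutoff[OF h \<psi>]] by simp
    have "(\<lambda>x. (1 - ?h m x) * \<psi> x) \<in> schwartz_space" for m
      using schwartz_diff[OF \<psi> test_in_schwartz[OF test_mult[OF t schwartz_smooth[OF \<psi>]]], of m] by (simp add: left_diff_distrib)
    then show "eventually (\<lambda>m. norm (f (\<lambda>x. (1 - ?h m x) * \<psi> x)) \<le> C * schwartz_seminorm N (\<lambda>x. (1 - ?h m x) * \<psi> x)) sequentially"
      by (intro always_eventually allI CN)
  qed
  obtain m0 :: nat where m0: "r < m0" using reals_Archimedean2 by blast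
  have "f (\<lambda>x. (1 - ?h m x) * \<psi> x) = f \<psi> - f (\<lambda>x. cutoff f x * \<psi> x)" if m: "m0 \<le> m" for m
  proof -
    have "is_cutoff (?h m)"
      unfolding is_cutoff_def
    proof (intro conjI exI[of _ "ball 0 (real (Suc m))"] t)
      show "dist_support f \<subseteq> ball 0 (real (Suc m))" using r(1) m0 m by fastforce
      show "\<forall>x\<in>ball 0 (real (Suc m)). h (inverse (real (Suc m)) *\<^sub>R x) = 1"
      proof
        fix x :: 'a assume "x \<in> ball 0 (real (Suc m))"
        then have "inverse (real (Suc m)) *\<^sub>R x \<in> cball 0 1" by (simp add: field_simps)
        then show "h (inverse (real (Suc m)) *\<^sub>R x) = 1" by (rule h(2))
      qed
    qed simp
    then have "f (\<lambda>x. ?h m x * \<psi> x) = f (\<lambda>x. cutoff f x * \<psi> x)"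
      by (rule cutoff_independent[OF _ cutoff_is_cutoff schwartz_smooth[OF \<psi>]])
    moreover have "f (\<lambda>x. \<psi> x - ?h m x * \<psi> x) = f \<psi> - f (\<lambda>x. ?h m x * \<psi> x)"
      by (intro diff \<psi> test_in_schwartz test_mult t schwartz_smooth)
    ultimately show ?thesis by (simp add: left_diff_distrib)
  qed
  then have "eventually (\<lambda>m. f (\<lambda>x. (1 - ?h m x) * \<psi> x) = f \<psi> - f (\<lambda>x. cutoff f x * \<psi> x)) sequentially"
    by (auto simp: eventually_sequentially)
  from Lim_transform_eventually[OF lim this] show ?thesis by (simp add: LIMSEQ_const_iff)
qed

end

section \<open>The Fourier transform of a compactly supported Sobolev distribution\<close>

text \<open>The Cauchy-Schwarz inequality for a weight and its inverse, that is, the duality of the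
  two Sobolev norms. Both bounds are on nonnegative integrals, so integrability of the product comes
  out of the proof.\<close>

lemma norm_integral_le_weighted:
  fixes g h :: "'a::euclidean_space \<Rightarrow> complex" and w :: "'a \<Rightarrow> real"
  assumes [measurable]: "g \<in> borel_measurable borel" "h \<in> borel_measurable borel" "w \<in> borel_measurable borel"
    and w: "\<And>x. w x > 0" and A: "A > 0" and B: "B > 0"
    and gA: "(\<integral>\<^sup>+x. ennreal (w x * (norm (g x))\<^sup>2) \<partial>lborel) \<le> ennreal (A\<^sup>2)"
    and hB: "(\<integral>\<^sup>+x. ennreal (inverse (w x) * (norm (h x))\<^sup>2) \<partial>lborel) \<le> ennreal (B\<^sup>2)"
  shows "norm (\<integral>x. g x * h x \<partial>lborel) \<le> A * B"
proof -
  \<comment> \<open>The coefficients in the inequality of Young are balanced so that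
    \<open>?p * A\<^sup>2\<close> and \<open>?q * B\<^sup>2\<close> are both
    \<open>A * B / 2\<close>.\<close>
  let ?p = "B / (2 * A)" and ?q = "A / (2 * B)"
  have young: "norm (g x * h x) \<le> ?p * (w x * (norm (g x))\<^sup>2) + ?q * (inverse (w x) * (norm (h x))\<^sup>2)" for x
  proof -
    define a where "a = sqrt (B / A * w x) * norm (g x)"
    define b where "b = sqrt (A / B * inverse (w x)) * norm (h x)"
    have "sqrt (B / A * w x) * sqrt (A / B * inverse (w x)) = sqrt ((B / A * w x) * (A / B * inverse (w x)))"
      by (rule real_sqrt_mult[symmetric])
    also have "(B / A * w x) * (A / B * inverse (w x)) = 1" using A B w[of x] by (simp add: field_simps)
    finally have "a * b = norm (g x * h x)" by (simp add: a_def b_def norm_mult mult_ac)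
    moreover have "a * b \<le> (a\<^sup>2 + b\<^sup>2) / 2" using zero_le_power2[of "a - b"] by (simp add: power2_eq_square algebra_simps)
    moreover have "a\<^sup>2 = B / A * w x * (norm (g x))\<^sup>2" using A B less_imp_le[OF w[of x]] by (simp add: a_def power_mult_distrib)
    moreover have "b\<^sup>2 = A / B * inverse (w x) * (norm (h x))\<^sup>2" using A B less_imp_le[OF w[of x]] by (simp add: b_def power_mult_distrib)
    ultimately show ?thesis by (simp add: field_simps)
  qed
  have p: "?p \<ge> 0" "?q \<ge> 0" using A B by auto
  have wn: "w x * (norm (g x))\<^sup>2 \<ge> 0" "inverse (w x) * (norm (h x))\<^sup>2 \<ge> 0" for x
    using w[of x] by auto
  have "(\<integral>\<^sup>+x. ennreal (norm (g x * h x)) \<partial>lborel) \<le>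
    (\<integral>\<^sup>+x. ennreal ?p * ennreal (w x * (norm (g x))\<^sup>2) + ennreal ?q * ennreal (inverse (w x) * (norm (h x))\<^sup>2) \<partial>lborel)"
    using young p wn
    by (intro nn_integral_mono) (simp only: ennreal_mult[symmetric] ennreal_plus[symmetric] mult_nonneg_nonneg ennreal_leI)
  also have "\<dots> = ennreal ?p * (\<integral>\<^sup>+x. ennreal (w x * (norm (g x))\<^sup>2) \<partial>lborel) + ennreal ?q * (\<integral>\<^sup>+x. ennreal (inverse (w x) * (norm (h x))\<^sup>2) \<partial>lborel)"
    by (subst nn_integral_add; simp add: nn_integral_cmult)
  also have "\<dots> \<le> ennreal ?p * ennreal (A\<^sup>2) + ennreal ?q * ennreal (B\<^sup>2)"
    by (intro add_mono mult_left_mono gA hB) auto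
  also have "\<dots> = ennreal (A * B)"
    using p A B by (simp add: ennreal_mult[symmetric] ennreal_plus[symmetric] power2_eq_square del: ennreal_plus)
  finally have le: "(\<integral>\<^sup>+x. ennreal (norm (g x * h x)) \<partial>lborel) \<le> ennreal (A * B)" .
  then have "integrable lborel (\<lambda>x. g x * h x)"
    by (auto simp: integrable_iff_bounded intro: le_less_trans)
  then have "ennreal (\<integral>x. norm (g x * h x) \<partial>lborel) = (\<integral>\<^sup>+x. ennreal (norm (g x * h x)) \<partial>lborel)"
    by (intro nn_integral_eq_integral[symmetric] integrable_norm) auto
  with le have "ennreal (\<integral>x. norm (g x * h x) \<partial>lborel) \<le> ennreal (A * B)" by (simp only:)
  then have "(\<integral>x. norm (g x * h x) \<partial>lborel) \<le> A * B" using A B by (subst (asm) ennreal_le_iff) auto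
  then show ?thesis using integral_norm_bound[of lborel "\<lambda>x. g x * h x"] by linarith
qed

abbreviation sobolev_weight :: "real \<Rightarrow> 'a::euclidean_space \<Rightarrow> real" where
  "sobolev_weight s \<xi> \<equiv> (1 + (norm \<xi>)\<^sup>2) powr s"

lemma sobolev_weight_pos: "sobolev_weight s \<xi> > 0"
  by (simp add: add_pos_nonneg pos_add_strict less_imp_neq[THEN not_sym])

lemma fourier_modulation:
  "fourier (\<lambda>x. h x * cis (- (x \<bullet> \<xi>))) \<zeta> = fourier h (\<zeta> + \<xi>)"
proof -
  have "cis (- (x \<bullet> (\<zeta> + \<xi>))) = cis (- (x \<bullet> \<zeta>)) * cis (- (x \<bullet> \<xi>))" for x
    by (simp add: cis_mult inner_add_right)
  then show ?thesis by (simp only: fourier_def mult_ac)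
qed

text \<open>By Fourier inversion this is the Schwartz function whose Fourier transform is h times
  the exponential of frequency \<xi>. It turns f applied to that product into an integral against
  the Fourier transform of f.\<close>

definition modulated_dual :: "('a::euclidean_space \<Rightarrow> complex) \<Rightarrow> 'a \<Rightarrow> 'a \<Rightarrow> complex" where
  "modulated_dual h \<xi> \<zeta> = fourier h (\<xi> - \<zeta>)"

lemma modulated_dual:
  assumes "h \<in> test_functions"
  shows "modulated_dual h \<xi> \<in> schwartz_space" "fourier (modulated_dual h \<xi>) = (\<lambda>x. h x * cis (- (x \<bullet> \<xi>)))"
proof -
  have S: "(\<lambda>x. h x * cis (- (x \<bullet> \<xi>))) \<in> schwartz_space"
    by (intro test_in_schwartz test_mult assms smooth_cis_inner)
  have eq: "modulated_dual h \<xi> = (\<lambda>\<zeta>. fourier (\<lambda>x. h x * cis (- (x \<bullet> \<xi>))) (- \<zeta>))"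
    by (simp add: modulated_dual_def fourier_modulation fun_eq_iff)
  show "modulated_dual h \<xi> \<in> schwartz_space" "fourier (modulated_dual h \<xi>) = (\<lambda>x. h x * cis (- (x \<bullet> \<xi>)))"
    unfolding eq using fourier_inverse_exists[OF S] by auto
qed

text \<open>The dual norm of a cutoff times an exponential grows at most polynomially in the
  frequency: the weight at \<zeta> is distributed over \<xi> and the difference
  \<open>\<xi> - \<zeta>\<close>, and the rapid decay of \<open>fourier h\<close> takes care of the
  difference.\<close>

lemma modulated_dual_norm:
  fixes h :: "'a::euclidean_space \<Rightarrow> complex"
  assumes h: "h \<in> test_functions"
  obtains B K where "B > 0"
    "\<And>\<xi>. (\<integral>\<^sup>+\<zeta>. ennreal (inverse (sobolev_weight s \<zeta>) * (norm (modulated_dual h \<xi> \<zeta>))\<^sup>2) \<partial>lborel) \<le> ennreal ((B * (1 + norm \<xi>) ^ K)\<^sup>2)"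
proof -
  obtain K :: nat where K: "\<bar>s\<bar> \<le> real K" using real_arch_simple by blast
  let ?d = "DIM('a)"
  obtain C where C: "\<And>w. (1 + norm w) ^ (K + ?d) * norm (fourier h w) \<le> C"
    using fourier_decay[OF test_in_schwartz[OF h]] by blast
  have C0: "C \<ge> 0" by (rule order_trans[OF _ C[of 0]]) simp
  define J where "J = (\<integral>w. 1 / (1 + norm w) ^ (2 * ?d) \<partial>(lborel :: 'a measure))"
  have J0: "J \<ge> 0" unfolding J_def by (intro integral_nonneg_AE) auto
  have Jnn: "(\<integral>\<^sup>+w. ennreal (1 / (1 + norm w) ^ (2 * ?d)) \<partial>(lborel::'a measure)) = ennreal J"
    unfolding J_def by (rule nn_integral_eq_integral[OF integrable_inverse_poly]) auto
  \<comment> \<open>The summand 1 keeps B positive also when h is zero.\<close>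
  define B where "B = C * sqrt J + 1"
  have B: "B > 0" using C0 J0 by (simp add: B_def add_nonneg_pos)
  have "(\<integral>\<^sup>+\<zeta>. ennreal (inverse (sobolev_weight s \<zeta>) * (norm (modulated_dual h \<xi> \<zeta>))\<^sup>2) \<partial>lborel) \<le> ennreal ((B * (1 + norm \<xi>) ^ K)\<^sup>2)" for \<xi> :: 'a
  proof -
    have pt: "inverse (sobolev_weight s \<zeta>) * (norm (modulated_dual h \<xi> \<zeta>))\<^sup>2 \<le> (C\<^sup>2 * (1 + norm \<xi>) ^ (2 * K)) * (1 / (1 + norm (\<zeta> + - \<xi>)) ^ (2 * ?d))" for \<zeta>
    proof -
      let ?w = "\<xi> - \<zeta>"
      have one: "1 \<le> 1 + (norm \<zeta>)\<^sup>2" by simp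
      have "inverse (sobolev_weight s \<zeta>) = (1 + (norm \<zeta>)\<^sup>2) powr (- s)" by (simp add: powr_minus)
      also have "\<dots> \<le> (1 + (norm \<zeta>)\<^sup>2) powr (real K)" using K one by (intro powr_mono) auto
      also have "\<dots> = (1 + (norm \<zeta>)\<^sup>2) ^ K" by (rule powr_realpow) (use one in linarith)
      also have "\<dots> \<le> ((1 + norm \<zeta>)\<^sup>2) ^ K" by (intro power_mono) (auto simp: power2_sum)
      \<comment> \<open>The inequality of Peetre, a submultiplicative form of the triangle
        inequality.\<close>
      also have "\<dots> \<le> (((1 + norm \<xi>) * (1 + norm ?w))\<^sup>2) ^ K"
      proof (intro power_mono)
        have "norm \<zeta> \<le> norm \<xi> + norm ?w" using norm_triangle_ineq4[of \<xi> "\<xi> - \<zeta>"] by simp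
        also have "\<dots> \<le> norm \<xi> + norm ?w + norm \<xi> * norm ?w" by simp
        finally show "1 + norm \<zeta> \<le> (1 + norm \<xi>) * (1 + norm ?w)" by (simp add: algebra_simps)
      qed auto
      also have "\<dots> = (1 + norm \<xi>) ^ (2 * K) * (1 + norm ?w) ^ (2 * K)"
        by (simp add: power_mult_distrib power_mult[symmetric])
      finally have 1: "inverse (sobolev_weight s \<zeta>) \<le> (1 + norm \<xi>) ^ (2 * K) * (1 + norm ?w) ^ (2 * K)" .
      have pos: "(1 + norm ?w) ^ n > 0" for n by (simp add: add_pos_nonneg)
      have "((1 + norm ?w) ^ (K + ?d) * norm (fourier h ?w))\<^sup>2 \<le> C\<^sup>2" using C[of ?w] by (intro power_mono) auto
      then have 2: "(1 + norm ?w) ^ (2 * K) * (1 + norm ?w) ^ (2 * ?d) * (norm (fourier h ?w))\<^sup>2 \<le> C\<^sup>2"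
        by (simp add: power_mult_distrib power_mult[symmetric] power_add[symmetric] algebra_simps)
      have "inverse (sobolev_weight s \<zeta>) * (norm (modulated_dual h \<xi> \<zeta>))\<^sup>2 \<le> (1 + norm \<xi>) ^ (2 * K) * (1 + norm ?w) ^ (2 * K) * (norm (fourier h ?w))\<^sup>2"
        unfolding modulated_dual_def by (intro mult_right_mono 1) simp
      also have "\<dots> = (1 + norm \<xi>) ^ (2 * K) * ((1 + norm ?w) ^ (2 * K) * (1 + norm ?w) ^ (2 * ?d) * (norm (fourier h ?w))\<^sup>2) / (1 + norm ?w) ^ (2 * ?d)"
        using pos[of "2 * ?d"] by (subst nonzero_eq_divide_eq[OF less_imp_neq[THEN not_sym]]) (assumption, simp only: mult_ac)
      also have "\<dots> \<le> (1 + norm \<xi>) ^ (2 * K) * C\<^sup>2 / (1 + norm ?w) ^ (2 * ?d)"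
        using pos[of "2 * ?d"] by (intro divide_right_mono mult_left_mono 2) auto
      finally show ?thesis by (simp add: norm_minus_commute mult.commute)
    qed
    have "(\<integral>\<^sup>+\<zeta>. ennreal (inverse (sobolev_weight s \<zeta>) * (norm (modulated_dual h \<xi> \<zeta>))\<^sup>2) \<partial>lborel)
      \<le> (\<integral>\<^sup>+\<zeta>. ennreal (C\<^sup>2 * (1 + norm \<xi>) ^ (2 * K)) * ennreal (1 / (1 + norm (\<zeta> + - \<xi>)) ^ (2 * ?d)) \<partial>lborel)"
      using pt by (intro nn_integral_mono) (simp only: ennreal_mult[symmetric] ennreal_leI zero_le_power2 zero_le_power mult_nonneg_nonneg divide_nonneg_nonneg add_nonneg_nonneg norm_ge_zero zero_le_one)
    also have "\<dots> = ennreal (C\<^sup>2 * (1 + norm \<xi>) ^ (2 * K)) * (\<integral>\<^sup>+\<zeta>. ennreal (1 / (1 + norm (\<zeta> + - \<xi>)) ^ (2 * ?d)) \<partial>lborel)"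
      by (rule nn_integral_cmult) measurable
    also have "(\<integral>\<^sup>+\<zeta>. ennreal (1 / (1 + norm (\<zeta> + - \<xi>)) ^ (2 * ?d)) \<partial>lborel) = (\<integral>\<^sup>+\<zeta>. ennreal (1 / (1 + norm \<zeta>) ^ (2 * ?d)) \<partial>distr lborel borel ((+) (- \<xi>)))"
      by (subst nn_integral_distr) (simp_all add: add.commute)
    also have "\<dots> = ennreal J" unfolding lborel_distr_plus by (rule Jnn)
    also have "ennreal (C\<^sup>2 * (1 + norm \<xi>) ^ (2 * K)) * ennreal J = ennreal ((C * sqrt J)\<^sup>2 * (1 + norm \<xi>) ^ (2 * K))"
      using J0 by (simp add: ennreal_mult[symmetric] power_mult_distrib mult_ac)
    also have "\<dots> \<le> ennreal ((B * (1 + norm \<xi>) ^ K)\<^sup>2)"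
    proof (rule ennreal_leI)
      have "(C * sqrt J)\<^sup>2 \<le> B\<^sup>2" using C0 J0 by (intro power_mono) (auto simp: B_def)
      then have "(C * sqrt J)\<^sup>2 * (1 + norm \<xi>) ^ (2 * K) \<le> B\<^sup>2 * (1 + norm \<xi>) ^ (2 * K)" by (intro mult_right_mono) auto
      then show "(C * sqrt J)\<^sup>2 * (1 + norm \<xi>) ^ (2 * K) \<le> (B * (1 + norm \<xi>) ^ K)\<^sup>2"
        by (simp add: power_mult_distrib power_mult[symmetric] mult.commute)
    qed
    finally show ?thesis .
  qed
  with B that show ?thesis by blast
qed

lemma ennreal_sqrt_less_imp:
  assumes "ennreal_sqrt t < ennreal e" "e > 0"
  shows "t \<le> ennreal (e\<^sup>2)"
proof (cases "t = \<infinity>")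
  case True
  then show ?thesis using assms by (simp add: ennreal_sqrt_def)
next
  case False
  then obtain r where r: "t = ennreal r" "r \<ge> 0" by (cases t) auto
  then have "sqrt r < e" using assms by (simp add: ennreal_sqrt_def ennreal_less_iff)
  then have "r \<le> e\<^sup>2" using real_sqrt_less_iff[of r "e\<^sup>2"] assms(2) by simp
  then show ?thesis using r by (simp add: ennreal_leI)
qed

lemma weighted_L2_norm_less_imp:
  "weighted_L2_norm s g < ennreal e \<Longrightarrow> e > 0 \<Longrightarrow> (\<integral>\<^sup>+\<xi>. ennreal (sobolev_weight s \<xi> * (norm (g \<xi>))\<^sup>2) \<partial>lborel) \<le> ennreal (e\<^sup>2)"
  unfolding weighted_L2_norm_def by (rule ennreal_sqrt_less_imp)

lemma schwartz_bounded:
  assumes "\<phi> \<in> schwartz_space"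
  obtains C where "C \<ge> 0" "\<And>x. norm (\<phi> x) \<le> C"
  using schwartz_bound[OF assms, of "[]" 0] by auto

locale compact_sobolev = compact_tempered f for f :: "('a::euclidean_space \<Rightarrow> complex) \<Rightarrow> complex" +
  fixes s :: real
  assumes sobolev: "f \<in> sobolev_space s"
begin

text \<open>The function F of the overview. It has a value at every point, as the restriction to
  subspaces demands.\<close>

definition hat :: "'a \<Rightarrow> complex" where
  "hat \<xi> = of_real (fconst TYPE('a)) * f (\<lambda>x. cutoff f x * cis (- (x \<bullet> \<xi>)))"

lemma cutoff_test: "cutoff f \<in> test_functions"
  using cutoff_is_cutoff by (simp add: is_cutoff_def)

text \<open>
  The uniform polynomial bound allows dominated convergence, which replaces the exchange of \<open>f\<close> with an
  integral.
\<close>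

lemma hat_approximation:
  obtains F C K where "\<And>n. F n \<in> borel_measurable borel" "\<And>\<xi>. (\<lambda>n. F n \<xi>) \<longlonglongrightarrow> hat \<xi>"
    "\<And>n \<xi>. norm (F n \<xi>) \<le> C * (1 + norm \<xi>) ^ K"
    "\<And>\<theta>. \<theta> \<in> schwartz_space \<Longrightarrow> (\<lambda>n. \<integral>\<xi>. F n \<xi> * \<theta> \<xi> \<partial>lborel) \<longlonglongrightarrow> f (fourier \<theta>)"
proof -
  let ?h = "cutoff f" and ?c = "fconst TYPE('a)"
  obtain \<phi> :: "nat \<Rightarrow> 'a \<Rightarrow> complex" where \<phi>: "\<And>n. \<phi> n \<in> schwartz_space"
    and Cau: "\<And>e. e > 0 \<Longrightarrow> \<exists>N. \<forall>m\<ge>N. \<forall>n\<ge>N. weighted_L2_norm s (fourier (\<lambda>x. \<phi> m x - \<phi> n x)) < ennreal e"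
    and lim: "\<And>\<psi>. \<psi> \<in> schwartz_space \<Longrightarrow> (\<lambda>n. \<integral>x. \<phi> n x * \<psi> x \<partial>lborel) \<longlonglongrightarrow> f \<psi>"
    using sobolev unfolding sobolev_space_def by blast
  \<comment> \<open>The Cauchy condition enters with the single value 1: from N on, all members of
    the sequence are within distance 1 of \<open>\<phi> N\<close>.\<close>
  obtain N where HN: "\<forall>m\<ge>N. \<forall>n\<ge>N. weighted_L2_norm s (fourier (\<lambda>x. \<phi> m x - \<phi> n x)) < ennreal 1"
    using Cau[OF zero_less_one] by (rule exE)
  note N = HN[rule_format, OF _ order_refl]
  obtain B K where B: "B > 0"
    "\<And>\<xi>. (\<integral>\<^sup>+\<zeta>. ennreal (inverse (sobolev_weight s \<zeta>) * (norm (modulated_dual ?h \<xi> \<zeta>))\<^sup>2) \<partial>lborel) \<le> ennreal ((B * (1 + norm \<xi>) ^ K)\<^sup>2)"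
    by (rule modulated_dual_norm[OF cutoff_test, of s]) (rule that)
  have prod: "(\<lambda>x. ?h x * \<phi> n x) \<in> schwartz_space" for n
    by (intro test_in_schwartz test_mult cutoff_test schwartz_smooth \<phi>)
  have he: "(\<lambda>x. ?h x * cis (- (x \<bullet> \<xi>))) \<in> schwartz_space" for \<xi>
    by (intro test_in_schwartz test_mult cutoff_test smooth_cis_inner)
  obtain H where H: "H \<ge> 0" "\<And>x. norm (?h x) \<le> H" using schwartz_bounded[OF test_in_schwartz[OF cutoff_test]] by metis
  define F where "F n = fourier (\<lambda>x. ?h x * \<phi> (n + N) x)" for n
  have F_eq: "F n \<xi> = of_real ?c * (\<integral>x. \<phi> (n + N) x * (?h x * cis (- (x \<bullet> \<xi>))) \<partial>lborel)" for n \<xi>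
    by (simp add: F_def fourier_def mult_ac)
  define D where "D = (\<integral>x. norm (\<phi> N x) * H \<partial>lborel)"
  have D0: "D \<ge> 0" unfolding D_def using H(1) by (intro integral_nonneg_AE) auto
  \<comment> \<open>The difference from \<open>\<phi> N\<close> has Sobolev norm below 1 and is
    estimated by duality, giving B. The fixed function \<open>\<phi> N\<close> is integrable and is
    estimated by the supremum H of the cutoff, giving D.\<close>
  have bound: "norm (F n \<xi>) \<le> (?c * (B + D)) * (1 + norm \<xi>) ^ K" for n \<xi>
  proof -
    let ?g = "\<lambda>x. ?h x * cis (- (x \<bullet> \<xi>))" and ?\<delta> = "\<lambda>x. \<phi> (n + N) x - \<phi> N x"
    have \<delta>: "?\<delta> \<in> schwartz_space" by (intro schwartz_diff \<phi>)
    obtain G where G: "\<And>x. norm (?g x) \<le> G" using schwartz_bounded[OF he] by metis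
    have i: "integrable lborel (\<lambda>x. ?g x * \<psi> x)" if "\<psi> \<in> schwartz_space" for \<psi>
      by (rule integrable_slow_schwartz[of _ G 0, OF schwartz_measurable[OF he] _ that]) (simp add: G)
    have "(\<integral>x. \<phi> (n + N) x * ?g x \<partial>lborel) = (\<integral>x. ?g x * ?\<delta> x + ?g x * \<phi> N x \<partial>lborel)"
      by (intro Bochner_Integration.integral_cong refl) (simp add: algebra_simps)
    also have "\<dots> = (\<integral>x. ?g x * ?\<delta> x \<partial>lborel) + (\<integral>x. ?g x * \<phi> N x \<partial>lborel)"
      by (rule Bochner_Integration.integral_add[OF i[OF \<delta>] i[OF \<phi>]])
    finally have split: "norm (\<integral>x. \<phi> (n + N) x * ?g x \<partial>lborel) \<le> norm (\<integral>x. ?g x * ?\<delta> x \<partial>lborel) + norm (\<integral>x. ?g x * \<phi> N x \<partial>lborel)"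
      by (simp only:) (rule norm_triangle_ineq)
    have "(\<integral>x. ?g x * ?\<delta> x \<partial>lborel) = (\<integral>x. ?\<delta> x * fourier (modulated_dual ?h \<xi>) x \<partial>lborel)"
      unfolding modulated_dual(2)[OF cutoff_test] by (simp only: mult_ac)
    also have "\<dots> = (\<integral>x. fourier ?\<delta> x * modulated_dual ?h \<xi> x \<partial>lborel)"
      by (intro fourier_multiplication_formula schwartz_integrable \<delta> modulated_dual(1) cutoff_test)
    finally have "norm (\<integral>x. ?g x * ?\<delta> x \<partial>lborel) = norm (\<integral>x. fourier ?\<delta> x * modulated_dual ?h \<xi> x \<partial>lborel)" by simp
    also have "\<dots> \<le> 1 * (B * (1 + norm \<xi>) ^ K)"
    proof (rule norm_integral_le_weighted[where w="sobolev_weight s"])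
      show "fourier ?\<delta> \<in> borel_measurable borel" by (intro schwartz_measurable fourier_schwartz \<delta>)
      show "modulated_dual ?h \<xi> \<in> borel_measurable borel" by (intro schwartz_measurable modulated_dual(1) cutoff_test)
      show "0 < B * (1 + norm \<xi>) ^ K" using B(1) by (simp add: add_pos_nonneg)
      show "(\<integral>\<^sup>+x. ennreal (sobolev_weight s x * (norm (fourier ?\<delta> x))\<^sup>2) \<partial>lborel) \<le> ennreal (1\<^sup>2)"
        by (rule weighted_L2_norm_less_imp[OF N]) simp_all
      show "(\<integral>\<^sup>+x. ennreal (inverse (sobolev_weight s x) * (norm (modulated_dual ?h \<xi> x))\<^sup>2) \<partial>lborel) \<le> ennreal ((B * (1 + norm \<xi>) ^ K)\<^sup>2)"
        by (rule B(2))
      show "sobolev_weight s x > 0" for x :: 'a by (rule sobolev_weight_pos)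
    qed simp_all
    finally have b1: "norm (\<integral>x. ?g x * ?\<delta> x \<partial>lborel) \<le> B * (1 + norm \<xi>) ^ K" by simp
    have "norm (\<integral>x. ?g x * \<phi> N x \<partial>lborel) \<le> D"
      unfolding D_def
    proof (rule order_trans[OF integral_norm_bound integral_mono'])
      show "integrable lborel (\<lambda>x. norm (\<phi> N x) * H)" using schwartz_integrable[OF \<phi>] by (intro integrable_mult_left integrable_norm)
      show "norm (?g x * \<phi> N x) \<le> norm (\<phi> N x) * H" for x
        using mult_left_mono[OF H(2)[of x], of "norm (\<phi> N x)"] by (simp add: norm_mult mult.commute)
    qed (use H in simp)
    also have "D \<le> D * (1 + norm \<xi>) ^ K" using mult_left_mono[OF one_le_power[of "1 + norm \<xi>" K] D0] by simp
    finally have b2: "norm (\<integral>x. ?g x * \<phi> N x \<partial>lborel) \<le> D * (1 + norm \<xi>) ^ K" .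
    have "norm (F n \<xi>) = ?c * norm (\<integral>x. \<phi> (n + N) x * ?g x \<partial>lborel)" unfolding F_eq norm_mult by simp
    also have "\<dots> \<le> ?c * (B * (1 + norm \<xi>) ^ K + D * (1 + norm \<xi>) ^ K)"
      using split b1 b2 by (intro mult_left_mono) auto
    finally show ?thesis by (simp add: algebra_simps)
  qed
  show ?thesis
  proof (rule that)
    show "F n \<in> borel_measurable borel" for n unfolding F_def by (intro schwartz_measurable fourier_schwartz prod)
    show "(\<lambda>n. F n \<xi>) \<longlonglongrightarrow> hat \<xi>" for \<xi>
      unfolding F_eq hat_def using LIMSEQ_ignore_initial_segment[OF lim[OF he], of N] by (intro tendsto_mult tendsto_const)
    show "norm (F n \<xi>) \<le> (?c * (B + D)) * (1 + norm \<xi>) ^ K" for n \<xi> by (rule bound)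
    fix \<theta> :: "'a \<Rightarrow> complex" assume \<theta>: "\<theta> \<in> schwartz_space"
    have h\<theta>: "(\<lambda>x. ?h x * fourier \<theta> x) \<in> schwartz_space"
      by (intro test_in_schwartz test_mult cutoff_test smooth_fourier \<theta>)
    have "(\<integral>\<xi>. F n \<xi> * \<theta> \<xi> \<partial>lborel) = (\<integral>x. \<phi> (n + N) x * (?h x * fourier \<theta> x) \<partial>lborel)" for n
      using fourier_multiplication_formula[OF schwartz_integrable[OF prod] schwartz_integrable[OF \<theta>], of "n + N"]
      by (simp add: F_def mult_ac)
    \<comment> \<open>The limit is f applied to the cutoff times \<open>fourier \<theta>\<close>;
      the cutoff may be dropped although \<open>fourier \<theta>\<close> need not have compact
      support.\<close>
    then show "(\<lambda>n. \<integral>\<xi>. F n \<xi> * \<theta> \<xi> \<partial>lborel) \<longlonglongrightarrow> f (fourier \<theta>)"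
      using LIMSEQ_ignore_initial_segment[OF lim[OF h\<theta>], of N] cutoff_schwartz[OF fourier_schwartz[OF \<theta>]] by simp
  qed
qed

lemma hat_measurable[measurable]: "hat \<in> borel_measurable borel"
proof -
  obtain F where "\<And>n. F n \<in> borel_measurable borel" "\<And>\<xi>. (\<lambda>n. F n \<xi>) \<longlonglongrightarrow> hat \<xi>"
    by (rule hat_approximation) (rule that)
  then show ?thesis by (intro borel_measurable_LIMSEQ_metric[of F borel hat]) auto
qed

text \<open>Both sides are limits of the integrals of \<open>F n\<close> against \<theta>. The
  polynomial bound on \<open>F n\<close> passes to \<open>hat\<close> and, times the decay of
  \<theta>, gives the integrable majorant.\<close>

lemma hat_dual:
  assumes \<theta>: "\<theta> \<in> schwartz_space"
  shows "integrable lborel (\<lambda>\<xi>. hat \<xi> * \<theta> \<xi>)" "(\<integral>\<xi>. hat \<xi> * \<theta> \<xi> \<partial>lborel) = f (fourier \<theta>)"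
proof -
  obtain F C K where F: "\<And>n. F n \<in> borel_measurable borel" "\<And>\<xi>. (\<lambda>n. F n \<xi>) \<longlonglongrightarrow> hat \<xi>"
    "\<And>n \<xi>. norm (F n \<xi>) \<le> C * (1 + norm \<xi>) ^ K"
    "\<And>\<theta>. \<theta> \<in> schwartz_space \<Longrightarrow> (\<lambda>n. \<integral>\<xi>. F n \<xi> * \<theta> \<xi> \<partial>lborel) \<longlonglongrightarrow> f (fourier \<theta>)"
    by (rule hat_approximation) (rule that)
  have "norm (hat \<xi>) \<le> C * (1 + norm \<xi>) ^ K" for \<xi>
    by (rule LIMSEQ_le_const2[OF tendsto_norm[OF F(2)]]) (use F(3) in auto)
  then show "integrable lborel (\<lambda>\<xi>. hat \<xi> * \<theta> \<xi>)" by (rule integrable_slow_schwartz[OF hat_measurable _ \<theta>])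
  note [measurable] = F(1) schwartz_measurable[OF \<theta>]
  have C0: "C \<ge> 0" using order_trans[OF norm_ge_zero F(3)[of 0 0]] by simp
  have "(\<lambda>n. \<integral>\<xi>. F n \<xi> * \<theta> \<xi> \<partial>lborel) \<longlonglongrightarrow> (\<integral>\<xi>. hat \<xi> * \<theta> \<xi> \<partial>lborel)"
  proof (rule integral_dominated_convergence[where w="\<lambda>\<xi>. norm (of_real (C * (1 + norm \<xi>) ^ K) * \<theta> \<xi>)"])
    show "integrable lborel (\<lambda>\<xi>. norm (of_real (C * (1 + norm \<xi>) ^ K) * \<theta> \<xi>))"
    proof (intro integrable_norm integrable_slow_schwartz[of _ C K, OF _ _ \<theta>])
      show "norm (complex_of_real (C * (1 + norm \<xi>) ^ K)) \<le> C * (1 + norm \<xi>) ^ K" for \<xi> :: 'a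
        unfolding norm_of_real using C0 by simp
    qed measurable
    show "AE \<xi> in lborel. (\<lambda>n. F n \<xi> * \<theta> \<xi>) \<longlonglongrightarrow> hat \<xi> * \<theta> \<xi>" by (intro AE_I2 tendsto_mult F(2) tendsto_const)
    show "AE \<xi> in lborel. norm (F n \<xi> * \<theta> \<xi>) \<le> norm (of_real (C * (1 + norm \<xi>) ^ K) * \<theta> \<xi>)" for n
    proof (rule AE_I2)
      fix \<xi>
      have "norm (F n \<xi>) * norm (\<theta> \<xi>) \<le> (C * (1 + norm \<xi>) ^ K) * norm (\<theta> \<xi>)" by (intro mult_right_mono F(3)) simp
      then show "norm (F n \<xi> * \<theta> \<xi>) \<le> norm (of_real (C * (1 + norm \<xi>) ^ K) * \<theta> \<xi>)"
        unfolding norm_mult norm_of_real using C0 by simp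
    qed
  qed measurable
  then show "(\<integral>\<xi>. hat \<xi> * \<theta> \<xi> \<partial>lborel) = f (fourier \<theta>)" using F(4)[OF \<theta>] LIMSEQ_unique by blast
qed

lemma dist_fourier_props:
  shows dist_fourier_measurable: "dist_fourier f \<in> borel_measurable borel"
    and dist_fourier_integrable: "\<theta> \<in> schwartz_space \<Longrightarrow> integrable lborel (\<lambda>\<xi>. dist_fourier f \<xi> * \<theta> \<xi>)"
    and dist_fourier_dual: "\<theta> \<in> schwartz_space \<Longrightarrow> (\<integral>\<xi>. dist_fourier f \<xi> * \<theta> \<xi> \<partial>lborel) = f (fourier \<theta>)"
proof -
  have "\<exists>g. g \<in> borel_measurable borel \<and> (\<forall>\<phi>\<in>schwartz_space. integrable lborel (\<lambda>\<xi>. g \<xi> * \<phi> \<xi>) \<and> (\<integral>\<xi>. g \<xi> * \<phi> \<xi> \<partial>lborel) = f (fourier \<phi>))"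
    using hat_measurable hat_dual by blast
  from someI_ex[OF this, folded dist_fourier_def]
  show "dist_fourier f \<in> borel_measurable borel" "\<theta> \<in> schwartz_space \<Longrightarrow> integrable lborel (\<lambda>\<xi>. dist_fourier f \<xi> * \<theta> \<xi>)"
    "\<theta> \<in> schwartz_space \<Longrightarrow> (\<integral>\<xi>. dist_fourier f \<xi> * \<theta> \<xi> \<partial>lborel) = f (fourier \<theta>)" by auto
qed

lemma dist_fourier_eq_hat: "AE \<xi> in lborel. dist_fourier f \<xi> = hat \<xi>"
proof -
  note [measurable] = dist_fourier_measurable
  have "AE \<xi> in lborel. dist_fourier f \<xi> - hat \<xi> = 0"
  proof (rule AE_zero_of_test_integrals)
    fix \<theta> :: "'a \<Rightarrow> complex" assume "\<theta> \<in> test_functions"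
    then have \<theta>: "\<theta> \<in> schwartz_space" by (rule test_in_schwartz)
    show "integrable lborel (\<lambda>x. (dist_fourier f x - hat x) * \<theta> x)"
      using dist_fourier_integrable[OF \<theta>] hat_dual(1)[OF \<theta>] by (simp add: left_diff_distrib)
    show "(\<integral>x. (dist_fourier f x - hat x) * \<theta> x \<partial>lborel) = 0"
      using dist_fourier_integrable[OF \<theta>] hat_dual[OF \<theta>] dist_fourier_dual[OF \<theta>] by (simp add: left_diff_distrib)
  qed measurable
  then show ?thesis by simp
qed

lemma sobolev_norm_eq:
  "sobolev_norm s f = ennreal_sqrt (\<integral>\<^sup>+\<xi>. ennreal (sobolev_weight s \<xi> * (norm (hat \<xi>))\<^sup>2) \<partial>lborel)"
  unfolding sobolev_norm_def weighted_L2_norm_def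
  by (intro arg_cong[where f=ennreal_sqrt] nn_integral_cong_AE eventually_mono[OF dist_fourier_eq_hat]) simp

lemma hat_cutoff: "is_cutoff h \<Longrightarrow> hat \<xi> = of_real (fconst TYPE('a)) * f (\<lambda>x. h x * cis (- (x \<bullet> \<xi>)))"
  unfolding hat_def by (simp only: cutoff_independent[OF cutoff_is_cutoff _ smooth_cis_inner])

end

text \<open>\<open>hat \<xi>\<close> is the integral of \<open>dist_fourier f\<close> against
  \<open>modulated_dual h \<xi>\<close>, hence at most the Sobolev norm of f times the dual norm.
  Since B is fixed before f and comes from h and s alone, the upper estimate will be uniform in
  f.\<close>

lemma hat_pointwise_bound:
  fixes h :: "'a::euclidean_space \<Rightarrow> complex"
  assumes h: "h \<in> test_functions"
  obtains B where "B > 0"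
    "\<And>f \<xi> X. compact_sobolev f s \<Longrightarrow> tempered.is_cutoff f h \<Longrightarrow> norm \<xi> \<le> 1 \<Longrightarrow> X \<ge> 0 \<Longrightarrow> sobolev_norm s f = ennreal X \<Longrightarrow>
      norm (compact_sobolev.hat f \<xi>) \<le> B * X"
proof -
  let ?c = "fconst TYPE('a)"
  obtain B K where B: "B > 0"
    "\<And>\<xi>. (\<integral>\<^sup>+\<zeta>. ennreal (inverse (sobolev_weight s \<zeta>) * (norm (modulated_dual h \<xi> \<zeta>))\<^sup>2) \<partial>lborel) \<le> ennreal ((B * (1 + norm \<xi>) ^ K)\<^sup>2)"
    by (rule modulated_dual_norm[OF h, of s]) (rule that)
  show ?thesis
  proof (rule that[of "?c * (B * 2 ^ K)"])
    show "0 < ?c * (B * 2 ^ K)" using B(1) by simp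
    fix f X and \<xi> :: 'a
    assume f: "compact_sobolev f s" and cut: "tempered.is_cutoff f h" and \<xi>: "norm \<xi> \<le> 1" and X: "X \<ge> 0" "sobolev_norm s f = ennreal X"
    interpret compact_sobolev f s by fact
    have dual: "hat \<xi> = of_real ?c * (\<integral>\<zeta>. dist_fourier f \<zeta> * modulated_dual h \<xi> \<zeta> \<partial>lborel)"
      using hat_cutoff[OF cut, of \<xi>] modulated_dual[OF h, of \<xi>] dist_fourier_dual[OF modulated_dual(1)[OF h]] by simp
    \<comment> \<open>The weighted estimate divides by its bounds and X may be 0; so X is enlarged
      by e, which then tends to 0.\<close>
    have b: "norm (\<integral>\<zeta>. dist_fourier f \<zeta> * modulated_dual h \<xi> \<zeta> \<partial>lborel) \<le> (X + e) * (B * (1 + norm \<xi>) ^ K)" if e: "e > 0" for e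
    proof (rule norm_integral_le_weighted[where w="sobolev_weight s"])
      show "dist_fourier f \<in> borel_measurable borel" by (rule dist_fourier_measurable)
      show "modulated_dual h \<xi> \<in> borel_measurable borel" by (intro schwartz_measurable modulated_dual(1) h)
      show "0 < B * (1 + norm \<xi>) ^ K" using B(1) by (simp add: add_pos_nonneg)
      show "(\<integral>\<^sup>+x. ennreal (sobolev_weight s x * (norm (dist_fourier f x))\<^sup>2) \<partial>lborel) \<le> ennreal ((X + e)\<^sup>2)"
        using X e by (intro weighted_L2_norm_less_imp) (simp_all add: sobolev_norm_def[symmetric] ennreal_less_iff)
      show "(\<integral>\<^sup>+x. ennreal (inverse (sobolev_weight s x) * (norm (modulated_dual h \<xi> x))\<^sup>2) \<partial>lborel) \<le> ennreal ((B * (1 + norm \<xi>) ^ K)\<^sup>2)"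
        by (rule B(2))
      show "sobolev_weight s x > 0" for x :: 'a by (rule sobolev_weight_pos)
    qed (use X e in simp_all)
    have "norm (\<integral>\<zeta>. dist_fourier f \<zeta> * modulated_dual h \<xi> \<zeta> \<partial>lborel) \<le> X * (B * (1 + norm \<xi>) ^ K)"
    proof (rule tendsto_lowerbound)
      show "((\<lambda>e. (X + e) * (B * (1 + norm \<xi>) ^ K)) \<longlongrightarrow> X * (B * (1 + norm \<xi>) ^ K)) (at_right 0)"
        by (auto intro!: tendsto_eq_intros)
      show "eventually (\<lambda>e. norm (\<integral>\<zeta>. dist_fourier f \<zeta> * modulated_dual h \<xi> \<zeta> \<partial>lborel) \<le> (X + e) * (B * (1 + norm \<xi>) ^ K)) (at_right 0)"
        unfolding eventually_at_right_field using b by (intro exI[of _ 1]) auto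
    qed simp
    also have "\<dots> \<le> X * (B * 2 ^ K)"
      using X(1) B(1) \<xi> by (intro mult_left_mono power_mono) auto
    finally have "?c * norm (\<integral>\<zeta>. dist_fourier f \<zeta> * modulated_dual h \<xi> \<zeta> \<partial>lborel) \<le> ?c * (X * (B * 2 ^ K))"
      by (intro mult_left_mono) auto
    then show "norm (hat \<xi>) \<le> ?c * (B * 2 ^ K) * X"
      unfolding dual norm_mult by (simp add: mult_ac)
  qed
qed

section \<open>The stability estimate\<close>

lemma ennreal_sqrt_mono: "t \<le> u \<Longrightarrow> ennreal_sqrt t \<le> ennreal_sqrt u"
  by (cases t; cases u) (auto simp: ennreal_sqrt_def ennreal_le_iff top_unique intro!: ennreal_leI)

lemma ennreal_sqrt_cmult:
  assumes "c > 0"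
  shows "ennreal_sqrt (ennreal (c\<^sup>2) * t) = ennreal c * ennreal_sqrt t"
proof (cases t)
  case (real r)
  then show ?thesis using assms
    by (simp add: ennreal_sqrt_def ennreal_mult[symmetric] real_sqrt_mult)
next
  case top
  then show ?thesis using assms by (simp add: ennreal_sqrt_def ennreal_mult_top)
qed

lemma ennreal_sqrt_eq_imp:
  assumes "ennreal_sqrt t = ennreal X" "X \<ge> 0"
  shows "t = ennreal (X\<^sup>2)"
proof (cases t)
  case (real r)
  then have "sqrt r = X" using assms by (simp add: ennreal_sqrt_def)
  then show ?thesis using real by auto
next
  case top
  then show ?thesis using assms by (simp add: ennreal_sqrt_def)
qed

text \<open>These are the bounds on the ratio of the two weights: at least 1 throughout, and at most
  \<open>2 ^ k\<close> away from the unit ball.\<close>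

lemma pow_le_weight:
  fixes r :: real
  assumes "r \<ge> 0"
  shows "r ^ k \<le> (1 + r\<^sup>2) powr (real k / 2)" and "r \<ge> 1 \<Longrightarrow> (1 + r\<^sup>2) powr (real k / 2) \<le> 2 ^ k * r ^ k"
proof -
  have pos: "1 + r\<^sup>2 > 0" by (simp add: add_pos_nonneg)
  have eq: "(1 + r\<^sup>2) powr (real k / 2) = sqrt (1 + r\<^sup>2) ^ k"
    using pos by (simp add: powr_half_sqrt[symmetric] powr_realpow[symmetric] powr_powr)
  have "r \<le> sqrt (1 + r\<^sup>2)" using assms by (simp add: real_le_rsqrt)
  then show "r ^ k \<le> (1 + r\<^sup>2) powr (real k / 2)" unfolding eq using assms by (intro power_mono)
  assume r: "r \<ge> 1"
  have "1 \<le> r\<^sup>2" using r by (simp add: one_le_power)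
  then have "1 + r\<^sup>2 \<le> (2 * r)\<^sup>2" by (simp add: power2_eq_square)
  then have "sqrt (1 + r\<^sup>2) \<le> 2 * r" using assms by (intro real_le_lsqrt) auto
  then show "(1 + r\<^sup>2) powr (real k / 2) \<le> 2 ^ k * r ^ k"
    unfolding eq power_mult_distrib[symmetric] by (intro power_mono) auto
qed

lemma two_pi_powr_half_sq: "((2 * pi) powr (real k / 2))\<^sup>2 = (2 * pi) ^ k"
proof -
  have "((2 * pi) powr (real k / 2))\<^sup>2 = (2 * pi) powr (real k / 2 + real k / 2)"
    by (simp only: power2_eq_square powr_add)
  also have "\<dots> = (2 * pi) powr real k" by (simp only: field_sum_of_halves)
  also have "\<dots> = (2 * pi) ^ k" by (rule powr_realpow) simp
  finally show ?thesis .
qed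

locale kplane_setting = grassmannian_measure k \<mu> + compact_sobolev f s
  for k and \<mu> :: "'a::euclidean_space set measure" and f :: "('a \<Rightarrow> complex) \<Rightarrow> complex" and s
begin

text \<open>The integrand of the fiber norm, continued from the complements to the whole space. The
  factor \<open>(2 * pi) ^ k\<close> is the square of the discrepancy between the Fourier
  normalizations in dimensions \<open>DIM('a)\<close> and \<open>DIM('a) - k\<close>.\<close>

definition fiber_density :: "'a \<Rightarrow> real" where
  "fiber_density \<xi> = (1 + (norm \<xi>)\<^sup>2) powr (s + real k / 2) * ((2 * pi) ^ k * (norm (hat \<xi>))\<^sup>2)"

text \<open>The Fourier slice theorem. For \<eta> in the fiber the exponential does not see the
  projection, so f is applied to the same function on both sides, up to the powers of
  \<open>2 * pi\<close> that normalize the transforms.\<close>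

lemma fiber_fourier_hat:
  assumes a: "\<alpha> \<in> space \<mu>" and \<eta>: "\<eta> \<in> \<alpha>\<^sup>\<bottom>"
  shows "fiber_fourier (kplane_transform f) \<alpha> \<eta> = of_real ((2 * pi) powr (real k / 2)) * hat \<eta>"
proof -
  have eq: "orth_proj (\<alpha>\<^sup>\<bottom>) x \<bullet> \<eta> = x \<bullet> \<eta>" for x
    by (rule inner_orth_proj[OF subspace_orthogonal_comp \<eta>])
  have "- real (DIM('a) - k) / 2 = real k / 2 + - real DIM('a) / 2"
    using k by (simp add: of_nat_diff field_simps)
  then have c: "(2 * pi) powr (- real (DIM('a) - k) / 2) = (2 * pi) powr (real k / 2) * fconst TYPE('a)"
    by (simp only: powr_add)
  show ?thesis
    unfolding fiber_fourier_def kplane_transform_def pairing_def grassmannianD(3)[OF a] c hat_def of_real_mult o_def eq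
    by (simp only: mult.assoc)
qed

lemma affine_norm_eq:
  "affine_grassmannian_sobolev_norm \<mu> (s + real k / 2) (kplane_transform f) =
    ennreal_sqrt (\<integral>\<^sup>+\<alpha>. fiber_integral (\<lambda>\<eta>. ennreal (fiber_density \<eta>)) \<alpha> \<partial>\<mu>)"
  unfolding affine_grassmannian_sobolev_norm_def
proof (rule arg_cong[where f=ennreal_sqrt], rule nn_integral_cong)
  fix \<alpha> assume a: "\<alpha> \<in> space \<mu>"
  show "(\<integral>\<^sup>+\<eta>. ennreal ((1 + (norm \<eta>)\<^sup>2) powr (s + real k / 2) * (norm (fiber_fourier (kplane_transform f) \<alpha> \<eta>))\<^sup>2) \<partial>subspace_lborel (\<alpha>\<^sup>\<bottom>)) =
    fiber_integral (\<lambda>\<eta>. ennreal (fiber_density \<eta>)) \<alpha>"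
  \<comment> \<open>The slice identity is available only on the complement of \<alpha>, where the
    fiber measure is concentrated.\<close>
  proof (rule nn_integral_cong_AE, rule eventually_mono[OF AE_subspace_lborel[OF subspace_orthogonal_comp]])
    fix \<eta> assume \<eta>: "\<eta> \<in> \<alpha>\<^sup>\<bottom>"
    have "((2 * pi) powr (real k / 2))\<^sup>2 = (2 * pi) ^ k"
      by (rule two_pi_powr_half_sq)
    then have "(norm (fiber_fourier (kplane_transform f) \<alpha> \<eta>))\<^sup>2 = (2 * pi) ^ k * (norm (hat \<eta>))\<^sup>2"
      unfolding fiber_fourier_hat[OF a \<eta>] norm_mult power_mult_distrib by simp
    then show "ennreal ((1 + (norm \<eta>)\<^sup>2) powr (s + real k / 2) * (norm (fiber_fourier (kplane_transform f) \<alpha> \<eta>))\<^sup>2) = ennreal (fiber_density \<eta>)"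
      by (simp add: fiber_density_def)
  qed
qed

lemma fiber_density_measurable[measurable]: "fiber_density \<in> borel_measurable borel"
  unfolding fiber_density_def by measurable

lemma fiber_density_split:
  "fiber_density \<xi> = (1 + (norm \<xi>)\<^sup>2) powr (real k / 2) * ((2 * pi) ^ k * (sobolev_weight s \<xi> * (norm (hat \<xi>))\<^sup>2))"
  unfolding fiber_density_def powr_add by (simp only: mult_ac)

lemma fiber_density_lower:
  assumes "\<xi> \<noteq> 0"
  shows "(2 * pi) ^ k * (sobolev_weight s \<xi> * (norm (hat \<xi>))\<^sup>2) \<le> fiber_density \<xi> * inverse (norm \<xi> ^ k)"
proof -
  let ?q = "(2 * pi) ^ k * (sobolev_weight s \<xi> * (norm (hat \<xi>))\<^sup>2)"
  have q: "?q \<ge> 0" by simp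
  have n: "norm \<xi> ^ k > 0" using assms by simp
  have "norm \<xi> ^ k * ?q \<le> fiber_density \<xi>"
    unfolding fiber_density_split by (intro mult_right_mono pow_le_weight q) simp
  then show ?thesis using n by (simp add: field_simps)
qed

text \<open>Off the unit ball the ratio of the weights is bounded. Inside, the ratio blows up, so
  \<open>hat\<close> is replaced by its bound Y; what remains is a multiple of
  \<open>inverse (norm \<xi> ^ k)\<close>, whose integral over the ball will be finite.\<close>

lemma fiber_density_upper:
  assumes "\<xi> \<noteq> 0" and bd: "norm \<xi> \<le> 1 \<Longrightarrow> norm (hat \<xi>) \<le> Y"
  shows "fiber_density \<xi> * inverse (norm \<xi> ^ k) \<le> 2 ^ k * (2 * pi) ^ k * (sobolev_weight s \<xi> * (norm (hat \<xi>))\<^sup>2)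
     + (2 powr \<bar>s + real k / 2\<bar> * ((2 * pi) ^ k * Y\<^sup>2)) * (indicator (ball 0 1) \<xi> * inverse (norm \<xi> ^ k))"
proof (cases "norm \<xi> < 1")
  case True
  \<comment> \<open>The exponent may have either sign; its absolute value gives a bound by a power
    of 2 on the ball in both cases.\<close>
  have "(1 + (norm \<xi>)\<^sup>2) powr (s + real k / 2) \<le> (1 + (norm \<xi>)\<^sup>2) powr \<bar>s + real k / 2\<bar>"
    by (intro powr_mono) auto
  also have "\<dots> \<le> 2 powr \<bar>s + real k / 2\<bar>"
    using True by (intro powr_mono2) (auto simp: power_le_one add_nonneg_nonneg)
  finally have "fiber_density \<xi> \<le> 2 powr \<bar>s + real k / 2\<bar> * ((2 * pi) ^ k * Y\<^sup>2)"
    unfolding fiber_density_def using bd True by (intro mult_mono power_mono) auto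
  then have "fiber_density \<xi> * inverse (norm \<xi> ^ k) \<le> (2 powr \<bar>s + real k / 2\<bar> * ((2 * pi) ^ k * Y\<^sup>2)) * inverse (norm \<xi> ^ k)"
    by (intro mult_right_mono) auto
  also have "\<dots> = (2 powr \<bar>s + real k / 2\<bar> * ((2 * pi) ^ k * Y\<^sup>2)) * (indicator (ball 0 1) \<xi> * inverse (norm \<xi> ^ k))"
    using True by simp
  finally show ?thesis by (rule order_trans) simp
next
  case False
  let ?q = "(2 * pi) ^ k * (sobolev_weight s \<xi> * (norm (hat \<xi>))\<^sup>2)"
  have n: "norm \<xi> ^ k > 0" using assms by simp
  have "fiber_density \<xi> \<le> 2 ^ k * norm \<xi> ^ k * ?q"
    unfolding fiber_density_split using False by (intro mult_right_mono pow_le_weight) auto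
  then have "fiber_density \<xi> * inverse (norm \<xi> ^ k) \<le> 2 ^ k * norm \<xi> ^ k * ?q * inverse (norm \<xi> ^ k)"
    using n by (intro mult_right_mono) auto
  also have "\<dots> = 2 ^ k * (2 * pi) ^ k * (sobolev_weight s \<xi> * (norm (hat \<xi>))\<^sup>2)"
  proof -
    have "norm \<xi> ^ k * inverse (norm \<xi> ^ k) = 1" by (rule right_inverse[OF less_imp_neq[OF n, THEN not_sym]])
    moreover have "2 ^ k * norm \<xi> ^ k * ?q * inverse (norm \<xi> ^ k) = 2 ^ k * ?q * (norm \<xi> ^ k * inverse (norm \<xi> ^ k))"
      by (simp only: mult_ac)
    ultimately show ?thesis by (simp only: mult_1_right mult.assoc)
  qed
  finally show ?thesis by (rule order_trans) simp
qed

end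

lemma compact_sobolevI:
  fixes f :: "('a::euclidean_space \<Rightarrow> complex) \<Rightarrow> complex"
  assumes "f \<in> sobolev_space s" "bounded \<Omega>" "dist_support f \<subseteq> closure \<Omega>"
  shows "compact_sobolev f s"
proof
  show "tempered_distribution f" using assms(1) by (simp add: sobolev_space_def)
  show "bounded (dist_support f)" using assms(2,3) bounded_subset bounded_closure by blast
qed (rule assms(1))

text \<open>The selected \<open>cutoff f\<close> varies with f. A single h for all distributions
  supported in the closure of \<Omega> is what makes the upper constant independent of f.\<close>

lemma common_cutoff:
  fixes \<Omega> :: "'a::euclidean_space set"
  assumes "bounded \<Omega>"
  obtains h where "h \<in> test_functions"
    "\<And>f. tempered f \<Longrightarrow> dist_support f \<subseteq> closure \<Omega> \<Longrightarrow> tempered.is_cutoff f h"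
proof -
  obtain r where r: "r > 0" "\<And>x. x \<in> closure \<Omega> \<Longrightarrow> norm x \<le> r"
    using bounded_closure[OF assms] bounded_pos by blast
  obtain h where h: "h \<in> test_functions" "\<And>y. y \<in> cball (0::'a) (r + 1) \<Longrightarrow> h y = 1"
    by (rule bump_exists[of "r + 1" "r + 2" "0::'a"]) (use r(1) in \<open>simp, simp, blast\<close>)
  show ?thesis
  proof (rule that[OF h(1)])
    fix f assume "tempered f" and sub: "dist_support f \<subseteq> closure \<Omega>"
    then interpret tempered f by simp
    have "dist_support f \<subseteq> ball 0 (r + 1)"
    proof
      fix x assume "x \<in> dist_support f"
      then have "norm x \<le> r" using sub r(2) by blast
      then show "x \<in> ball 0 (r + 1)" by simp
    qed
    moreover have "\<forall>x\<in>ball 0 (r + 1). h x = 1" using h(2) by simp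
    ultimately show "is_cutoff h" unfolding is_cutoff_def using h(1) open_ball by blast
  qed
qed

theorem theorem4p1:
  fixes s :: real and k :: nat and \<mu> :: "'a::euclidean_space set measure"
  assumes "DIM('a) \<ge> 2"
    and "1 \<le> k" and "k \<le> DIM('a) - 1"
    and "invariant_grassmannian_measure k \<mu>"
  shows "\<exists>c::real. c > 0 \<and>
    (\<forall>\<Omega>::'a set. open \<Omega> \<and> bounded \<Omega> \<longrightarrow>
      (\<exists>C::real. C > 0 \<and>
        (\<forall>f::('a \<Rightarrow> complex) \<Rightarrow> complex.
           f \<in> sobolev_space s \<and> dist_support f \<subseteq> closure \<Omega> \<longrightarrow>
             ennreal c * sobolev_norm s f
               \<le> affine_grassmannian_sobolev_norm \<mu> (s + real k / 2) (kplane_transform f) \<and>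
             affine_grassmannian_sobolev_norm \<mu> (s + real k / 2) (kplane_transform f)
               \<le> ennreal C * sobolev_norm s f)))"
proof -
  have gm: "grassmannian_measure k \<mu>" by unfold_locales (use assms in auto)
  interpret grassmannian_measure k \<mu> by (rule gm)
  obtain c0 :: real where c0: "c0 > 0"
    and formula: "\<And>g. g \<in> borel_measurable borel \<Longrightarrow> (\<integral>\<^sup>+\<alpha>. fiber_integral g \<alpha> \<partial>\<mu>) = ennreal c0 * (\<integral>\<^sup>+x. g x * ennreal (inverse (norm x ^ k)) \<partial>lborel)"
    by (rule fiber_integral_formula) (rule that)
  \<comment> \<open>Squared, this is the constant of the integral formula times the factor
    \<open>(2 * pi) ^ k\<close> of \<open>fiber_density\<close>; the ratio of the weights enters
    through its lower bound 1.\<close>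
  define c where "c = sqrt (c0 * (2 * pi) ^ k)"
  have c: "c > 0" "c\<^sup>2 = c0 * (2 * pi) ^ k" using c0 by (simp_all add: c_def)
  \<comment> \<open>By the integral formula, c0 times the integral of
    \<open>inverse (norm x ^ k)\<close> over the unit ball is the \<open>nu\<close>-measure of that
    ball, which gives its finiteness.\<close>
  have "emeasure nu (ball 0 1) \<le> emeasure nu (cball 0 1)" by (intro emeasure_mono ball_subset_cball) simp
  then have "emeasure nu (ball 0 1) < \<infinity>" using nu_cball_finite[of 1] by (rule le_less_trans)
  then obtain V where V: "emeasure nu (ball 0 1) = ennreal V" "V \<ge> 0" by (cases "emeasure nu (ball 0 1)") auto
  have ball_mass: "ennreal c0 * (\<integral>\<^sup>+x. indicator (ball 0 1) x * ennreal (inverse (norm x ^ k)) \<partial>(lborel :: 'a measure)) = ennreal V"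
  proof -
    have "(indicator (ball 0 1) :: 'a \<Rightarrow> ennreal) \<in> borel_measurable borel" by (intro borel_measurable_indicator borel_open open_ball)
    from formula[OF this] nn_integral_nu[OF this] V show ?thesis by simp
  qed
  have lower: "ennreal c * sobolev_norm s f \<le> affine_grassmannian_sobolev_norm \<mu> (s + real k / 2) (kplane_transform f)"
    if f: "compact_sobolev f s" for f
  proof -
    interpret kplane_setting k \<mu> f s using gm f by (rule kplane_setting.intro)
    let ?q = "\<lambda>\<xi>. sobolev_weight s \<xi> * (norm (hat \<xi>))\<^sup>2"
    have "ennreal (c\<^sup>2) * (\<integral>\<^sup>+\<xi>. ennreal (?q \<xi>) \<partial>lborel) = ennreal c0 * (\<integral>\<^sup>+\<xi>. ennreal ((2 * pi) ^ k * ?q \<xi>) \<partial>lborel)"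
      using c0 by (simp add: c(2) ennreal_mult nn_integral_cmult mult.assoc)
    also have "\<dots> \<le> ennreal c0 * (\<integral>\<^sup>+\<xi>. ennreal (fiber_density \<xi>) * ennreal (inverse (norm \<xi> ^ k)) \<partial>lborel)"
    proof (intro mult_left_mono nn_integral_mono_AE, rule eventually_mono[OF AE_lborel_singleton[of 0]])
      fix \<xi> :: 'a assume "\<xi> \<noteq> 0"
      from fiber_density_lower[OF this] show "ennreal ((2 * pi) ^ k * ?q \<xi>) \<le> ennreal (fiber_density \<xi>) * ennreal (inverse (norm \<xi> ^ k))"
        by (subst ennreal_mult[symmetric]) (auto simp: fiber_density_def intro: ennreal_leI)
    qed simp
    also have "\<dots> = (\<integral>\<^sup>+\<alpha>. fiber_integral (\<lambda>\<eta>. ennreal (fiber_density \<eta>)) \<alpha> \<partial>\<mu>)"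
      by (rule formula[symmetric]) measurable
    finally have "ennreal_sqrt (ennreal (c\<^sup>2) * (\<integral>\<^sup>+\<xi>. ennreal (?q \<xi>) \<partial>lborel)) \<le> affine_grassmannian_sobolev_norm \<mu> (s + real k / 2) (kplane_transform f)"
      unfolding affine_norm_eq by (rule ennreal_sqrt_mono)
    then show ?thesis unfolding sobolev_norm_eq ennreal_sqrt_cmult[OF c(1)] .
  qed
  have upper: "\<exists>C::real. C > 0 \<and> (\<forall>f. f \<in> sobolev_space s \<and> dist_support f \<subseteq> closure \<Omega> \<longrightarrow>
      affine_grassmannian_sobolev_norm \<mu> (s + real k / 2) (kplane_transform f) \<le> ennreal C * sobolev_norm s f)"
    if \<Omega>: "bounded \<Omega>" for \<Omega> :: "'a set"
  proof -
    obtain h where h: "h \<in> test_functions"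
      "\<And>f. tempered f \<Longrightarrow> dist_support f \<subseteq> closure \<Omega> \<Longrightarrow> tempered.is_cutoff f h"
      by (rule common_cutoff[OF \<Omega>]) (rule that)
    obtain B where B: "B > 0"
      "\<And>f \<xi> X. compact_sobolev f s \<Longrightarrow> tempered.is_cutoff f h \<Longrightarrow> norm \<xi> \<le> 1 \<Longrightarrow> X \<ge> 0 \<Longrightarrow> sobolev_norm s f = ennreal X \<Longrightarrow>
        norm (compact_sobolev.hat f \<xi>) \<le> B * X"
      by (rule hat_pointwise_bound[OF h(1), of s]) (rule that)
    \<comment> \<open>The square of C collects two contributions: a from the bounded ratio of the
      weights, and \<open>b * V\<close> from the unit ball with the pointwise bound
      \<open>B * X\<close> on \<open>hat\<close>. The factor c0 is explicit in a and contained in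
      V.\<close>
    define a where "a = c0 * (2 ^ k * (2 * pi) ^ k)"
    define b where "b = 2 powr \<bar>s + real k / 2\<bar> * ((2 * pi) ^ k * B\<^sup>2)"
    define C where "C = sqrt (a + b * V)"
    have a: "a > 0" and b: "b \<ge> 0" using c0 by (auto simp: a_def b_def)
    have C: "C > 0" "C\<^sup>2 = a + b * V" using a b V(2) by (auto simp: C_def add_pos_nonneg)
    have "affine_grassmannian_sobolev_norm \<mu> (s + real k / 2) (kplane_transform f) \<le> ennreal C * sobolev_norm s f"
      if f: "f \<in> sobolev_space s" "dist_support f \<subseteq> closure \<Omega>" for f
    proof (cases "sobolev_norm s f")
      case top
      then show ?thesis using C(1) by (simp add: ennreal_mult_top)
    next
      case (real X)
      have cs: "compact_sobolev f s" by (rule compact_sobolevI[OF f(1) \<Omega> f(2)])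
      interpret kplane_setting k \<mu> f s using gm cs by (rule kplane_setting.intro)
      have cut: "is_cutoff h" by (rule h(2)[OF tempered_axioms f(2)])
      let ?q = "\<lambda>\<xi>. sobolev_weight s \<xi> * (norm (hat \<xi>))\<^sup>2"
      have E: "(\<integral>\<^sup>+\<xi>. ennreal (?q \<xi>) \<partial>lborel) = ennreal (X\<^sup>2)"
        using real sobolev_norm_eq by (intro ennreal_sqrt_eq_imp) simp_all
      have ind[measurable]: "ball (0::'a) 1 \<in> sets borel" by (rule borel_open) simp
      have "(\<integral>\<^sup>+\<alpha>. fiber_integral (\<lambda>\<eta>. ennreal (fiber_density \<eta>)) \<alpha> \<partial>\<mu>) =
        ennreal c0 * (\<integral>\<^sup>+\<xi>. ennreal (fiber_density \<xi>) * ennreal (inverse (norm \<xi> ^ k)) \<partial>lborel)"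
        by (rule formula) measurable
      also have "\<dots> \<le> ennreal c0 * (\<integral>\<^sup>+\<xi>. ennreal (2 ^ k * (2 * pi) ^ k) * ennreal (?q \<xi>)
          + ennreal (b * X\<^sup>2) * (indicator (ball 0 1) \<xi> * ennreal (inverse (norm \<xi> ^ k))) \<partial>lborel)"
      proof (intro mult_left_mono nn_integral_mono_AE, rule eventually_mono[OF AE_lborel_singleton[of 0]])
        fix \<xi> :: 'a assume \<xi>: "\<xi> \<noteq> 0"
        have bd: "norm \<xi> \<le> 1 \<Longrightarrow> norm (hat \<xi>) \<le> B * X" by (rule B(2)[OF cs cut _ real(1) real(2)])
        have "ennreal (fiber_density \<xi>) * ennreal (inverse (norm \<xi> ^ k)) = ennreal (fiber_density \<xi> * inverse (norm \<xi> ^ k))"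
          by (rule ennreal_mult[symmetric]) (simp_all add: fiber_density_def)
        also have "\<dots> \<le> ennreal (2 ^ k * (2 * pi) ^ k * ?q \<xi> + b * X\<^sup>2 * (indicator (ball 0 1) \<xi> * inverse (norm \<xi> ^ k)))"
          using fiber_density_upper[OF \<xi> bd] by (intro ennreal_leI) (simp only: b_def power_mult_distrib mult.assoc)
        also have "\<dots> = ennreal (2 ^ k * (2 * pi) ^ k) * ennreal (?q \<xi>) + ennreal (b * X\<^sup>2) * ennreal (indicator (ball 0 1) \<xi> * inverse (norm \<xi> ^ k))"
          using b by (subst ennreal_plus; simp add: ennreal_mult)
        also have "ennreal (indicator (ball 0 1) \<xi> * inverse (norm \<xi> ^ k)) = indicator (ball 0 1) \<xi> * ennreal (inverse (norm \<xi> ^ k))"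
          by (simp add: indicator_def)
        finally show "ennreal (fiber_density \<xi>) * ennreal (inverse (norm \<xi> ^ k)) \<le> ennreal (2 ^ k * (2 * pi) ^ k) * ennreal (?q \<xi>)
          + ennreal (b * X\<^sup>2) * (indicator (ball 0 1) \<xi> * ennreal (inverse (norm \<xi> ^ k)))" .
      qed simp
      also have "\<dots> = ennreal c0 * (ennreal (2 ^ k * (2 * pi) ^ k) * ennreal (X\<^sup>2)
          + ennreal (b * X\<^sup>2) * (\<integral>\<^sup>+\<xi>. indicator (ball 0 1) \<xi> * ennreal (inverse (norm \<xi> ^ k)) \<partial>(lborel :: 'a measure)))"
      proof -
        let ?v = "\<lambda>\<xi>::'a. indicator (ball 0 1) \<xi> * ennreal (inverse (norm \<xi> ^ k))"
        have "(\<integral>\<^sup>+\<xi>. ennreal (2 ^ k * (2 * pi) ^ k) * ennreal (?q \<xi>) + ennreal (b * X\<^sup>2) * ?v \<xi> \<partial>lborel)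
            = (\<integral>\<^sup>+\<xi>. ennreal (2 ^ k * (2 * pi) ^ k) * ennreal (?q \<xi>) \<partial>lborel) + (\<integral>\<^sup>+\<xi>. ennreal (b * X\<^sup>2) * ?v \<xi> \<partial>lborel)"
          by (rule nn_integral_add) measurable
        also have "(\<integral>\<^sup>+\<xi>. ennreal (2 ^ k * (2 * pi) ^ k) * ennreal (?q \<xi>) \<partial>lborel) = ennreal (2 ^ k * (2 * pi) ^ k) * ennreal (X\<^sup>2)"
          unfolding E[symmetric] by (rule nn_integral_cmult) measurable
        also have "(\<integral>\<^sup>+\<xi>. ennreal (b * X\<^sup>2) * ?v \<xi> \<partial>lborel) = ennreal (b * X\<^sup>2) * (\<integral>\<^sup>+\<xi>. ?v \<xi> \<partial>lborel)"
          by (rule nn_integral_cmult) measurable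
        finally show ?thesis by (rule arg_cong[where f="\<lambda>t. ennreal c0 * t"])
      qed
      also have "\<dots> = ennreal (a * X\<^sup>2) + ennreal (b * X\<^sup>2) * ennreal V"
        using c0 unfolding ball_mass[symmetric] by (simp add: a_def distrib_left ennreal_mult mult_ac)
      also have "\<dots> = ennreal (C\<^sup>2) * ennreal (X\<^sup>2)"
        using a b V(2) by (simp add: C(2) ennreal_mult[symmetric] ennreal_plus[symmetric] algebra_simps del: ennreal_plus)
      finally have "affine_grassmannian_sobolev_norm \<mu> (s + real k / 2) (kplane_transform f) \<le> ennreal_sqrt (ennreal (C\<^sup>2) * ennreal (X\<^sup>2))"
        unfolding affine_norm_eq by (rule ennreal_sqrt_mono)
      also have "\<dots> = ennreal C * sobolev_norm s f"
        unfolding ennreal_sqrt_cmult[OF C(1)] real(2)[symmetric] using real by (simp add: ennreal_sqrt_def)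
      finally show ?thesis .
    qed
    with C(1) show ?thesis by blast
  qed
  show ?thesis
  proof (rule exI[of _ c], intro conjI allI impI c(1))
    fix \<Omega> :: "'a set" assume "open \<Omega> \<and> bounded \<Omega>"
    then have \<Omega>: "bounded \<Omega>" by simp
    obtain C where C: "C > 0" "\<And>f. f \<in> sobolev_space s \<and> dist_support f \<subseteq> closure \<Omega> \<Longrightarrow>
      affine_grassmannian_sobolev_norm \<mu> (s + real k / 2) (kplane_transform f) \<le> ennreal C * sobolev_norm s f"
      using upper[OF \<Omega>] by blast
    show "\<exists>C::real. C > 0 \<and>
        (\<forall>f::('a \<Rightarrow> complex) \<Rightarrow> complex.
           f \<in> sobolev_space s \<and> dist_support f \<subseteq> closure \<Omega> \<longrightarrow>
             ennreal c * sobolev_norm s f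
               \<le> affine_grassmannian_sobolev_norm \<mu> (s + real k / 2) (kplane_transform f) \<and>
             affine_grassmannian_sobolev_norm \<mu> (s + real k / 2) (kplane_transform f)
               \<le> ennreal C * sobolev_norm s f)"
      using C lower compact_sobolevI[OF _ \<Omega>] by blast
  qed
qed

end
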